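(* Let $f:\mathbb{R}^d\to\mathbb{R}$ be locally Lipschitz, bounded below by $f^\star$, and satisfy the $(\alpha,\beta)$ subgradient growth condition. Let $\delta>0$ and suppose $f_\delta$ is level-bounded, i.e. $\{\mathbf{x}:f_\delta(\mathbf{x})\le\nu\}$ is bounded for every $\nu\in\mathbb{R}$. Let $p\in(0,1)$, $T\in\mathbb{N}$, $\mathbf{x}_1\in\mathbb{R}^d$ and $\Delta>f_\delta(\mathbf{x}_1)-f^\star$. Run the RS-GF iteration: for $t=1,\dots,T$, draw $\mathbf{w}_t$ uniformly from $\mathbb{S}^{d-1}$ (independently of the past) and set $\mathbf{x}_{t+1}=\mathbf{x}_t-\eta_t\,\mathbf{g}(\mathbf{x}_t,\mathbf{w}_t)$, with stepsize $\eta_t=\frac{1}{\log(2T/p)\sqrt{T}}C_t$, where $$C_t=\min\left\{\frac{\Delta}{2(d+1)(\alpha(\mathbf{x}_t)+\beta(\mathbf{x}_t,3\delta)+1)^2},\ \frac{\sqrt6}{12}\frac{\Delta}{\sigma(\mathbf{x}_t)(\alpha(\mathbf{x}_t)+\beta(\mathbf{x}_t,\delta))},\ \frac{1}{d(\alpha(\mathbf{x}_t)+\beta(\mathbf{x}_t,3\delta))}\sqrt{\frac{\Delta}{\ell\big(\mathbf{x}_t,\frac{\Delta}{d(\alpha(\mathbf{x}_t)+\beta(\mathbf{x}_t,3\delta)+1)\sqrt T}\big)}}\right\}.$$ Then with probability at least $1-p$: for all $t\in\{1,\dots,T\}$, $f_\delta(\mathbf{x}_t)-f^\star\le 2\Delta$,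 and $$\sum_{t=1}^T\frac{\eta_t}{\sum_{s=1}^T\eta_s}\|\nabla f_\delta(\mathbf{x}_t)\|^2\le\frac{2\Delta\log(2T/p)}{C_{\mathrm{path}}\sqrt T},\qquad C_{\mathrm{path}}=\frac1T\sum_{t=1}^T C_t .$$ Consequently, for $\epsilon>0$, there is a choice $T=\tilde{\mathcal{O}}(d^{5/2}\delta^{-1}\epsilon^{-4})$ such that with probability at least $1-p$, $\min_{1\le t\le T}\|\nabla f_\delta(\mathbf{x}_t)\|^2\le\epsilon^2$, so the overall sample complexity (number of function evaluations) is $\tilde{\mathcal{O}}(d^{5/2}\delta^{-1}\epsilon^{-4})$; in that event any $\tilde{\mathbf{x}}\in\arg\min_{\mathbf{x}_t,\,1\le t\le T}\|\nabla f_\delta(\mathbf{x}_t)\|$ is a $(\delta,\epsilon)$-Goldstein stationary point of $f$.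
   Context: $\|\cdot\|$ is the Euclidean norm, $\mathbb{B}_\delta(\mathbf{x})$ the closed ball of radius $\delta$ about $\mathbf{x}$, $\mathbb{S}^{d-1}$ the unit sphere. $\partial f$ is the Clarke subdifferential. The Goldstein $\delta$-subdifferential is $\partial_\delta f(\mathbf{x})=\mathrm{conv}\big(\bigcup_{\mathbf{y}\in\mathbb{B}_\delta(\mathbf{x})}\partial f(\mathbf{y})\big)$; $\mathbf{x}$ is a $(\delta,\epsilon)$-Goldstein stationary point if $\min\{\|\mathbf{g}\|:\mathbf{g}\in\partial_\delta f(\mathbf{x})\}\le\epsilon$. Subgradient growth condition: let $\alpha:\mathbb{R}^d\to\mathbb{R}_+$ and $\beta:\mathbb{R}^d\times\mathbb{R}_+\to\mathbb{R}_+$ be continuous, with $\beta(\mathbf{x},r)$ non-decreasing in $r$. The function $f$ satisfies the $(\alpha,\beta)$ subgradient growth condition if $\sup_{\zeta\in\partial f(\mathbf{x})}\|\zeta\|\le\alpha(\mathbf{x})$ for all $\mathbf{x}$, and $|\alpha(\mathbf{x})-\alpha(\mathbf{y})|\le\beta(\mathbf{x},\|\mathbf{y}-\mathbf{x}\|)$ for all $\mathbf{x},\mathbf{y}$. Smoothing: $f_\delta(\mathbf{x})=\mathbb{E}_{\mathbf{w}}[f(\mathbf{x}+\delta\mathbf{w})]$ with $\mathbf{w}$ uniform on the unit ball $\mathbb{B}_1(0)$; under the growth condition $f_\delta$ is continuously differentiable. Gradient estimator: $\mathbf{g}(\mathbf{x},\mathbf{w})=\frac{d\,(f(\mathbf{x}+\delta\mathbf{w})-f(\mathbf{x}-\delta\mathbf{w}))}{2\delta}\mathbf{w}$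 for $\mathbf{w}\in\mathbb{S}^{d-1}$. $\sigma(\mathbf{x})=\sqrt{16\sqrt{2\pi}\,d\,(\alpha(\mathbf{x})+\beta(\mathbf{x},2\delta))^2}$. $\ell(\mathbf{x},r)=\frac{c\sqrt d\,(2\alpha(\mathbf{x})+\beta(\mathbf{x},\delta)+\beta(\mathbf{x},r+\delta))}{2\delta}$, where $c>0$ is a universal constant for which $\|\nabla f_\delta(\mathbf{x})-\nabla f_\delta(\mathbf{y})\|\le\ell(\mathbf{x},\|\mathbf{x}-\mathbf{y}\|)\|\mathbf{x}-\mathbf{y}\|$ holds for all $\mathbf{x},\mathbf{y}$, all $d$, $\delta$ and all functions with the growth condition. $\tilde{\mathcal{O}}$ suppresses logarithmic factors (in $d,\delta^{-1},\epsilon^{-1},p^{-1}$) and factors depending only on $\Delta$ and on bounds for $\alpha$ and $\beta$ on the bounded level set $\{f_\delta\le f^\star+2\Delta\}$; it refers to the regime of large $d$ and small $\delta,\epsilon$. *)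

theory Defs
  imports "HOL-Probability.Probability"
begin

section \<open>Clarke and Goldstein subdifferentials, growth condition\<close>

definition locally_lipschitz :: "('a::metric_space \<Rightarrow> 'b::metric_space) \<Rightarrow> bool" where
  "locally_lipschitz f \<longleftrightarrow> (\<forall>x. \<exists>u>0. \<exists>L. L-lipschitz_on (cball x u) f)"

text \<open>Clarke's generalized directional derivative: the upper limit of the difference
  quotients as \<open>y \<rightarrow> x\<close> (with \<open>y = x\<close> allowed) and \<open>t \<down> 0\<close>.\<close>

definition clarke_dderiv :: "('a::euclidean_space \<Rightarrow> real) \<Rightarrow> 'a \<Rightarrow> 'a \<Rightarrow> ereal" where
  "clarke_dderiv f x v =
     Limsup (nhds x \<times>\<^sub>F at_right (0::real)) (\<lambda>(y, t). ereal ((f (y + t *\<^sub>R v) - f y) / t))"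

definition clarke_subdiff :: "('a::euclidean_space \<Rightarrow> real) \<Rightarrow> 'a \<Rightarrow> 'a set" where
  "clarke_subdiff f x = {\<zeta>. \<forall>v. ereal (\<zeta> \<bullet> v) \<le> clarke_dderiv f x v}"

definition goldstein_subdiff :: "('a::euclidean_space \<Rightarrow> real) \<Rightarrow> real \<Rightarrow> 'a \<Rightarrow> 'a set" where
  "goldstein_subdiff f \<delta> x = convex hull (\<Union>y\<in>cball x \<delta>. clarke_subdiff f y)"

text \<open>The minimum in the definition of stationarity is required to be attained.\<close>

definition goldstein_stationary ::
  "('a::euclidean_space \<Rightarrow> real) \<Rightarrow> real \<Rightarrow> real \<Rightarrow> 'a \<Rightarrow> bool" where
  "goldstein_stationary f \<delta> \<epsilon> x \<longleftrightarrow>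
     (\<exists>g. is_arg_min norm (\<lambda>h. h \<in> goldstein_subdiff f \<delta> x) g \<and> norm g \<le> \<epsilon>)"

definition growth_condition ::
  "('a::euclidean_space \<Rightarrow> real) \<Rightarrow> ('a \<Rightarrow> real) \<Rightarrow> ('a \<Rightarrow> real \<Rightarrow> real) \<Rightarrow> bool" where
  "growth_condition f \<alpha> \<beta> \<longleftrightarrow>
     continuous_on UNIV \<alpha> \<and> (\<forall>x. 0 \<le> \<alpha> x) \<and>
     continuous_on (UNIV \<times> {0..}) (\<lambda>(x, r). \<beta> x r) \<and> (\<forall>x. \<forall>r\<ge>0. 0 \<le> \<beta> x r) \<and>
     (\<forall>x. mono_on {0..} (\<beta> x)) \<and>
     (\<forall>x. \<forall>\<zeta>\<in>clarke_subdiff f x. norm \<zeta> \<le> \<alpha> x) \<and>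
     (\<forall>x y. \<bar>\<alpha> x - \<alpha> y\<bar> \<le> \<beta> x (norm (y - x)))"


section \<open>Randomized smoothing\<close>

definition unif_ball :: "'a::euclidean_space measure" where
  "unif_ball = uniform_measure lborel (cball 0 1)"

text \<open>The uniform distribution on the unit sphere is the law of \<open>w / \<parallel>w\<parallel>\<close> for \<open>w\<close> uniform
  on the unit ball (the origin has probability zero).\<close>

definition unif_sphere :: "'a::euclidean_space measure" where
  "unif_sphere = distr unif_ball borel sgn"

definition smoothing :: "('a::euclidean_space \<Rightarrow> real) \<Rightarrow> real \<Rightarrow> 'a \<Rightarrow> real" where
  "smoothing f \<delta> x = (LINT w|unif_ball. f (x + \<delta> *\<^sub>R w))"

definition gradient :: "('a::euclidean_space \<Rightarrow> real) \<Rightarrow> 'a \<Rightarrow> 'a" where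
  "gradient f x = (THE D. GDERIV f x :> D)"

definition grad_est :: "('a::euclidean_space \<Rightarrow> real) \<Rightarrow> real \<Rightarrow> 'a \<Rightarrow> 'a \<Rightarrow> 'a" where
  "grad_est f \<delta> x w =
     (real DIM('a) * (f (x + \<delta> *\<^sub>R w) - f (x - \<delta> *\<^sub>R w)) / (2 * \<delta>)) *\<^sub>R w"


section \<open>The RS-GF iteration\<close>

text \<open>The dimension \<open>d\<close> is an explicit argument of the following formulas, so that
  complexity bounds can be stated uniformly in \<open>d\<close>.  For the iteration on \<open>'a\<close> it is
  \<open>DIM('a)\<close>.\<close>

definition rsgf_sigma ::
  "nat \<Rightarrow> ('a \<Rightarrow> real) \<Rightarrow> ('a \<Rightarrow> real \<Rightarrow> real) \<Rightarrow> real \<Rightarrow> 'a \<Rightarrow> real" where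
  "rsgf_sigma d \<alpha> \<beta> \<delta> x = sqrt (16 * sqrt (2 * pi) * real d * (\<alpha> x + \<beta> x (2 * \<delta>))\<^sup>2)"

definition rsgf_ell ::
  "real \<Rightarrow> nat \<Rightarrow> ('a \<Rightarrow> real) \<Rightarrow> ('a \<Rightarrow> real \<Rightarrow> real) \<Rightarrow> real \<Rightarrow> 'a \<Rightarrow> real \<Rightarrow> real" where
  "rsgf_ell c d \<alpha> \<beta> \<delta> x r =
     c * sqrt (real d) * (2 * \<alpha> x + \<beta> x \<delta> + \<beta> x (r + \<delta>)) / (2 * \<delta>)"

text \<open>\<open>C\<^sub>t\<close> as a function of the current point.  A term of the minimum with a vanishing
  denominator counts as \<open>+\<infinity>\<close>, that is, it is omitted.\<close>

definition rsgf_C ::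
  "real \<Rightarrow> nat \<Rightarrow> ('a \<Rightarrow> real) \<Rightarrow> ('a \<Rightarrow> real \<Rightarrow> real) \<Rightarrow> real \<Rightarrow> real \<Rightarrow> nat \<Rightarrow> 'a \<Rightarrow> real" where
  "rsgf_C c d \<alpha> \<beta> \<delta> \<Delta> T x =
    (let m = \<alpha> x + \<beta> x (3 * \<delta>);
         s = rsgf_sigma d \<alpha> \<beta> \<delta> x * (\<alpha> x + \<beta> x \<delta>);
         l = rsgf_ell c d \<alpha> \<beta> \<delta> x (\<Delta> / (real d * (m + 1) * sqrt (real T)))
     in Min ({\<Delta> / (2 * (real d + 1) * (m + 1)\<^sup>2)} \<union>
             (if s = 0 then {} else {sqrt 6 / 12 * (\<Delta> / s)}) \<union>
             (if m = 0 \<or> l = 0 then {} else {1 / (real d * m) * sqrt (\<Delta> / l)})))"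

definition rsgf_eta ::
  "real \<Rightarrow> nat \<Rightarrow> ('a \<Rightarrow> real) \<Rightarrow> ('a \<Rightarrow> real \<Rightarrow> real) \<Rightarrow> real \<Rightarrow> real \<Rightarrow> real \<Rightarrow> nat \<Rightarrow> 'a \<Rightarrow> real" where
  "rsgf_eta c d \<alpha> \<beta> \<delta> \<Delta> p T x =
     1 / (ln (2 * real T / p) * sqrt (real T)) * rsgf_C c d \<alpha> \<beta> \<delta> \<Delta> T x"

text \<open>The iterates \<open>x\<^sub>t\<close> for the directions \<open>w 1, w 2, \<dots>\<close>.  Indices start at 1; the value at
  index 0 is a dummy.\<close>

fun rsgf_iter ::
  "('a::euclidean_space \<Rightarrow> real) \<Rightarrow> real \<Rightarrow> ('a \<Rightarrow> real) \<Rightarrow> ('a \<Rightarrow> real \<Rightarrow> real) \<Rightarrow> real \<Rightarrow> real \<Rightarrow> real \<Rightarrow>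
    nat \<Rightarrow> 'a \<Rightarrow> (nat \<Rightarrow> 'a) \<Rightarrow> nat \<Rightarrow> 'a" where
  "rsgf_iter f c \<alpha> \<beta> \<delta> \<Delta> p T x1 w 0 = x1"
| "rsgf_iter f c \<alpha> \<beta> \<delta> \<Delta> p T x1 w (Suc t) =
     (if t = 0 then x1
      else let x = rsgf_iter f c \<alpha> \<beta> \<delta> \<Delta> p T x1 w t
           in x - rsgf_eta c DIM('a) \<alpha> \<beta> \<delta> \<Delta> p T x *\<^sub>R grad_est f \<delta> x (w t))"

definition rsgf_noise :: "nat \<Rightarrow> (nat \<Rightarrow> 'a::euclidean_space) measure" where
  "rsgf_noise T = (\<Pi>\<^sub>M t\<in>{1..T}. unif_sphere)"

text \<open>The points at which \<open>f\<close> is evaluated during \<open>T\<close> iterations.\<close>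

definition rsgf_queries ::
  "('a::euclidean_space \<Rightarrow> real) \<Rightarrow> real \<Rightarrow> ('a \<Rightarrow> real) \<Rightarrow> ('a \<Rightarrow> real \<Rightarrow> real) \<Rightarrow> real \<Rightarrow> real \<Rightarrow> real \<Rightarrow>
    nat \<Rightarrow> 'a \<Rightarrow> (nat \<Rightarrow> 'a) \<Rightarrow> 'a list" where
  "rsgf_queries f c \<alpha> \<beta> \<delta> \<Delta> p T x1 w =
     concat (map (\<lambda>t. let x = rsgf_iter f c \<alpha> \<beta> \<delta> \<Delta> p T x1 w t
                      in [x + \<delta> *\<^sub>R w t, x - \<delta> *\<^sub>R w t]) [1..<Suc T])"


section \<open>Complexity\<close>

text \<open>Bounds for \<open>\<alpha>\<close> and \<open>\<beta>\<close> on the level set \<open>{f\<^sub>\<delta> \<le> f\<^sup>\<star> + 2\<Delta>}\<close>.  No radius larger than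
  \<open>3\<delta> + \<Delta>\<close> is ever inserted into \<open>\<beta>\<close> by the step sizes.\<close>

definition level_bounds ::
  "('a::euclidean_space \<Rightarrow> real) \<Rightarrow> real \<Rightarrow> ('a \<Rightarrow> real) \<Rightarrow> ('a \<Rightarrow> real \<Rightarrow> real) \<Rightarrow> real \<Rightarrow> real \<Rightarrow>
    real \<Rightarrow> real \<Rightarrow> bool" where
  "level_bounds f fstar \<alpha> \<beta> \<delta> \<Delta> A B \<longleftrightarrow>
     (\<forall>x. smoothing f \<delta> x \<le> fstar + 2 * \<Delta> \<longrightarrow>
        \<alpha> x \<le> A \<and> (\<forall>r\<in>{0..3 * \<delta> + \<Delta>}. \<beta> x r \<le> B))"

text \<open>The number of iterations: the least \<open>T\<close> for which the bound
  \<open>2\<Delta> log(2T/p) / (C \<surd>T)\<close> is at most \<open>\<epsilon>\<^sup>2\<close>, where \<open>C\<close> is the expression for \<open>C\<^sub>t\<close> with \<open>\<alpha>\<close>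
  and \<open>\<beta>\<close> replaced by the constants \<open>A\<close> and \<open>B\<close> (then the point, here \<open>0 :: real\<close>, is
  irrelevant).  Every dependence on the dimension goes through the argument \<open>d\<close>.\<close>

definition rsgf_T ::
  "real \<Rightarrow> real \<Rightarrow> real \<Rightarrow> real \<Rightarrow> nat \<Rightarrow> real \<Rightarrow> real \<Rightarrow> real \<Rightarrow> nat" where
  "rsgf_T c \<Delta> A B d \<delta> \<epsilon> p =
     (LEAST T. T \<ge> 1 \<and>
        2 * \<Delta> * ln (2 * real T / p) /
          (rsgf_C c d (\<lambda>_. A) (\<lambda>_ _. B) \<delta> \<Delta> T (0::real) * sqrt (real T)) \<le> \<epsilon>\<^sup>2)"

text \<open>\<open>h = O(g)\<close> up to a power of the logarithm, uniformly over all \<open>d \<ge> 1\<close>,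
  \<open>0 < \<delta>, \<epsilon> \<le> 1\<close> and \<open>0 < p < 1\<close>.\<close>

definition soft_O ::
  "(nat \<Rightarrow> real \<Rightarrow> real \<Rightarrow> real \<Rightarrow> real) \<Rightarrow> (nat \<Rightarrow> real \<Rightarrow> real \<Rightarrow> real) \<Rightarrow> bool" where
  "soft_O h g \<longleftrightarrow>
     (\<exists>K. \<exists>m::nat. \<forall>d\<ge>1. \<forall>\<delta>\<in>{0<..1}. \<forall>\<epsilon>\<in>{0<..1}. \<forall>p\<in>{0<..<1}.
        \<bar>h d \<delta> \<epsilon> p\<bar> \<le> K * (1 + ln (real d / (\<delta> * \<epsilon> * p))) ^ m * g d \<delta> \<epsilon>)"

end

theory Submission
  imports Defs
begin

text \<open>
  The argument follows the function value \<open>f\<^sub>\<delta>\<close> along the iteration.  Writing \<open>g\<close> for the estimator and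
  \<open>\<nabla>\<close> for the gradient of \<open>f\<^sub>\<delta>\<close> at the current point, the smoothness of \<open>f\<^sub>\<delta>\<close> gives
  \<open>f\<^sub>\<delta>(x - \<eta> g) \<le> f\<^sub>\<delta>(x) - \<eta> \<parallel>\<nabla>\<parallel>\<^sup>2 + \<eta> \<nabla> \<bullet> (\<nabla> - g) + \<eta>\<^sup>2 \<ell> \<parallel>g\<parallel>\<^sup>2 / 2\<close> (\<open>descent_step\<close>).  The third terms are
  martingale increments, since \<open>g\<close> is unbiased (\<open>integral_grad_est\<close>).  The first two parts of the step
  size bound their absolute values and their conditional variances, so that by an exponential moment
  bound their sum exceeds \<open>\<Delta> / 2\<close> only with small probability (\<open>U_tail\<close>).  The third part of the step
  size keeps the sum of the quadratic terms below \<open>\<Delta> / 2\<close> (\<open>step_quadratic_term\<close>).  As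
  \<open>f\<^sub>\<delta>(x\<^sub>1) - f\<^sup>\<star> < \<Delta>\<close> and \<open>f\<^sub>\<delta> \<ge> f\<^sup>\<star>\<close>, all iterates stay in the level set and the weighted squared
  gradients add up to at most \<open>2\<Delta>\<close> (\<open>good_bounds\<close>).

  The analytic input is a formula for the gradient of \<open>f\<^sub>\<delta>\<close> as an average of \<open>f(x + \<delta> w) w\<close> over the sphere
  (\<open>smoothing_GDERIV\<close>, a form of the divergence theorem for continuous \<open>f\<close>), and the fact that the
  gradient lies in the compact Goldstein subdifferential (\<open>gradient_smoothing_in_goldstein\<close>).  The latter
  bounds the gradient by the growth condition and turns a small gradient into Goldstein stationarity.
  Both rest on the mean value inequality for Clarke subgradients (\<open>clarke_mean_value\<close>), which also makes
  \<open>f\<close> Lipschitz on balls with the constant that the growth condition suggests.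

  One point is delicate.  The step size contains the smoothness modulus \<open>\<ell>\<close> at the radius
  \<open>\<Delta> / (d (m + 1) \<surd>T)\<close>, where \<open>m = \<alpha>(x) + \<beta>(x, 3\<delta>)\<close>, whereas the bound \<open>d m\<close> on the estimator admits
  steps that are about \<open>d\<close> times longer, and the growth condition does not control \<open>\<beta>\<close> there.  Steps of
  length at most \<open>2\<delta>\<close> are harmless, since then only \<open>\<beta>(x, 3\<delta>)\<close> matters.  Longer ones require that
  \<open>f(x + \<delta> w) - f(x - \<delta> w)\<close> be \<open>\<surd>2 log(2T/p)\<close> times larger than its typical size
  (\<open>step_length_dichotomy\<close>), which concentration of measure on the sphere excludes up to a small
  probability (\<open>unif_sphere_concentration\<close>, from the Brunn-Minkowski inequality).  The numerical constants
  leave little room in this comparison.  It uses that a universal smoothness constant \<open>c\<close> is at least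
  \<open>1/2\<close> (\<open>smoothness_constant_ge_half\<close>), as the distance to a hyperplane shows.  With a single iteration
  the claims are trivial (\<open>T1_conclusion\<close>).

  For the complexity, the step sizes on the level set are at least the constant \<open>C\<close> obtained by inserting
  the bounds for \<open>\<alpha>\<close> and \<open>\<beta>\<close> (\<open>rsgf_C_ge_const\<close>).  This constant is at least a multiple of
  \<open>\<delta>\<^bsup>1/2\<^esup> d\<^bsup>-5/4\<^esup>\<close> (\<open>rsgf_C_const_ge\<close>), and solving \<open>2\<Delta> log(2T/p) \<le> \<epsilon>\<^sup>2 C \<surd>T\<close> for \<open>T\<close> gives the rate
  (\<open>soft_O_rsgf_T\<close>).
\<close>

section \<open>Clarke calculus\<close>

text \<open>An upper bound for the generalized derivative in epsilon-delta form.  In contrast to the upper limit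
  itself, such bounds can be added, rescaled and moved to nearby base points without side conditions.\<close>

definition quotient_bound :: "('a::euclidean_space \<Rightarrow> real) \<Rightarrow> 'a \<Rightarrow> 'a \<Rightarrow> real \<Rightarrow> bool" where
  "quotient_bound f x v k \<longleftrightarrow>
     (\<exists>e>0. \<forall>y t. dist y x < e \<longrightarrow> 0 < t \<longrightarrow> t < e \<longrightarrow> f (y + t *\<^sub>R v) - f y \<le> k * t)"

lemma quotient_bound_of_clarke_dderiv_less:
  fixes f :: "'a::euclidean_space \<Rightarrow> real"
  assumes "clarke_dderiv f x v < ereal k"
  shows "quotient_bound f x v k"
proof -
  have "\<forall>\<^sub>F (y, t) in nhds x \<times>\<^sub>F at_right (0::real). ereal ((f (y + t *\<^sub>R v) - f y) / t) < ereal k"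
    using Limsup_lessD[OF assms[unfolded clarke_dderiv_def]] by (simp add: case_prod_unfold)
  then obtain P Q where P: "eventually P (nhds x)" and Q: "eventually Q (at_right (0::real))"
    and PQ: "\<And>y t. P y \<Longrightarrow> Q t \<Longrightarrow> (f (y + t *\<^sub>R v) - f y) / t < k"
    by (auto simp: eventually_prod_filter)
  obtain e1 where e1: "e1 > 0" "\<And>y. dist y x < e1 \<Longrightarrow> P y"
    using P by (auto simp: eventually_nhds_metric)
  obtain e2 where e2: "e2 > 0" "\<And>t. 0 < t \<Longrightarrow> t < e2 \<Longrightarrow> Q t"
    using Q by (auto simp: eventually_at_right_field)
  show ?thesis unfolding quotient_bound_def
  proof (intro exI[of _ "min e1 e2"] conjI allI impI)
    show "min e1 e2 > 0" using e1 e2 by simp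
    fix y and t :: real
    assume "dist y x < min e1 e2" and t: "0 < t" "t < min e1 e2"
    then have "(f (y + t *\<^sub>R v) - f y) / t < k" using e1 e2 PQ by auto
    then show "f (y + t *\<^sub>R v) - f y \<le> k * t" using t by (simp add: divide_simps split: if_splits)
  qed
qed

lemma clarke_dderiv_le_of_quotient_bound:
  fixes f :: "'a::euclidean_space \<Rightarrow> real"
  assumes "quotient_bound f x v k"
  shows "clarke_dderiv f x v \<le> ereal k"
proof -
  obtain e where e: "e > 0"
    "\<And>y t. dist y x < e \<Longrightarrow> 0 < t \<Longrightarrow> t < e \<Longrightarrow> f (y + t *\<^sub>R v) - f y \<le> k * t"
    using assms by (auto simp: quotient_bound_def)
  have "\<forall>\<^sub>F z in nhds x \<times>\<^sub>F at_right (0::real).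
      (\<lambda>(y, t). ereal ((f (y + t *\<^sub>R v) - f y) / t)) z \<le> ereal k"
    unfolding eventually_prod_filter
  proof (intro exI[of _ "\<lambda>y. dist y x < e"] exI[of _ "\<lambda>t. 0 < t \<and> t < e"] conjI allI impI)
    show "\<forall>\<^sub>F y in nhds x. dist y x < e" using e(1) by (auto simp: eventually_nhds_metric)
    show "\<forall>\<^sub>F t in at_right 0. 0 < t \<and> t < e" using e(1) by (auto simp: eventually_at_right_field)
    fix y and t :: real
    assume *: "dist y x < e" "0 < t \<and> t < e"
    show "(case (y, t) of (y, t) \<Rightarrow> ereal ((f (y + t *\<^sub>R v) - f y) / t)) \<le> ereal k"
      using e(2)[of y t] * by (simp add: divide_simps mult.commute)
  qed
  then show ?thesis unfolding clarke_dderiv_def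
    by (rule Limsup_bounded)
qed

lemma locally_lipschitz_ball:
  fixes f :: "'a::euclidean_space \<Rightarrow> real"
  assumes "locally_lipschitz f"
  obtains u L where "u > 0" "L \<ge> 0" "\<And>y z. dist y x < u \<Longrightarrow> dist z x < u \<Longrightarrow> \<bar>f y - f z\<bar> \<le> L * norm (y - z)"
proof -
  obtain u L where u: "u > 0" "L-lipschitz_on (cball x u) f" using assms[unfolded locally_lipschitz_def, rule_format, of x] by blast
  show thesis
  proof (rule that)
    show "u > 0" "L \<ge> 0" using u by (auto simp: lipschitz_on_def)
    show "\<bar>f y - f z\<bar> \<le> L * norm (y - z)" if "dist y x < u" "dist z x < u" for y z
      using lipschitz_onD[OF u(2), of y z] that by (simp add: dist_norm dist_commute norm_minus_commute)
  qed
qed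

lemma locally_lipschitz_continuous:
  fixes f :: "'a::euclidean_space \<Rightarrow> real"
  assumes "locally_lipschitz f"
  shows "continuous_on UNIV f"
proof -
  have "isCont f x" for x
  proof -
    obtain u L where u: "u > 0" "L-lipschitz_on (cball x u) f" using assms[unfolded locally_lipschitz_def, rule_format, of x] by blast
    have "continuous_on (cball x u) f" using u lipschitz_on_continuous_on by blast
    then show ?thesis using u(1)
      using continuous_on_interior[of "cball x u" f x] by (simp add: interior_cball)
  qed
  then show ?thesis by (simp add: continuous_on_eq_continuous_at)
qed

lemma quotient_bound_add:
  fixes f :: "'a::euclidean_space \<Rightarrow> real"
  assumes "quotient_bound f x v k" "quotient_bound f x w l"
  shows "quotient_bound f x (v + w) (k + l)"
proof -
  obtain e1 where e1: "e1 > 0"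
    "\<And>y t. dist y x < e1 \<Longrightarrow> 0 < t \<Longrightarrow> t < e1 \<Longrightarrow> f (y + t *\<^sub>R v) - f y \<le> k * t"
    using assms by (auto simp: quotient_bound_def)
  obtain e2 where e2: "e2 > 0"
    "\<And>y t. dist y x < e2 \<Longrightarrow> 0 < t \<Longrightarrow> t < e2 \<Longrightarrow> f (y + t *\<^sub>R w) - f y \<le> l * t"
    using assms by (auto simp: quotient_bound_def)
  define e where "e = Min {e1, e2 / 2, e2 / (2 * (norm v + 1))}"
  have e: "e > 0" "e \<le> e1" "e \<le> e2 / 2" "e \<le> e2 / (2 * (norm v + 1))"
  proof -
    have "e2 / (2 * (norm v + 1)) > 0" using e2(1) by (intro divide_pos_pos mult_pos_pos add_nonneg_pos) auto
    then show "e > 0" using e1(1) e2(1) by (simp add: e_def)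
    show "e \<le> e1" "e \<le> e2 / 2" "e \<le> e2 / (2 * (norm v + 1))"
      unfolding e_def by (rule Min_le; blast)+
  qed
  show ?thesis unfolding quotient_bound_def
  proof (intro exI[of _ e] conjI allI impI e(1))
    fix y and t :: real
    assume *: "dist y x < e" "0 < t" "t < e"
    have "t * norm v \<le> t * (norm v + 1)" using * by (simp add: mult_left_mono)
    also have "\<dots> < e * (norm v + 1)"
      using * by (intro mult_strict_right_mono) (auto simp: add_nonneg_pos)
    also have "\<dots> \<le> e2 / 2" using e(4) norm_ge_zero[of v] by (simp add: field_simps)
    finally have "dist (y + t *\<^sub>R v) x < e2"
      using * e(3) norm_triangle_ineq[of "y - x" "t *\<^sub>R v"] by (simp add: dist_norm algebra_simps)
    then have "f ((y + t *\<^sub>R v) + t *\<^sub>R w) - f (y + t *\<^sub>R v) \<le> l * t"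
      using * e e2 by auto
    moreover have "f (y + t *\<^sub>R v) - f y \<le> k * t" using * e e1 by auto
    ultimately show "f (y + t *\<^sub>R (v + w)) - f y \<le> (k + l) * t"
      by (simp add: algebra_simps)
  qed
qed

lemma quotient_bound_scale:
  fixes f :: "'a::euclidean_space \<Rightarrow> real"
  assumes "quotient_bound f x v k" "c > 0"
  shows "quotient_bound f x (c *\<^sub>R v) (c * k)"
proof -
  obtain e1 where e1: "e1 > 0"
    "\<And>y t. dist y x < e1 \<Longrightarrow> 0 < t \<Longrightarrow> t < e1 \<Longrightarrow> f (y + t *\<^sub>R v) - f y \<le> k * t"
    using assms by (auto simp: quotient_bound_def)
  show ?thesis unfolding quotient_bound_def
  proof (intro exI[of _ "min e1 (e1 / c)"] conjI allI impI)
    show "min e1 (e1 / c) > 0" using e1 assms by simp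
    fix y and t :: real
    assume *: "dist y x < min e1 (e1 / c)" "0 < t" "t < min e1 (e1 / c)"
    then have "f (y + (t * c) *\<^sub>R v) - f y \<le> k * (t * c)"
      using assms(2) by (intro e1) (auto simp: field_simps)
    then show "f (y + t *\<^sub>R c *\<^sub>R v) - f y \<le> c * k * t" by (simp add: mult_ac)
  qed
qed

lemma quotient_bound_lipschitz:
  fixes f :: "'a::euclidean_space \<Rightarrow> real"
  assumes u: "u > 0" "\<And>y z. dist y x < u \<Longrightarrow> dist z x < u \<Longrightarrow> \<bar>f y - f z\<bar> \<le> L * norm (y - z)"
  shows "quotient_bound f x v (L * norm v)" and "quotient_bound f x v k \<Longrightarrow> - (L * norm v) \<le> k"
proof -
  define e where "e = min (u / 2) (u / (2 * (norm v + 1)))"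
  have e: "e > 0" "e \<le> u / 2" "e \<le> u / (2 * (norm v + 1))"
  proof -
    have "u / (2 * (norm v + 1)) > 0" using u(1) by (intro divide_pos_pos mult_pos_pos add_nonneg_pos) auto
    then show "e > 0" using u(1) by (simp add: e_def)
    show "e \<le> u / 2" "e \<le> u / (2 * (norm v + 1))" unfolding e_def by (rule min.cobounded1, rule min.cobounded2)
  qed
  have near: "\<bar>f (y + t *\<^sub>R v) - f y\<bar> \<le> L * norm v * t" if *: "dist y x < e" "0 < t" "t < e" for y t
  proof -
    have "t * norm v \<le> t * (norm v + 1)" using * by (simp add: mult_left_mono)
    also have "\<dots> < e * (norm v + 1)"
      using * by (intro mult_strict_right_mono) (auto simp: add_nonneg_pos)
    also have "\<dots> \<le> u / 2" using e(3) norm_ge_zero[of v] by (simp add: field_simps)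
    finally have "dist (y + t *\<^sub>R v) x < u"
      using * e(2) norm_triangle_ineq[of "y - x" "t *\<^sub>R v"] by (simp add: dist_norm algebra_simps)
    from u(2)[OF this, of y] show ?thesis using * e by (simp add: mult_ac)
  qed
  show "quotient_bound f x v (L * norm v)" unfolding quotient_bound_def
    using near e(1) by (meson abs_le_D1)
  show "- (L * norm v) \<le> k" if qb: "quotient_bound f x v k"
  proof -
    obtain e1 where e1: "e1 > 0"
      "\<And>y t. dist y x < e1 \<Longrightarrow> 0 < t \<Longrightarrow> t < e1 \<Longrightarrow> f (y + t *\<^sub>R v) - f y \<le> k * t"
      using qb by (auto simp: quotient_bound_def)
    define t where "t = min e e1 / 2"
    have t: "0 < t" "t < e" "t < e1" using e(1) e1(1) by (auto simp: t_def)
    have "f (x + t *\<^sub>R v) - f x \<le> k * t" using e1 t by auto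
    moreover have "\<bar>f (x + t *\<^sub>R v) - f x\<bar> \<le> L * norm v * t" using near[of x t] t e by auto
    ultimately have "- (L * norm v) * t \<le> k * t" by (simp add: algebra_simps)
    then show ?thesis using t(1) by (simp only: mult_le_cancel_right_pos)
  qed
qed

text \<open>The generalized derivative is a finite sublinear function of the direction, hence the
  supremum of the linear functions below it.  The linear function is read off from a hyperplane
  that separates a point slightly below the graph from the closed convex cone above it.\<close>

lemma clarke_dderiv_le_of_subdiff:
  fixes f :: "'a::euclidean_space \<Rightarrow> real"
  assumes lip: "locally_lipschitz f" and le: "\<And>\<zeta>. \<zeta> \<in> clarke_subdiff f x \<Longrightarrow> \<zeta> \<bullet> v \<le> \<kappa>"
  shows "clarke_dderiv f x v \<le> ereal \<kappa>"
proof -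
  obtain u L where L: "u > 0" "L \<ge> 0" "\<And>y z. dist y x < u \<Longrightarrow> dist z x < u \<Longrightarrow> \<bar>f y - f z\<bar> \<le> L * norm (y - z)"
    using locally_lipschitz_ball[OF lip] by metis
  have qb: "quotient_bound f x w (L * norm w)" "quotient_bound f x w k \<Longrightarrow> - (L * norm w) \<le> k" for w k
    using quotient_bound_lipschitz(1)[of u x f L w] quotient_bound_lipschitz(2)[of u x f L w k] L(1,3)
    by metis+
  have fin: "clarke_dderiv f x w \<noteq> -\<infinity> \<and> clarke_dderiv f x w \<noteq> \<infinity>" for w
  proof -
    have "clarke_dderiv f x w \<noteq> \<infinity>"
      using clarke_dderiv_le_of_quotient_bound[OF qb(1), of w] by auto
    moreover have "\<not> clarke_dderiv f x w < ereal (- (L * norm w) - 1)"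
      using qb(2)[of w] quotient_bound_of_clarke_dderiv_less[of f x w "- (L * norm w) - 1"] by fastforce
    ultimately show ?thesis by auto
  qed
  define p where "p w = real_of_ereal (clarke_dderiv f x w)" for w
  have p: "clarke_dderiv f x w = ereal (p w)" for w
    using fin[of w] by (auto simp: p_def ereal_real)
  have p1: "quotient_bound f x w k" if "p w < k" for w k
    using quotient_bound_of_clarke_dderiv_less[of f x w k] that by (simp add: p)
  have p2: "p w \<le> k" if "quotient_bound f x w k" for w k
    using clarke_dderiv_le_of_quotient_bound[OF that] by (simp add: p)
  have padd: "p (a + b) \<le> p a + p b" for a b
  proof (rule field_le_epsilon)
    fix e :: real assume "e > 0"
    then have "quotient_bound f x (a + b) ((p a + e / 2) + (p b + e / 2))"
      by (intro quotient_bound_add p1) auto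
    from p2[OF this] show "p (a + b) \<le> p a + p b + e" by simp
  qed
  have pscale: "p (c *\<^sub>R a) \<le> c * p a" if "c > 0" for c a
  proof (rule field_le_epsilon)
    fix e :: real assume "e > 0"
    then have "quotient_bound f x (c *\<^sub>R a) (c * (p a + e / c))"
      using that by (intro quotient_bound_scale p1) auto
    from p2[OF this] show "p (c *\<^sub>R a) \<le> c * p a + e" using that by (simp add: algebra_simps)
  qed
  have p0: "p 0 \<le> 0" using p2[OF qb(1)[of 0]] by simp
  have plip: "p a \<le> p b + L * norm (a - b)" for a b
    using padd[of b "a - b"] p2[OF qb(1)[of "a - b"]] by simp
  have "L-lipschitz_on UNIV p"
  proof (rule lipschitz_onI)
    fix a b show "dist (p a) (p b) \<le> L * dist a b"
      using plip[of a b] plip[of b a] by (simp add: dist_norm norm_minus_commute abs_le_iff)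
  qed (fact L(2))
  then have pcont: "continuous_on UNIV p" by (rule lipschitz_on_continuous_on)
  define E where "E = {z. p (fst z) \<le> snd z}"
  have "closed E" unfolding E_def
    by (intro closed_Collect_le continuous_intros continuous_on_compose2[OF pcont]) auto
  have Escale: "c *\<^sub>R z \<in> E" if "z \<in> E" "c > 0" for c z
  proof -
    have "p (c *\<^sub>R fst z) \<le> c * p (fst z)" using pscale that by blast
    also have "\<dots> \<le> c * snd z" using that by (simp add: E_def)
    finally show ?thesis by (simp add: E_def)
  qed
  have Eadd: "z + z' \<in> E" if "z \<in> E" "z' \<in> E" for z z'
    using that padd[of "fst z" "fst z'"] by (simp add: E_def)
  have E0: "0 \<in> E" using p0 by (simp add: E_def)
  have "convex E"
  proof (rule convexI)
    fix z z' and a b :: real assume *: "z \<in> E" "z' \<in> E" "0 \<le> a" "0 \<le> b" "a + b = 1"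
    show "a *\<^sub>R z + b *\<^sub>R z' \<in> E"
      using * Escale[of z a] Escale[of z' b] Eadd E0
      by (cases "a = 0"; cases "b = 0") auto
  qed
  have "p v \<le> \<kappa>"
  proof (rule field_le_epsilon)
    fix e :: real assume e: "e > 0"
    have "(v, p v - e) \<notin> E" using e by (simp add: E_def)
    with \<open>closed E\<close> \<open>convex E\<close> obtain n b where n: "n \<bullet> (v, p v - e) < b" "\<And>z. z \<in> E \<Longrightarrow> n \<bullet> z > b"
      using separating_hyperplane_closed_point[of E "(v, p v - e)"] by metis
    have "b < 0" using n(2)[OF E0] by simp
    have nn: "n \<bullet> z \<ge> 0" if "z \<in> E" for z
    proof (rule ccontr)
      assume neg: "\<not> n \<bullet> z \<ge> 0"
      then have "(b / (n \<bullet> z)) *\<^sub>R z \<in> E" using \<open>b < 0\<close> that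
        by (intro Escale) (auto simp: zero_less_divide_iff)
      from n(2)[OF this] show False using neg by simp
    qed
    obtain a s where as: "n = (a, s)" by (cases n)
    have "(v, p v) \<in> E" by (simp add: E_def)
    from nn[OF this] n(1) have "s * e > 0" using \<open>b < 0\<close> as by (simp add: algebra_simps)
    then have s: "s > 0" using e by (simp add: zero_less_mult_iff)
    define \<zeta> where "\<zeta> = (- 1 / s) *\<^sub>R a"
    have "\<zeta> \<bullet> w \<le> p w" for w
    proof -
      have "(w, p w) \<in> E" by (simp add: E_def)
      from nn[OF this] have "a \<bullet> w + s * p w \<ge> 0" using as by simp
      then show ?thesis using s by (simp add: \<zeta>_def field_simps)
    qed
    then have "\<zeta> \<in> clarke_subdiff f x" by (simp add: clarke_subdiff_def p)
    from le[OF this] have "\<zeta> \<bullet> v \<le> \<kappa>" .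
    moreover have "p v - e < \<zeta> \<bullet> v"
    proof -
      have "a \<bullet> v + s * (p v - e) < 0" using n(1) as \<open>b < 0\<close> by simp
      then show ?thesis using s by (simp add: \<zeta>_def field_simps)
    qed
    ultimately show "p v \<le> \<kappa> + e" by simp
  qed
  then show ?thesis by (simp add: p)
qed

text \<open>The bounds on the Clarke derivatives make \<open>s \<mapsto> f (y + s *\<^sub>R v) - (\<kappa> + e) * s\<close> nonincreasing near every
  point of the segment, hence by bisection on the whole segment.\<close>

lemma clarke_mean_value:
  fixes f :: "'a::euclidean_space \<Rightarrow> real"
  assumes lip: "locally_lipschitz f"
    and le: "\<And>s \<zeta>. 0 \<le> s \<Longrightarrow> s \<le> 1 \<Longrightarrow> \<zeta> \<in> clarke_subdiff f (y + s *\<^sub>R v) \<Longrightarrow> \<zeta> \<bullet> v \<le> \<kappa>"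
  shows "f (y + v) - f y \<le> \<kappa>"
proof (rule field_le_epsilon)
  fix e :: real assume e: "e > 0"
  define g where "g s = f (y + s *\<^sub>R v) - (\<kappa> + e) * s" for s
  have "(0::real) \<le> 1" by simp
  then have "g 1 \<le> g 0"
  proof (induction rule: Bolzano)
    case (trans a b c)
    then show ?case by simp
  next
    case (local s)
    have "clarke_dderiv f (y + s *\<^sub>R v) v \<le> ereal \<kappa>"
      using le local by (intro clarke_dderiv_le_of_subdiff lip) auto
    also have "\<dots> < ereal (\<kappa> + e)" using e by simp
    finally obtain d where d: "d > 0"
      "\<And>z t. dist z (y + s *\<^sub>R v) < d \<Longrightarrow> 0 < t \<Longrightarrow> t < d \<Longrightarrow> f (z + t *\<^sub>R v) - f z \<le> (\<kappa> + e) * t"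
      using quotient_bound_of_clarke_dderiv_less unfolding quotient_bound_def by blast
    define d' where "d' = d / (norm v + 1)"
    have d': "d' > 0" "d' \<le> d" "d' * (norm v + 1) = d"
    proof -
      have n: "norm v + 1 > 0" by (simp add: add_nonneg_pos)
      show "d' > 0" "d' * (norm v + 1) = d" using d(1) n by (simp_all add: d'_def)
      have "d' * 1 \<le> d' * (norm v + 1)" using d(1) n by (intro mult_left_mono) (auto simp: d'_def)
      then show "d' \<le> d" using d(1) n by (simp add: d'_def)
    qed
    show ?case
    proof (intro exI[of _ d'] conjI allI impI d'(1))
      fix a b assume ab: "a \<le> s \<and> s \<le> b \<and> b - a < d'"
      show "g b \<le> g a"
      proof (cases "a = b")
        case False
        have "dist (y + a *\<^sub>R v) (y + s *\<^sub>R v) = (s - a) * norm v"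
          using ab by (simp add: dist_norm flip: scaleR_diff_left)
        also have "\<dots> \<le> (s - a) * (norm v + 1)" using ab by (intro mult_left_mono) auto
        also have "\<dots> < d' * (norm v + 1)" using ab by (intro mult_strict_right_mono) (auto simp: add_nonneg_pos)
        finally have "dist (y + a *\<^sub>R v) (y + s *\<^sub>R v) < d" using d' by simp
        from d(2)[OF this, of "b - a"] have "f ((y + a *\<^sub>R v) + (b - a) *\<^sub>R v) - f (y + a *\<^sub>R v) \<le> (\<kappa> + e) * (b - a)"
          using ab False d' by auto
        moreover have "(y + a *\<^sub>R v) + (b - a) *\<^sub>R v = y + b *\<^sub>R v" by (simp add: algebra_simps)
        ultimately show ?thesis by (simp add: g_def algebra_simps)
      qed simp
    qed
  qed
  then show "f (y + v) - f y \<le> \<kappa> + e" by (simp add: g_def)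
qed

lemma lipschitz_of_clarke_subdiff_bound:
  fixes f :: "'a::euclidean_space \<Rightarrow> real"
  assumes lip: "locally_lipschitz f" and S: "convex S"
    and le: "\<And>y \<zeta>. y \<in> S \<Longrightarrow> \<zeta> \<in> clarke_subdiff f y \<Longrightarrow> norm \<zeta> \<le> M" and yz: "y \<in> S" "z \<in> S"
  shows "\<bar>f y - f z\<bar> \<le> M * norm (y - z)"
proof -
  have *: "f z - f y \<le> M * norm (z - y)" if "y \<in> S" "z \<in> S" for y z
  proof -
    have "f (y + (z - y)) - f y \<le> M * norm (z - y)"
    proof (rule clarke_mean_value[OF lip])
      fix s :: real and \<zeta>
      assume s: "0 \<le> s" "s \<le> 1" and \<zeta>: "\<zeta> \<in> clarke_subdiff f (y + s *\<^sub>R (z - y))"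
      have "y + s *\<^sub>R (z - y) = (1 - s) *\<^sub>R y + s *\<^sub>R z" by (simp add: algebra_simps)
      also have "\<dots> \<in> S" using S that s by (intro convexD) auto
      finally have "norm \<zeta> \<le> M" using le \<zeta> by blast
      have "\<zeta> \<bullet> (z - y) \<le> norm \<zeta> * norm (z - y)" by (rule norm_cauchy_schwarz)
      also have "\<dots> \<le> M * norm (z - y)" using \<open>norm \<zeta> \<le> M\<close> by (intro mult_right_mono) auto
      finally show "\<zeta> \<bullet> (z - y) \<le> M * norm (z - y)" .
    qed
    then show ?thesis by simp
  qed
  show ?thesis using *[OF yz] *[OF yz(2,1)] by (simp add: norm_minus_commute abs_le_iff)
qed

text \<open>A strict upper bound for the difference quotients near \<open>y0\<close> is one near every close base point, so
  the generalized derivative is upper semicontinuous.\<close>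

lemma clarke_subdiff_closed_graph:
  fixes f :: "'a::euclidean_space \<Rightarrow> real"
  assumes "\<And>n. \<zeta> n \<in> clarke_subdiff f (y n)" "y \<longlonglongrightarrow> y0" "\<zeta> \<longlonglongrightarrow> \<zeta>0"
  shows "\<zeta>0 \<in> clarke_subdiff f y0"
  unfolding clarke_subdiff_def
proof (safe, rule ccontr)
  fix v assume "\<not> ereal (\<zeta>0 \<bullet> v) \<le> clarke_dderiv f y0 v"
  then have "clarke_dderiv f y0 v < ereal (\<zeta>0 \<bullet> v)" by simp
  then obtain k where k: "clarke_dderiv f y0 v < ereal k" "ereal k < ereal (\<zeta>0 \<bullet> v)"
    by (metis ereal_dense2)
  obtain e where e: "e > 0"
    "\<And>y t. dist y y0 < e \<Longrightarrow> 0 < t \<Longrightarrow> t < e \<Longrightarrow> f (y + t *\<^sub>R v) - f y \<le> k * t"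
    using quotient_bound_of_clarke_dderiv_less[OF k(1)] by (auto simp: quotient_bound_def)
  have "\<forall>\<^sub>F n in sequentially. dist (y n) y0 < e / 2"
    using tendstoD[OF assms(2), of "e / 2"] e(1) by simp
  then have "\<forall>\<^sub>F n in sequentially. \<zeta> n \<bullet> v \<le> k"
  proof eventually_elim
    case (elim n)
    have "quotient_bound f (y n) v k" unfolding quotient_bound_def
    proof (intro exI[of _ "e / 2"] conjI allI impI)
      fix z and t :: real assume *: "dist z (y n) < e / 2" "0 < t" "t < e / 2"
      show "f (z + t *\<^sub>R v) - f z \<le> k * t"
        using * elim e dist_triangle[of z y0 "y n"] by (intro e) auto
    qed (use e in auto)
    from clarke_dderiv_le_of_quotient_bound[OF this]
    have "ereal (\<zeta> n \<bullet> v) \<le> ereal k"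
      using assms(1)[of n] unfolding clarke_subdiff_def by (blast intro: order_trans)
    then show ?case by simp
  qed
  moreover have "(\<lambda>n. \<zeta> n \<bullet> v) \<longlonglongrightarrow> \<zeta>0 \<bullet> v" by (intro tendsto_intros assms)
  ultimately have "\<zeta>0 \<bullet> v \<le> k" by (intro tendsto_upperbound) auto
  then show False using k by simp
qed

text \<open>Compactness makes the minimum in the definition of Goldstein stationarity attained, and permits the
  strict separation of a point from the Goldstein subdifferential.\<close>

lemma compact_goldstein_subdiff:
  fixes f :: "'a::euclidean_space \<Rightarrow> real"
  assumes le: "\<And>y \<zeta>. y \<in> cball x \<delta> \<Longrightarrow> \<zeta> \<in> clarke_subdiff f y \<Longrightarrow> norm \<zeta> \<le> M"
  shows "compact (goldstein_subdiff f \<delta> x)"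
  unfolding goldstein_subdiff_def
proof (rule compact_convex_hull, unfold compact_eq_bounded_closed, intro conjI)
  let ?U = "\<Union>y\<in>cball x \<delta>. clarke_subdiff f y"
  show "bounded ?U" unfolding bounded_iff using le by blast
  show "closed ?U" unfolding closed_sequential_limits
  proof (intro allI impI, elim conjE)
    fix z l assume z: "\<forall>n. z n \<in> ?U" and l: "z \<longlonglongrightarrow> l"
    then obtain y where y: "\<And>n. y n \<in> cball x \<delta>" "\<And>n. z n \<in> clarke_subdiff f (y n)"
      by (simp only: UN_iff) metis
    obtain y0 r where r: "y0 \<in> cball x \<delta>" "strict_mono (r :: nat \<Rightarrow> nat)" "(y \<circ> r) \<longlonglongrightarrow> y0"
      using compact_cball[of x \<delta>] y(1) unfolding compact_eq_seq_compact_metric seq_compact_def by metis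
    have "l \<in> clarke_subdiff f y0"
      by (rule clarke_subdiff_closed_graph[of "z \<circ> r" f "y \<circ> r"])
         (use y r l LIMSEQ_subseq_LIMSEQ in auto)
    then show "l \<in> ?U" using r by blast
  qed
qed

lemma growth_conditionD:
  assumes "growth_condition f \<alpha> \<beta>"
  shows "continuous_on UNIV \<alpha>" "0 \<le> \<alpha> x" "continuous_on (UNIV \<times> {0..}) (\<lambda>(x, r). \<beta> x r)"
    "0 \<le> r \<Longrightarrow> 0 \<le> \<beta> x r" "0 \<le> r \<Longrightarrow> r \<le> r' \<Longrightarrow> \<beta> x r \<le> \<beta> x r'"
    "\<zeta> \<in> clarke_subdiff f x \<Longrightarrow> norm \<zeta> \<le> \<alpha> x"
    "\<bar>\<alpha> x - \<alpha> y\<bar> \<le> \<beta> x (norm (y - x))"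
  using assms by (auto simp: growth_condition_def mono_on_def)

lemma clarke_subdiff_norm_cball:
  assumes "growth_condition f \<alpha> \<beta>" "y \<in> cball x r" "\<zeta> \<in> clarke_subdiff f y"
  shows "norm \<zeta> \<le> \<alpha> x + \<beta> x r"
proof -
  note D = growth_conditionD[OF assms(1)]
  have "norm \<zeta> \<le> \<alpha> y" using D(6) assms(3) .
  also have "\<dots> \<le> \<alpha> x + \<beta> x (norm (y - x))" using D(7)[of x y] by simp
  also have "\<beta> x (norm (y - x)) \<le> \<beta> x r"
    using assms(2) by (intro D(5)) (auto simp: dist_norm norm_minus_commute)
  finally show ?thesis by simp
qed

lemma growth_condition_lipschitz:
  assumes "locally_lipschitz f" "growth_condition f \<alpha> \<beta>" "y \<in> cball x r" "z \<in> cball x r"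
  shows "\<bar>f y - f z\<bar> \<le> (\<alpha> x + \<beta> x r) * norm (y - z)"
  using lipschitz_of_clarke_subdiff_bound[OF assms(1) convex_cball _ assms(3,4)]
    clarke_subdiff_norm_cball[OF assms(2)] by metis

section \<open>Differentiability of the smoothing\<close>

lemma lborel_integral_translate:
  fixes \<phi> :: "'a::euclidean_space \<Rightarrow> 'b::{banach, second_countable_topology}"
  assumes [measurable]: "\<phi> \<in> borel_measurable borel"
  shows "(LINT w|lborel. \<phi> (a + w)) = (LINT w|lborel. \<phi> w)"
proof -
  have "(LINT w|lborel. \<phi> w) = (LINT w|distr lborel borel ((+) a). \<phi> w)" by (simp add: lborel_distr_plus)
  also have "\<dots> = (LINT w|lborel. \<phi> (a + w))" by (rule integral_distr) auto
  finally show ?thesis by simp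
qed

lemma lborel_integral_scale:
  fixes \<phi> :: "'a::euclidean_space \<Rightarrow> 'b::{banach, second_countable_topology}"
  assumes [measurable]: "\<phi> \<in> borel_measurable borel" and c: "c \<noteq> 0"
  shows "(LINT w|lborel. \<phi> w) = \<bar>c\<bar> ^ DIM('a) *\<^sub>R (LINT w|lborel. \<phi> (c *\<^sub>R w))"
proof -
  have "(LINT w|lborel. \<phi> w) = (LINT w|density (distr lborel borel (\<lambda>x. 0 + c *\<^sub>R x)) (\<lambda>_. ennreal (\<bar>c\<bar> ^ DIM('a))). \<phi> w)"
    by (subst lborel_affine[OF c, of 0, symmetric]) simp
  also have "\<dots> = (LINT w|distr lborel borel (\<lambda>x. c *\<^sub>R x). (\<bar>c\<bar> ^ DIM('a)) *\<^sub>R \<phi> w)"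
    by (subst integral_density) auto
  also have "\<dots> = (LINT w|lborel. (\<bar>c\<bar> ^ DIM('a)) *\<^sub>R \<phi> (c *\<^sub>R w))"
    by (rule integral_distr) auto
  finally show ?thesis by simp
qed

lemma sgn_borel_measurable [measurable]: "(sgn :: 'a::euclidean_space \<Rightarrow> 'a) \<in> borel_measurable borel"
  unfolding sgn_div_norm[abs_def] by measurable

lemma cball_borel_measurable [measurable]: "cball (x::'a::euclidean_space) r \<in> sets borel"
  by simp

lemma integrable_on_ball:
  fixes \<phi> :: "'a::euclidean_space \<Rightarrow> 'b::{banach, second_countable_topology}"
  assumes [measurable]: "\<phi> \<in> borel_measurable borel" and bd: "\<And>w. norm w \<le> r \<Longrightarrow> norm (\<phi> w) \<le> K"
    and out: "\<And>w. norm w > r \<Longrightarrow> \<phi> w = 0"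
  shows "integrable lborel \<phi>" "norm (LINT w|lborel. \<phi> w) \<le> K * measure lborel (cball (0::'a) r)"
proof -
  have fin: "emeasure lborel (cball (0::'a) r) < \<infinity>" by (rule emeasure_lborel_cball_finite)
  have i: "integrable lborel (\<lambda>w. K * indicator (cball (0::'a) r) w)" using fin by simp
  have le: "norm (\<phi> w) \<le> K * indicator (cball 0 r) w" for w
    using bd[of w] out[of w] by (cases "norm w \<le> r") (auto simp: indicator_def)
  show int: "integrable lborel \<phi>" 
  proof (rule Bochner_Integration.integrable_bound[OF i])
    show "AE w in lborel. norm (\<phi> w) \<le> norm (K * indicator (cball 0 r) w)"
      by (intro AE_I2 order_trans[OF le]) simp
  qed simp
  have "norm (LINT w|lborel. \<phi> w) \<le> (LINT w|lborel. norm (\<phi> w))" by (rule integral_norm_bound)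
  also have "\<dots> \<le> (LINT w|lborel. K * indicator (cball (0::'a) r) w)"
    using int i le by (intro integral_mono) auto
  also have "\<dots> = K * measure lborel (cball (0::'a) r)" by simp
  finally show "norm (LINT w|lborel. \<phi> w) \<le> K * measure lborel (cball (0::'a) r)" .
qed

text \<open>The cutoff functions below fail to be differentiable on two spheres.\<close>

lemma AE_lborel_norm_neq: "AE w in lborel. norm (w::'a::euclidean_space) \<noteq> r"
proof -
  have "sphere (0::'a) r \<in> null_sets lborel"
    using negligible_sphere[of 0 r] by (simp add: negligible_iff_null_sets null_sets_completion_iff)
  then show ?thesis by (rule AE_I'[where P="\<lambda>w. norm w \<noteq> r"]) auto
qed

text \<open>A Lipschitz substitute for the indicator function of the unit ball, whose jump on the sphere is spread
  over a shell of thickness \<open>\<epsilon>\<close>.\<close>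

definition ball_cutoff :: "real \<Rightarrow> 'a::euclidean_space \<Rightarrow> real" where
  "ball_cutoff \<epsilon> w = max 0 (min 1 ((1 - norm w) / \<epsilon>))"

definition shell :: "real \<Rightarrow> 'a::euclidean_space set" where
  "shell \<epsilon> = {w. 1 - \<epsilon> < norm w \<and> norm w \<le> 1}"

lemma shell_borel [measurable]: "shell \<epsilon> \<in> sets borel"
  unfolding shell_def by measurable

lemma ball_cutoff_measurable [measurable]: "ball_cutoff \<epsilon> \<in> borel_measurable borel"
  unfolding ball_cutoff_def by measurable

lemma ball_cutoff_lipschitz:
  assumes "\<epsilon> > 0"
  shows "\<bar>ball_cutoff \<epsilon> w - ball_cutoff \<epsilon> w'\<bar> \<le> norm (w - w') / \<epsilon>"
proof -
  have "\<bar>ball_cutoff \<epsilon> w - ball_cutoff \<epsilon> w'\<bar> \<le> \<bar>(1 - norm w) / \<epsilon> - (1 - norm w') / \<epsilon>\<bar>"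
    unfolding ball_cutoff_def by (auto simp: max_def min_def)
  also have "\<dots> = \<bar>norm w - norm w'\<bar> / \<epsilon>"
    using assms by (simp add: diff_divide_distrib[symmetric])
  also have "\<dots> \<le> norm (w - w') / \<epsilon>"
    using assms norm_triangle_ineq3[of w w'] by (intro divide_right_mono) auto
  finally show ?thesis .
qed

lemma ball_cutoff_has_derivative:
  assumes \<epsilon>: "0 < \<epsilon>" "\<epsilon> < 1" and w: "norm w \<noteq> 1 - \<epsilon>" "norm w \<noteq> 1"
  shows "(ball_cutoff \<epsilon> has_derivative (\<lambda>h. - (indicator (shell \<epsilon>) w / \<epsilon>) * (sgn w \<bullet> h))) (at w)"
proof -
  consider "norm w < 1 - \<epsilon>" | "norm w > 1" | "1 - \<epsilon> < norm w" "norm w < 1" using w by linarith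
  then show ?thesis
  proof cases
    case 1
    have "((\<lambda>_. 1) has_derivative (\<lambda>h. 0)) (at w)" by simp
    then have "(ball_cutoff \<epsilon> has_derivative (\<lambda>h. 0)) (at w)"
      by (rule has_derivative_transform_within_open[where s="{w. norm w < 1 - \<epsilon>}"])
         (use 1 \<epsilon> in \<open>auto simp: ball_cutoff_def min_def max_def field_simps intro!: open_Collect_less continuous_intros\<close>)
    then show ?thesis using 1 by (simp add: shell_def)
  next
    case 2
    have "((\<lambda>_. 0) has_derivative (\<lambda>h. 0)) (at w)" by simp
    then have "(ball_cutoff \<epsilon> has_derivative (\<lambda>h. 0)) (at w)"
      by (rule has_derivative_transform_within_open[where s="{w. norm w > 1}"])
         (use 2 \<epsilon> in \<open>auto simp: ball_cutoff_def min_def max_def field_simps intro!: open_Collect_less continuous_intros\<close>)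
    then show ?thesis using 2 by (simp add: shell_def)
  next
    case 3
    have "w \<noteq> 0" using 3 \<epsilon> by auto
    then have "(norm has_derivative (\<lambda>h. h \<bullet> sgn w)) (at w)"
      using GDERIV_norm by (auto simp: gderiv_def)
    then have "((\<lambda>w. (1 - norm w) / \<epsilon>) has_derivative (\<lambda>h. (0 - h \<bullet> sgn w) / \<epsilon>)) (at w)"
      by (intro bounded_linear.has_derivative[OF bounded_linear_divide] has_derivative_diff has_derivative_const)
    then have "(ball_cutoff \<epsilon> has_derivative (\<lambda>h. (0 - h \<bullet> sgn w) / \<epsilon>)) (at w)"
      by (rule has_derivative_transform_within_open[where s="{w. 1 - \<epsilon> < norm w} \<inter> {w. norm w < 1}"])
         (use 3 \<epsilon> in \<open>auto simp: ball_cutoff_def min_def max_def field_simps intro!: open_Int open_Collect_less continuous_intros\<close>)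
    then show ?thesis using 3 by (simp add: shell_def inner_commute)
  qed
qed

text \<open>Translating the variable of integration moves the increment from \<open>u\<close>, which need not be
  differentiable, to the kernel.\<close>

lemma cutoff_convolution_has_derivative:
  fixes u :: "'a::euclidean_space \<Rightarrow> real"
  assumes u: "continuous_on UNIV u" and \<epsilon>: "0 < \<epsilon>" "\<epsilon> < 1"
  shows "((\<lambda>x. LINT w|lborel. ball_cutoff \<epsilon> w * u (x + w)) has_derivative
    (\<lambda>h. ((1 / \<epsilon>) *\<^sub>R (LINT w|lborel. (indicator (shell \<epsilon>) w * u (x + w)) *\<^sub>R sgn w)) \<bullet> h)) (at x)"
proof -
  have um [measurable]: "u \<in> borel_measurable borel" using u by (rule borel_measurable_continuous_onI)
  define F where "F x = (LINT w|lborel. ball_cutoff \<epsilon> w * u (x + w))" for x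
  define G where "G = (LINT w|lborel. (indicator (shell \<epsilon>) w * u (x + w)) *\<^sub>R sgn w)"
  have "compact (u ` cball x 2)" using u by (intro compact_continuous_image continuous_on_subset[OF u]) auto
  then have "\<exists>K. \<forall>y\<in>cball x 2. \<bar>u y\<bar> \<le> K" by (auto dest!: compact_imp_bounded simp: bounded_iff)
  then obtain K where K: "\<And>y. y \<in> cball x 2 \<Longrightarrow> \<bar>u y\<bar> \<le> K" by metis
  have K2: "\<bar>u (x + w)\<bar> \<le> K" if "norm w \<le> 2" for w using K[of "x + w"] that by (simp add: dist_norm)
  have K0: "0 \<le> K" using K2[of 0] by simp
  have cut0: "ball_cutoff \<epsilon> w = 0" if "norm w \<ge> 1" for w :: 'a
    using that \<epsilon> divide_le_0_iff[of "1 - norm w" \<epsilon>] by (simp add: ball_cutoff_def)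
  have cut1: "0 \<le> ball_cutoff \<epsilon> w" "ball_cutoff \<epsilon> w \<le> 1" for w :: 'a
    by (auto simp: ball_cutoff_def)
  have Gi: "integrable lborel (\<lambda>w. (indicator (shell \<epsilon>) w * u (x + w)) *\<^sub>R sgn w)"
    by (rule integrable_on_ball(1)[where r=1 and K=K])
       (use K2 K0 in \<open>auto simp: indicator_def shell_def norm_sgn\<close>)
  have shift: "F (x + h) = (LINT w|lborel. ball_cutoff \<epsilon> (w - h) * u (x + w))" for h
    unfolding F_def using lborel_integral_translate[of "\<lambda>w. ball_cutoff \<epsilon> (w - h) * u (x + w)" h]
    by (simp add: add.assoc)
  have int: "integrable lborel (\<lambda>w. ball_cutoff \<epsilon> (w - h) * u (x + w))" if h: "norm h \<le> 1" for h
  proof (rule integrable_on_ball(1)[where r=2 and K=K])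
    fix w :: 'a
    show "norm (ball_cutoff \<epsilon> (w - h) * u (x + w)) \<le> K" if "norm w \<le> 2"
      using mult_mono[OF cut1(2)[of "w - h"] K2[OF that]] cut1(1)[of "w - h"] by (simp add: abs_mult)
    show "ball_cutoff \<epsilon> (w - h) * u (x + w) = 0" if "2 < norm w"
      using cut0[of "w - h"] that h norm_triangle_ineq2[of w h] by simp
  qed measurable
  define q where "q h w = (ball_cutoff \<epsilon> (w - h) - ball_cutoff \<epsilon> w - (indicator (shell \<epsilon>) w / \<epsilon>) * (sgn w \<bullet> h)) / norm h * u (x + w)"
    for h w
  have quot: "(F (x + h) - F x - ((1 / \<epsilon>) *\<^sub>R G) \<bullet> h) / norm h = (LINT w|lborel. q h w)" if h: "norm h \<le> 1" for h
  proof -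
    have 1: "((1 / \<epsilon>) *\<^sub>R G) \<bullet> h = (LINT w|lborel. (indicator (shell \<epsilon>) w / \<epsilon>) * (sgn w \<bullet> h) * u (x + w))"
    proof -
      have "G \<bullet> h = (LINT w|lborel. ((indicator (shell \<epsilon>) w * u (x + w)) *\<^sub>R sgn w) \<bullet> h)"
        unfolding G_def by (rule integral_inner_left[symmetric]) (use Gi in auto)
      then have "((1 / \<epsilon>) *\<^sub>R G) \<bullet> h = (1 / \<epsilon>) * (LINT w|lborel. ((indicator (shell \<epsilon>) w * u (x + w)) *\<^sub>R sgn w) \<bullet> h)"
        by simp
      also have "\<dots> = (LINT w|lborel. (1 / \<epsilon>) * (((indicator (shell \<epsilon>) w * u (x + w)) *\<^sub>R sgn w) \<bullet> h))"
        by (rule integral_mult_right_zero[symmetric])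
      finally show ?thesis by (simp add: mult_ac)
    qed
    have 2: "integrable lborel (\<lambda>w. (indicator (shell \<epsilon>) w / \<epsilon>) * (sgn w \<bullet> h) * u (x + w))"
    proof -
      have "integrable lborel (\<lambda>w. (1 / \<epsilon>) * (((indicator (shell \<epsilon>) w * u (x + w)) *\<^sub>R sgn w) \<bullet> h))"
        using Gi by (intro integrable_mult_right integrable_inner_left) auto
      then show ?thesis by (simp add: mult_ac)
    qed
    have 0: "integrable lborel (\<lambda>w. ball_cutoff \<epsilon> w * u (x + w))" using int[of 0] by simp
    have "F (x + h) - F x - ((1 / \<epsilon>) *\<^sub>R G) \<bullet> h = (LINT w|lborel. ball_cutoff \<epsilon> (w - h) * u (x + w)
        - ball_cutoff \<epsilon> w * u (x + w) - (indicator (shell \<epsilon>) w / \<epsilon>) * (sgn w \<bullet> h) * u (x + w))"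
      unfolding shift 1 Bochner_Integration.integral_diff[OF Bochner_Integration.integrable_diff[OF int[OF h] 0] 2]
        Bochner_Integration.integral_diff[OF int[OF h] 0] by (simp only: F_def)
    then have "(F (x + h) - F x - ((1 / \<epsilon>) *\<^sub>R G) \<bullet> h) / norm h = (LINT w|lborel. ball_cutoff \<epsilon> (w - h) * u (x + w)
        - ball_cutoff \<epsilon> w * u (x + w) - (indicator (shell \<epsilon>) w / \<epsilon>) * (sgn w \<bullet> h) * u (x + w)) / norm h"
      by (rule arg_cong)
    also have "\<dots> = (LINT w|lborel. (ball_cutoff \<epsilon> (w - h) * u (x + w)
        - ball_cutoff \<epsilon> w * u (x + w) - (indicator (shell \<epsilon>) w / \<epsilon>) * (sgn w \<bullet> h) * u (x + w)) / norm h)"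
      by (rule integral_divide_zero[symmetric])
    also have "\<dots> = (LINT w|lborel. q h w)"
      unfolding q_def by (intro Bochner_Integration.integral_cong refl) (simp add: left_diff_distrib)
    finally show ?thesis .
  qed
  have "(F has_derivative (\<lambda>h. ((1 / \<epsilon>) *\<^sub>R G) \<bullet> h)) (at x)"
    unfolding has_derivative_at tendsto_at_iff_sequentially
  proof (intro conjI allI impI)
    show "bounded_linear (\<lambda>h. ((1 / \<epsilon>) *\<^sub>R G) \<bullet> h)" by (rule bounded_linear_inner_right)
    fix X :: "nat \<Rightarrow> 'a" assume X0: "\<forall>i. X i \<in> UNIV - {0}" and X: "X \<longlonglongrightarrow> 0"
    have "\<forall>\<^sub>F i in sequentially. norm (X i) \<le> 1"
      using tendstoD[OF X, of 1] by (auto elim!: eventually_mono)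
    then obtain N where N: "\<And>i. i \<ge> N \<Longrightarrow> norm (X i) \<le> 1" by (auto simp: eventually_sequentially)
    define Y where "Y i = X (i + N)" for i
    have Y: "Y \<longlonglongrightarrow> 0" "\<And>i. norm (Y i) \<le> 1" "\<And>i. Y i \<noteq> 0"
      using LIMSEQ_ignore_initial_segment[OF X, of N] X0 N by (auto simp: Y_def[abs_def])
    have "(\<lambda>i. LINT w|lborel. q (Y i) w) \<longlonglongrightarrow> (LINT w|(lborel :: 'a measure). 0::real)"
    proof (rule integral_dominated_convergence[where w="\<lambda>w. (2 / \<epsilon> * K) * indicator (cball (0::'a) 2) w"])
      show "(\<lambda>w. q (Y i) w) \<in> borel_measurable lborel" for i unfolding q_def by measurable
      show "integrable lborel (\<lambda>w. (2 / \<epsilon> * K) * indicator (cball (0::'a) 2) w)"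
        using emeasure_lborel_cball_finite[of "0::'a" 2] by simp
      show "AE w in lborel. norm (q (Y i) w) \<le> (2 / \<epsilon> * K) * indicator (cball (0::'a) 2) w" for i
      proof (rule AE_I2)
        fix w :: 'a
        show "norm (q (Y i) w) \<le> (2 / \<epsilon> * K) * indicator (cball (0::'a) 2) w"
        proof (cases "norm w \<le> 2")
          case False
          then have "ball_cutoff \<epsilon> (w - Y i) = 0" "ball_cutoff \<epsilon> w = 0" "w \<notin> shell \<epsilon>"
            using Y(2)[of i] norm_triangle_ineq2[of w "Y i"] by (auto intro!: cut0 simp: shell_def)
          then show ?thesis using False by (simp add: q_def)
        next
          case True
          have "\<bar>ball_cutoff \<epsilon> (w - Y i) - ball_cutoff \<epsilon> w\<bar> \<le> norm (Y i) / \<epsilon>"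
            using ball_cutoff_lipschitz[OF \<epsilon>(1), of "w - Y i" w] by simp
          moreover have "\<bar>(indicator (shell \<epsilon>) w / \<epsilon>) * (sgn w \<bullet> Y i)\<bar> \<le> norm (Y i) / \<epsilon>"
          proof -
            have "\<bar>sgn w \<bullet> Y i\<bar> \<le> norm (sgn w) * norm (Y i)" by (rule Cauchy_Schwarz_ineq2)
            also have "\<dots> \<le> norm (Y i)" by (simp add: norm_sgn)
            finally show ?thesis using \<epsilon> by (simp add: indicator_def abs_mult divide_right_mono)
          qed
          ultimately have "\<bar>ball_cutoff \<epsilon> (w - Y i) - ball_cutoff \<epsilon> w - (indicator (shell \<epsilon>) w / \<epsilon>) * (sgn w \<bullet> Y i)\<bar> \<le> norm (Y i) / \<epsilon> + norm (Y i) / \<epsilon>"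
            by linarith
          also have "\<dots> = 2 / \<epsilon> * norm (Y i)" by simp
          finally have "\<bar>ball_cutoff \<epsilon> (w - Y i) - ball_cutoff \<epsilon> w - (indicator (shell \<epsilon>) w / \<epsilon>) * (sgn w \<bullet> Y i)\<bar> \<le> 2 / \<epsilon> * norm (Y i)" .
          then have "\<bar>ball_cutoff \<epsilon> (w - Y i) - ball_cutoff \<epsilon> w - (indicator (shell \<epsilon>) w / \<epsilon>) * (sgn w \<bullet> Y i)\<bar> / norm (Y i) \<le> 2 / \<epsilon>"
            using Y(3)[of i] by (subst pos_divide_le_eq) auto
          then have "norm (q (Y i) w) \<le> 2 / \<epsilon> * K"
            unfolding q_def real_norm_def abs_mult abs_divide abs_norm_cancel using K2[OF True] \<epsilon>
            by (intro mult_mono) auto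
          then show ?thesis using True by simp
        qed
      qed
      show "AE w in lborel. (\<lambda>i. q (Y i) w) \<longlonglongrightarrow> 0"
        using AE_lborel_norm_neq[of "1 - \<epsilon>"] AE_lborel_norm_neq[of 1]
      proof eventually_elim
        case (elim w)
        have "((\<lambda>h. norm (ball_cutoff \<epsilon> (w + h) - ball_cutoff \<epsilon> w - (- (indicator (shell \<epsilon>) w / \<epsilon>) * (sgn w \<bullet> h))) / norm h) \<longlongrightarrow> 0) (at 0)"
          using ball_cutoff_has_derivative[OF \<epsilon> elim] by (simp add: has_derivative_at)
        moreover have "- Y i \<in> UNIV - {0}" "(\<lambda>i. - Y i) \<longlonglongrightarrow> 0" for i using Y tendsto_minus[OF Y(1)] by auto
        ultimately have "((\<lambda>h. norm (ball_cutoff \<epsilon> (w + h) - ball_cutoff \<epsilon> w - (- (indicator (shell \<epsilon>) w / \<epsilon>) * (sgn w \<bullet> h))) / norm h)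
            \<circ> (\<lambda>i. - Y i)) \<longlonglongrightarrow> 0"
          by (rule tendsto_at_iff_sequentially[THEN iffD1, rule_format])
        then have "(\<lambda>i. \<bar>ball_cutoff \<epsilon> (w - Y i) - ball_cutoff \<epsilon> w - (indicator (shell \<epsilon>) w / \<epsilon>) * (sgn w \<bullet> Y i)\<bar> / norm (Y i) * \<bar>u (x + w)\<bar>) \<longlonglongrightarrow> 0 * \<bar>u (x + w)\<bar>"
          by (intro tendsto_mult tendsto_const) (simp add: o_def)
        then have "(\<lambda>i. \<bar>q (Y i) w\<bar>) \<longlonglongrightarrow> 0" by (simp add: q_def abs_mult)
        then show ?case by (rule tendsto_rabs_zero_cancel)
      qed
    qed simp
    then have "(\<lambda>i. \<bar>LINT w|lborel. q (Y i) w\<bar>) \<longlonglongrightarrow> 0" by (simp add: tendsto_rabs_zero)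
    moreover have "\<bar>LINT w|lborel. q (Y i) w\<bar> = norm (F (x + Y i) - F x - ((1 / \<epsilon>) *\<^sub>R G) \<bullet> Y i) / norm (Y i)" for i
      unfolding quot[OF Y(2), symmetric] abs_divide abs_norm_cancel real_norm_def ..
    ultimately have "(\<lambda>i. norm (F (x + Y i) - F x - ((1 / \<epsilon>) *\<^sub>R G) \<bullet> Y i) / norm (Y i)) \<longlonglongrightarrow> 0"
      by (simp only:)
    then have "(\<lambda>i. ((\<lambda>h. norm (F (x + h) - F x - ((1 / \<epsilon>) *\<^sub>R G) \<bullet> h) / norm h) \<circ> X) (i + N)) \<longlonglongrightarrow> 0"
      by (simp add: Y_def o_def)
    then show "((\<lambda>h. norm (F (x + h) - F x - ((1 / \<epsilon>) *\<^sub>R G) \<bullet> h) / norm h) \<circ> X) \<longlonglongrightarrow> 0"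
      by (rule LIMSEQ_offset)
  qed
  then show ?thesis unfolding F_def G_def .
qed

text \<open>The integrand depends on the direction only, so the ball of radius \<open>r\<close> carries the fraction
  \<open>r ^ DIM('a)\<close> of the integral over the unit ball.\<close>

lemma shell_integral_sgn:
  fixes \<phi> :: "'a::euclidean_space \<Rightarrow> 'b::{banach, second_countable_topology}"
  assumes [measurable]: "\<phi> \<in> borel_measurable borel" and bd: "\<And>w. norm w \<le> 1 \<Longrightarrow> norm (\<phi> w) \<le> K"
    and \<epsilon>: "0 < \<epsilon>" "\<epsilon> < 1"
  shows "(LINT w|lborel. indicator (shell \<epsilon>) w *\<^sub>R \<phi> (sgn w))
    = (1 - (1 - \<epsilon>) ^ DIM('a)) *\<^sub>R (LINT w|lborel. indicator (cball 0 1) w *\<^sub>R \<phi> (sgn w))"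
proof -
  have [measurable]: "(\<lambda>w. \<phi> (sgn w)) \<in> borel_measurable borel"
    by (rule measurable_compose[OF sgn_borel_measurable assms(1)])
  have K: "norm (\<phi> (sgn w)) \<le> K" for w using bd[of "sgn w"] by (simp add: norm_sgn split: if_splits)
  have K0: "0 \<le> K" using order_trans[OF norm_ge_zero K] .
  have int: "integrable lborel (\<lambda>w. indicator (cball 0 r) w *\<^sub>R \<phi> (sgn w))" for r
    by (rule integrable_on_ball(1)[where r=r and K=K]) (use K K0 in \<open>auto simp: indicator_def\<close>)
  have "(LINT w|lborel. indicator (cball 0 (1 - \<epsilon>)) w *\<^sub>R \<phi> (sgn w))
      = \<bar>1 - \<epsilon>\<bar> ^ DIM('a) *\<^sub>R (LINT w|lborel. indicator (cball 0 (1 - \<epsilon>)) ((1 - \<epsilon>) *\<^sub>R w) *\<^sub>R \<phi> (sgn ((1 - \<epsilon>) *\<^sub>R w)))"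
  proof (rule lborel_integral_scale)
    show "1 - \<epsilon> \<noteq> 0" using \<epsilon> by simp
  qed measurable
  also have "(\<lambda>w. indicator (cball 0 (1 - \<epsilon>)) ((1 - \<epsilon>) *\<^sub>R w) *\<^sub>R \<phi> (sgn ((1 - \<epsilon>) *\<^sub>R w)))
      = (\<lambda>w. indicator (cball 0 1) w *\<^sub>R \<phi> (sgn w))"
    using \<epsilon> by (auto simp: fun_eq_iff indicator_def sgn_scaleR)
  finally have scale: "(LINT w|lborel. indicator (cball 0 (1 - \<epsilon>)) w *\<^sub>R \<phi> (sgn w))
      = (1 - \<epsilon>) ^ DIM('a) *\<^sub>R (LINT w|lborel. indicator (cball 0 1) w *\<^sub>R \<phi> (sgn w))" using \<epsilon> by simp
  have "(LINT w|lborel. indicator (shell \<epsilon>) w *\<^sub>R \<phi> (sgn w))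
      = (LINT w|lborel. indicator (cball 0 1) w *\<^sub>R \<phi> (sgn w) - indicator (cball 0 (1 - \<epsilon>)) w *\<^sub>R \<phi> (sgn w))"
    using \<epsilon> by (intro Bochner_Integration.integral_cong) (auto simp: indicator_def shell_def)
  also have "\<dots> = (LINT w|lborel. indicator (cball 0 1) w *\<^sub>R \<phi> (sgn w)) - (LINT w|lborel. indicator (cball 0 (1 - \<epsilon>)) w *\<^sub>R \<phi> (sgn w))"
    by (intro Bochner_Integration.integral_diff int)
  finally show ?thesis unfolding scale by (simp add: scaleR_diff_left)
qed

lemma shell_measure:
  fixes \<epsilon> :: real
  assumes \<epsilon>: "0 < \<epsilon>" "\<epsilon> < 1"
  shows "measure lborel (shell \<epsilon> :: 'a::euclidean_space set) \<le> DIM('a) * \<epsilon> * measure lborel (cball (0::'a) 1)"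
proof -
  have "measure lborel (shell \<epsilon> :: 'a set) = (1 - (1 - \<epsilon>) ^ DIM('a)) * measure lborel (cball (0::'a) 1)"
    using shell_integral_sgn[of "\<lambda>_::'a. 1::real" 1 \<epsilon>] \<epsilon> by simp
  moreover have "1 - (1 - \<epsilon>) ^ DIM('a) \<le> DIM('a) * \<epsilon>"
    using Bernoulli_inequality[of "- \<epsilon>" "DIM('a)"] \<epsilon> by simp
  ultimately show ?thesis by (simp add: mult_right_mono)
qed

lemma inverse_real_plus_tendsto: "(\<lambda>n. inverse (real n + 2)) \<longlonglongrightarrow> 0"
  using LIMSEQ_ignore_initial_segment[OF lim_inverse_n', of 2] by (simp add: inverse_eq_divide add.commute)

lemma power_quotient_limit: "(\<lambda>n. (1 - (1 - inverse (real n + 2)) ^ d) / inverse (real n + 2)) \<longlonglongrightarrow> real d"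
proof -
  have "((\<lambda>x. x ^ d) has_field_derivative real d * 1 ^ (d - 1)) (at (1::real))"
    using DERIV_pow[of d "1::real" UNIV] by simp
  then have D: "((\<lambda>h. ((1 + h) ^ d - 1 ^ d) / h) \<longlongrightarrow> real d) (at (0::real))" by (simp add: DERIV_def)
  have "(\<lambda>n. - inverse (real n + 2)) \<longlonglongrightarrow> - 0"
    by (intro tendsto_minus inverse_real_plus_tendsto)
  then have "(\<lambda>n. - inverse (real n + 2)) \<longlonglongrightarrow> 0" by simp
  moreover have "- inverse (real n + 2) \<in> UNIV - {0}" for n by (auto simp: add_nonneg_eq_0_iff)
  ultimately have "((\<lambda>h. ((1 + h) ^ d - 1 ^ d) / h) \<circ> (\<lambda>n. - inverse (real n + 2))) \<longlonglongrightarrow> real d"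
    by (intro tendsto_at_iff_sequentially[THEN iffD1, rule_format, OF D])
  then show ?thesis by (simp add: o_def diff_divide_distrib)
qed

text \<open>The divergence theorem for the unit ball, with the surface integral written as an integral of
  a function of the direction over the ball.  It suffices that \<open>u\<close> is continuous: the
  gradients for the cutoff kernels are averages over thinner and thinner shells, which converge
  locally uniformly.\<close>

lemma ball_average_has_derivative:
  fixes u :: "'a::euclidean_space \<Rightarrow> real"
  assumes u: "continuous_on UNIV u"
  shows "((\<lambda>x. LINT w|lborel. indicator (cball 0 1) w * u (x + w)) has_derivative
    (\<lambda>h. (real DIM('a) *\<^sub>R (LINT w|lborel. indicator (cball 0 1) w *\<^sub>R (u (x0 + sgn w) *\<^sub>R sgn w))) \<bullet> h)) (at x0)"
proof -
  have um [measurable]: "u \<in> borel_measurable borel" using u by (rule borel_measurable_continuous_onI)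
  define e where "e n = inverse (real n + 2)" for n
  have e: "0 < e n" "e n < 1" for n by (auto simp: e_def field_simps)
  have e_lim: "e \<longlonglongrightarrow> 0" unfolding e_def by (rule inverse_real_plus_tendsto)
  define V where "V = measure lborel (cball (0::'a) 1)"
  have V: "V \<ge> 0" by (simp add: V_def)
  define d where "d = real DIM('a)"
  define D where "D n x = (1 / e n) *\<^sub>R (LINT w|lborel. (indicator (shell (e n)) w * u (x + w)) *\<^sub>R sgn w)" for n x
  define H where "H x = d *\<^sub>R (LINT w|lborel. indicator (cball 0 1) w *\<^sub>R (u (x + sgn w) *\<^sub>R sgn w))" for x
  define F where "F x = (LINT w|lborel. indicator (cball 0 1) w * u (x + w))" for x
  have comp: "compact (cball x0 2)" by simp
  have "compact (u ` cball x0 2)" by (intro compact_continuous_image continuous_on_subset[OF u]) auto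
  then have "\<exists>K. \<forall>y\<in>cball x0 2. \<bar>u y\<bar> \<le> K" by (auto dest!: compact_imp_bounded simp: bounded_iff)
  then obtain K where K: "\<And>y. y \<in> cball x0 2 \<Longrightarrow> \<bar>u y\<bar> \<le> K" by metis
  have near: "x + w \<in> cball x0 2" if "x \<in> ball x0 1" "norm w \<le> 1" for x w
    using that norm_triangle_ineq[of "x - x0" w] by (simp add: dist_norm norm_minus_commute algebra_simps)
  have K0: "0 \<le> K" using K[of x0] by simp
  have sgn1: "norm (sgn w :: 'a) \<le> 1" for w by (simp add: norm_sgn)
  \<comment> \<open>There are two errors: moving the argument of \<open>u\<close> from the shell to the sphere, which uniform
    continuity controls, and replacing the relative volume of the shell by its limit.\<close>
  have conv_D: "\<forall>\<^sub>F n in sequentially. \<forall>x\<in>ball x0 1. \<forall>h. norm (D n x \<bullet> h - H x \<bullet> h) \<le> \<eta> * norm h" if \<eta>: "\<eta> > 0" for \<eta>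
  proof -
    have "uniformly_continuous_on (cball x0 2) u"
      by (intro compact_uniformly_continuous continuous_on_subset[OF u]) auto
    moreover define \<omega> where "\<omega> = \<eta> / (2 * (d * V + 1))"
    have dV: "d * V + 1 > 0" using V by (simp add: d_def add_nonneg_pos)
    then have \<omega>: "\<omega> > 0" "d * V * \<omega> \<le> \<eta> / 2" using \<eta> V by (auto simp: \<omega>_def field_simps)
    ultimately obtain \<rho> where \<rho>: "\<rho> > 0" "\<And>y z. y \<in> cball x0 2 \<Longrightarrow> z \<in> cball x0 2 \<Longrightarrow> dist y z < \<rho> \<Longrightarrow> \<bar>u y - u z\<bar> < \<omega>"
      unfolding uniformly_continuous_on_def dist_real_def by (metis abs_minus_commute)
    have "\<forall>\<^sub>F n in sequentially. e n < \<rho>" using order_tendstoD(2)[OF e_lim \<rho>(1)] .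
    moreover have "\<forall>\<^sub>F n in sequentially. \<bar>(1 - (1 - e n) ^ DIM('a)) / e n - d\<bar> < \<eta> / (2 * (K * V + 1))"
    proof -
      have "K * V + 1 > 0" using K0 V by (simp add: add_nonneg_pos)
      then have "\<eta> / (2 * (K * V + 1)) > 0" using \<eta> by simp
      from tendstoD[OF power_quotient_limit[of "DIM('a)"] this] show ?thesis
        by (simp add: e_def d_def dist_real_def)
    qed
    ultimately show ?thesis
    proof eventually_elim
      case (elim n)
      show ?case
      proof (intro ballI allI)
        fix x h assume x: "x \<in> ball x0 1"
        define I where "I = (LINT w|lborel. indicator (cball 0 1) w *\<^sub>R (u (x + sgn w) *\<^sub>R sgn w))"
        have I: "norm I \<le> K * V" unfolding I_def V_def
          by (rule integrable_on_ball(2))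
             (use K near[OF x sgn1] K0 in \<open>auto simp: indicator_def norm_sgn intro!: mult_mono[of _ _ _ 1, simplified]\<close>)
        have sh: "(LINT w|lborel. indicator (shell (e n)) w *\<^sub>R (u (x + sgn w) *\<^sub>R sgn w)) = (1 - (1 - e n) ^ DIM('a)) *\<^sub>R I"
        proof -
          define \<phi> where "\<phi> w = (u (x + (if norm w \<le> 1 then w else 0))) *\<^sub>R (if norm w \<le> 1 then w else 0)" for w
          have [measurable]: "\<phi> \<in> borel_measurable borel" unfolding \<phi>_def by measurable
          have \<phi>s: "\<phi> (sgn w) = u (x + sgn w) *\<^sub>R sgn w" for w using sgn1[of w] by (simp add: \<phi>_def)
          have "norm (\<phi> w) \<le> K" if "norm w \<le> 1" for w
            using K[OF near[OF x that]] that K0 mult_mono[of "\<bar>u (x + w)\<bar>" K "norm w" 1] by (simp add: \<phi>_def)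
          from shell_integral_sgn[of \<phi> K, OF _ this e] show ?thesis by (simp add: \<phi>s I_def)
        qed
        have int1: "integrable lborel (\<lambda>w. (indicator (shell (e n)) w * u (x + w)) *\<^sub>R sgn w)"
          by (rule integrable_on_ball(1)[where r=1 and K=K])
             (use K near[OF x] K0 in \<open>auto simp: indicator_def shell_def norm_sgn\<close>)
        have int2: "integrable lborel (\<lambda>w. indicator (shell (e n)) w *\<^sub>R (u (x + sgn w) *\<^sub>R sgn w))"
          by (rule integrable_on_ball(1)[where r=1 and K=K])
             (use K near[OF x sgn1] K0 in \<open>auto simp: indicator_def shell_def norm_sgn\<close>)
        have "norm ((LINT w|lborel. (indicator (shell (e n)) w * u (x + w)) *\<^sub>R sgn w) - (1 - (1 - e n) ^ DIM('a)) *\<^sub>R I)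
            = norm (LINT w|lborel. (indicator (shell (e n)) w * u (x + w)) *\<^sub>R sgn w - indicator (shell (e n)) w *\<^sub>R (u (x + sgn w) *\<^sub>R sgn w))"
          unfolding sh[symmetric] Bochner_Integration.integral_diff[OF int1 int2] ..
        also have "\<dots> \<le> (LINT w|lborel. norm ((indicator (shell (e n)) w * u (x + w)) *\<^sub>R sgn w - indicator (shell (e n)) w *\<^sub>R (u (x + sgn w) *\<^sub>R sgn w)))"
          by (rule integral_norm_bound)
        also have "\<dots> \<le> (LINT w|lborel. \<omega> * indicator (shell (e n)) (w::'a))"
        proof (rule integral_mono)
          show "integrable lborel (\<lambda>w. norm ((indicator (shell (e n)) w * u (x + w)) *\<^sub>R sgn w - indicator (shell (e n)) w *\<^sub>R (u (x + sgn w) *\<^sub>R sgn w)))"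
            by (intro integrable_norm Bochner_Integration.integrable_diff int1 int2)
          show "integrable lborel (\<lambda>w. \<omega> * indicator (shell (e n)) (w::'a))"
            by (rule integrable_on_ball(1)[where r=1 and K=\<omega>]) (use \<omega> in \<open>auto simp: indicator_def shell_def\<close>)
          fix w :: 'a
          show "norm ((indicator (shell (e n)) w * u (x + w)) *\<^sub>R sgn w - indicator (shell (e n)) w *\<^sub>R (u (x + sgn w) *\<^sub>R sgn w)) \<le> \<omega> * indicator (shell (e n)) w"
          proof (cases "w \<in> shell (e n)")
            case True
            then have w: "1 - e n < norm w" "norm w \<le> 1" by (auto simp: shell_def)
            then have "w \<noteq> 0" using e[of n] by auto
            then have "norm w *\<^sub>R sgn w = w" by (simp add: sgn_div_norm)
            then have "w - sgn w = (norm w - 1) *\<^sub>R sgn w" unfolding scaleR_diff_left by simp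
            then have "dist (x + w) (x + sgn w) = 1 - norm w" using w \<open>w \<noteq> 0\<close> by (simp add: dist_norm norm_sgn)
            then have "\<bar>u (x + w) - u (x + sgn w)\<bar> < \<omega>"
              using w elim(1) by (intro \<rho>(2) near[OF x] sgn1) auto
            then show ?thesis using True \<open>w \<noteq> 0\<close> by (simp add: norm_sgn flip: scaleR_diff_left)
          qed simp
        qed
        also have "\<dots> = \<omega> * measure lborel (shell (e n) :: 'a set)" by simp
        also have "\<dots> \<le> \<omega> * (d * e n * V)" unfolding d_def V_def
          by (rule mult_left_mono[OF shell_measure[OF e[of n]]]) (use \<omega> in simp)
        finally have A: "norm ((LINT w|lborel. (indicator (shell (e n)) w * u (x + w)) *\<^sub>R sgn w) - (1 - (1 - e n) ^ DIM('a)) *\<^sub>R I)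
            \<le> \<omega> * (d * e n * V)" .
        have "D n x - H x = (1 / e n) *\<^sub>R ((LINT w|lborel. (indicator (shell (e n)) w * u (x + w)) *\<^sub>R sgn w) - (1 - (1 - e n) ^ DIM('a)) *\<^sub>R I)
            + ((1 - (1 - e n) ^ DIM('a)) / e n - d) *\<^sub>R I"
          unfolding D_def H_def I_def[symmetric] by (simp add: scaleR_diff_right scaleR_diff_left diff_divide_distrib)
        also have "norm \<dots> \<le> (1 / e n) * (\<omega> * (d * e n * V)) + \<eta> / (2 * (K * V + 1)) * (K * V)"
        proof (rule norm_triangle_le, intro add_mono)
          show "norm ((1 / e n) *\<^sub>R ((LINT w|lborel. (indicator (shell (e n)) w * u (x + w)) *\<^sub>R sgn w) - (1 - (1 - e n) ^ DIM('a)) *\<^sub>R I)) \<le> (1 / e n) * (\<omega> * (d * e n * V))"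
            unfolding norm_scaleR using A e[of n] by (intro mult_mono) auto
          show "norm (((1 - (1 - e n) ^ DIM('a)) / e n - d) *\<^sub>R I) \<le> \<eta> / (2 * (K * V + 1)) * (K * V)"
            unfolding norm_scaleR using I elim(2) by (intro mult_mono) auto
        qed
        also have "\<dots> \<le> \<eta> / 2 + \<eta> / 2"
        proof (rule add_mono)
          show "(1 / e n) * (\<omega> * (d * e n * V)) \<le> \<eta> / 2" using \<omega>(2) e[of n] by (simp add: mult_ac)
          have "K * V \<ge> 0" using K0 V by simp
          then show "\<eta> / (2 * (K * V + 1)) * (K * V) \<le> \<eta> / 2" using \<eta> by (simp add: field_simps)
        qed
        finally have "norm (D n x - H x) \<le> \<eta>" by simp
        have "norm (D n x \<bullet> h - H x \<bullet> h) \<le> norm (D n x - H x) * norm h"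
          unfolding inner_diff_left[symmetric] real_norm_def by (rule Cauchy_Schwarz_ineq2)
        also have "\<dots> \<le> \<eta> * norm h" using \<open>norm (D n x - H x) \<le> \<eta>\<close> by (intro mult_right_mono) auto
        finally show "norm (D n x \<bullet> h - H x \<bullet> h) \<le> \<eta> * norm h" .
      qed
    qed
  qed
  have conv_F: "(\<lambda>n. LINT w|lborel. ball_cutoff (e n) w * u (x + w)) \<longlonglongrightarrow> F x" if x: "x \<in> ball x0 1" for x
  proof (rule LIM_zero_cancel, rule Lim_null_comparison)
    have "(\<lambda>n. K * (d * e n * V)) \<longlonglongrightarrow> K * (d * 0 * V)" by (intro tendsto_intros e_lim)
    then show "(\<lambda>n. K * (d * e n * V)) \<longlonglongrightarrow> 0" by simp
    show "\<forall>\<^sub>F n in sequentially. norm ((LINT w|lborel. ball_cutoff (e n) w * u (x + w)) - F x) \<le> K * (d * e n * V)"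
    proof (intro always_eventually allI)
      fix n
      have cut0: "ball_cutoff (e n) w = 0" if "norm w > 1" for w :: 'a
        using that e[of n] divide_le_0_iff[of "1 - norm w" "e n"] by (simp add: ball_cutoff_def)
      have cut1: "0 \<le> ball_cutoff (e n) w" "ball_cutoff (e n) w \<le> 1" for w :: 'a by (auto simp: ball_cutoff_def)
      have int1: "integrable lborel (\<lambda>w. ball_cutoff (e n) w * u (x + w))"
      proof (rule integrable_on_ball(1)[where r=1 and K=K])
        show "norm (ball_cutoff (e n) w * u (x + w)) \<le> K" if "norm w \<le> 1" for w
          using mult_mono[OF cut1(2)[of w] K[OF near[OF x that]]] cut1(1)[of w] by (simp add: abs_mult)
      qed (use cut0 in auto)
      have int2: "integrable lborel (\<lambda>w. indicator (cball 0 1) w * u (x + w))"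
        by (rule integrable_on_ball(1)[where r=1 and K=K]) (use K near[OF x] K0 in \<open>auto simp: indicator_def\<close>)
      have "norm ((LINT w|lborel. ball_cutoff (e n) w * u (x + w)) - F x)
          = norm (LINT w|lborel. ball_cutoff (e n) w * u (x + w) - indicator (cball 0 1) w * u (x + w))"
        unfolding F_def Bochner_Integration.integral_diff[OF int1 int2] ..
      also have "\<dots> \<le> (LINT w|lborel. norm (ball_cutoff (e n) w * u (x + w) - indicator (cball 0 1) w * u (x + w)))"
        by (rule integral_norm_bound)
      also have "\<dots> \<le> (LINT w|lborel. K * indicator (shell (e n)) (w::'a))"
      proof (rule integral_mono)
        show "integrable lborel (\<lambda>w. norm (ball_cutoff (e n) w * u (x + w) - indicator (cball 0 1) w * u (x + w)))"
          by (intro integrable_norm Bochner_Integration.integrable_diff int1 int2)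
        show "integrable lborel (\<lambda>w. K * indicator (shell (e n)) (w::'a))"
          by (rule integrable_on_ball(1)[where r=1 and K=K]) (use K0 in \<open>auto simp: indicator_def shell_def\<close>)
        fix w :: 'a
        have "norm w > 1 \<or> norm w \<le> 1 - e n \<or> w \<in> shell (e n)" by (auto simp: shell_def)
        then consider "norm w > 1" | "norm w \<le> 1 - e n" | "w \<in> shell (e n)" by blast
        then show "norm (ball_cutoff (e n) w * u (x + w) - indicator (cball 0 1) w * u (x + w)) \<le> K * indicator (shell (e n)) w"
        proof cases
          case 1
          then show ?thesis using cut0[of w] by (simp add: shell_def)
        next
          case 2
          then have "ball_cutoff (e n) w = 1" "norm w \<le> 1" using e[of n] by (simp_all add: ball_cutoff_def le_divide_eq)
          then show ?thesis using 2 K0 by simp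
        next
          case 3
          then have w: "norm w \<le> 1" by (simp add: shell_def)
          have "norm (ball_cutoff (e n) w * u (x + w) - indicator (cball 0 1) w * u (x + w)) = (1 - ball_cutoff (e n) w) * \<bar>u (x + w)\<bar>"
            using w cut1[of w] abs_mult[of "ball_cutoff (e n) w - 1" "u (x + w)"] by (simp add: left_diff_distrib)
          also have "\<dots> \<le> 1 * K" using cut1[of w] K[OF near[OF x w]] by (intro mult_mono) auto
          finally show ?thesis using 3 by simp
        qed
      qed
      also have "\<dots> = K * measure lborel (shell (e n) :: 'a set)" by simp
      also have "\<dots> \<le> K * (d * e n * V)"
        unfolding d_def V_def by (rule mult_left_mono[OF shell_measure[OF e[of n]] K0])
      finally show "norm ((LINT w|lborel. ball_cutoff (e n) w * u (x + w)) - F x) \<le> K * (d * e n * V)" .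
    qed
  qed
  have "\<exists>g. \<forall>x\<in>ball x0 1. (\<lambda>n. LINT w|lborel. ball_cutoff (e n) w * u (x + w)) \<longlonglongrightarrow> g x
      \<and> (g has_derivative (\<lambda>h. H x \<bullet> h)) (at x within ball x0 1)"
  proof (rule has_derivative_sequence[where f'="\<lambda>n x h. D n x \<bullet> h"])
    show "((\<lambda>x. LINT w|lborel. ball_cutoff (e n) w * u (x + w)) has_derivative (\<lambda>h. D n x \<bullet> h)) (at x within ball x0 1)" for n x
      unfolding D_def by (rule has_derivative_at_withinI[OF cutoff_convolution_has_derivative[OF u e]])
    show "(\<lambda>n. LINT w|lborel. ball_cutoff (e n) w * u (x0 + w)) \<longlonglongrightarrow> F x0" by (rule conv_F) simp
  qed (use conv_D in auto)
  then obtain g where g: "\<And>x. x \<in> ball x0 1 \<Longrightarrow> (\<lambda>n. LINT w|lborel. ball_cutoff (e n) w * u (x + w)) \<longlonglongrightarrow> g x"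
    "\<And>x. x \<in> ball x0 1 \<Longrightarrow> (g has_derivative (\<lambda>h. H x \<bullet> h)) (at x within ball x0 1)" by blast
  have "(g has_derivative (\<lambda>h. H x0 \<bullet> h)) (at x0)"
    using g(2)[of x0] by (simp add: at_within_open[of x0 "ball x0 1"])
  then have "(F has_derivative (\<lambda>h. H x0 \<bullet> h)) (at x0)"
    by (rule has_derivative_transform_within_open[where s="ball x0 1"])
       (auto intro: LIMSEQ_unique[OF g(1) conv_F])
  then show ?thesis unfolding F_def H_def d_def .
qed

section \<open>The Prekopa-Leindler inequality\<close>

lemma emeasure_lborel_affine_preimage:
  fixes S :: "real set"
  assumes "S \<in> sets borel"
  shows "2 * emeasure lborel S = emeasure lborel {x. (x + t) / 2 \<in> S}"
proof -
  have "emeasure lborel S = emeasure (density (distr lborel borel (\<lambda>x. t / 2 + 1 / 2 * x)) (\<lambda>_. ennreal \<bar>1 / 2\<bar>)) S"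
    by (subst lborel_real_affine[of "1 / 2" "t / 2", symmetric]) auto
  also have "\<dots> = ennreal (1 / 2) * emeasure (distr lborel borel (\<lambda>x. t / 2 + 1 / 2 * x)) S"
    using assms by (subst emeasure_density_const) auto
  also have "emeasure (distr lborel borel (\<lambda>x. t / 2 + 1 / 2 * x)) S = emeasure lborel {x. (x + t) / 2 \<in> S}"
    using assms by (subst emeasure_distr) (simp_all add: vimage_def add_divide_distrib add.commute)
  finally have "2 * emeasure lborel S = (2 * ennreal (1 / 2)) * emeasure lborel {x. (x + t) / 2 \<in> S}"
    by (simp add: mult.assoc)
  also have "2 * ennreal (1 / 2) = 1"
    using ennreal_mult[of 2 "1/2"] by simp
  finally show ?thesis by simp
qed

text \<open>One-dimensional Brunn-Minkowski: the translates of \<open>A\<close> by a point near the bottom of \<open>B\<close> and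
  of \<open>B\<close> by a point near the top of \<open>A\<close> overlap in little more than a point.\<close>

lemma brunn_minkowski_real:
  fixes A B C :: "real set"
  assumes sets: "A \<in> sets borel" "B \<in> sets borel" "C \<in> sets borel"
    and ne: "A \<noteq> {}" "B \<noteq> {}" and bd: "bounded A" "bounded B"
    and mid: "\<And>a b. a \<in> A \<Longrightarrow> b \<in> B \<Longrightarrow> (a + b) / 2 \<in> C"
  shows "emeasure lborel A + emeasure lborel B \<le> 2 * emeasure lborel C"
proof (rule ennreal_le_epsilon)
  fix e :: real assume e: "0 < e"
  have bdd: "bdd_above A" "bdd_below B" using bd by (auto intro: bounded_imp_bdd_above bounded_imp_bdd_below)
  \<comment> \<open>Moving \<open>A\<close> below \<open>a'\<close> and \<open>B\<close> above \<open>b'\<close> costs \<open>e / 2\<close> each.\<close>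
  obtain a' where a': "a' \<in> A" "Sup A - e / 2 < a'"
    using less_cSup_iff[OF ne(1) bdd(1), of "Sup A - e / 2"] e by auto
  obtain b' where b': "b' \<in> B" "b' < Inf B + e / 2"
    using cInf_less_iff[OF ne(2) bdd(2), of "Inf B + e / 2"] e by auto
  define q where "q = (a' + b') / 2"
  have "emeasure lborel A \<le> emeasure lborel ((A \<inter> {..a'}) \<union> {a'..Sup A})"
    using sets cSup_upper[OF _ bdd(1)] by (intro emeasure_mono) auto
  also have "\<dots> \<le> emeasure lborel (A \<inter> {..a'}) + emeasure lborel {a'..Sup A}"
    using sets by (intro emeasure_subadditive) auto
  also have "emeasure lborel {a'..Sup A} \<le> ennreal (e / 2)"
    using a' cSup_upper[OF a'(1) bdd(1)] by (simp add: ennreal_leI)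
  finally have 1: "emeasure lborel A \<le> emeasure lborel (A \<inter> {..a'}) + ennreal (e / 2)" by simp
  have "emeasure lborel B \<le> emeasure lborel ((B \<inter> {b'..}) \<union> {Inf B..b'})"
    using sets cInf_lower[OF _ bdd(2)] by (intro emeasure_mono) auto
  also have "\<dots> \<le> emeasure lborel (B \<inter> {b'..}) + emeasure lborel {Inf B..b'}"
    using sets by (intro emeasure_subadditive) auto
  also have "emeasure lborel {Inf B..b'} \<le> ennreal (e / 2)"
    using b' cInf_lower[OF b'(1) bdd(2)] by (simp add: ennreal_leI)
  finally have 2: "emeasure lborel B \<le> emeasure lborel (B \<inter> {b'..}) + ennreal (e / 2)" by simp
  have "emeasure lborel (A \<inter> {..a'}) \<le> emeasure lborel {x. (x + b') / 2 \<in> C \<inter> {..q}}"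
    using sets mid b' by (intro emeasure_mono) (auto simp: q_def)
  also have "\<dots> = 2 * emeasure lborel (C \<inter> {..q})"
    using sets by (subst emeasure_lborel_affine_preimage) auto
  finally have 3: "emeasure lborel (A \<inter> {..a'}) \<le> 2 * emeasure lborel (C \<inter> {..q})" .
  have "emeasure lborel (B \<inter> {b'..}) \<le> emeasure lborel {x. (x + a') / 2 \<in> C \<inter> {q..}}"
    using sets mid[OF a'(1)] by (intro emeasure_mono) (auto simp: q_def add.commute[of _ a'])
  also have "\<dots> = 2 * emeasure lborel (C \<inter> {q..})"
    using sets by (subst emeasure_lborel_affine_preimage) auto
  also have "emeasure lborel (C \<inter> {q..}) \<le> emeasure lborel ((C \<inter> {q<..}) \<union> {q})"
    using sets by (intro emeasure_mono) auto
  also have "\<dots> \<le> emeasure lborel (C \<inter> {q<..}) + emeasure lborel {q}"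
    using sets by (intro emeasure_subadditive) auto
  finally have 4: "emeasure lborel (B \<inter> {b'..}) \<le> 2 * emeasure lborel (C \<inter> {q<..})"
    by (simp add: mult_left_mono)
  have "emeasure lborel (C \<inter> {..q}) + emeasure lborel (C \<inter> {q<..}) = emeasure lborel (C \<inter> {..q} \<union> C \<inter> {q<..})"
    using sets by (intro plus_emeasure) auto
  also have "C \<inter> {..q} \<union> C \<inter> {q<..} = C" by auto
  finally have 5: "emeasure lborel (C \<inter> {..q}) + emeasure lborel (C \<inter> {q<..}) = emeasure lborel C" .
  have "emeasure lborel A + emeasure lborel B \<le>
      (2 * emeasure lborel (C \<inter> {..q}) + ennreal (e / 2)) + (2 * emeasure lborel (C \<inter> {q<..}) + ennreal (e / 2))"
    by (intro add_mono order_trans[OF 1] order_trans[OF 2] 3 4 order_refl)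
  also have "\<dots> = 2 * (emeasure lborel (C \<inter> {..q}) + emeasure lborel (C \<inter> {q<..})) + (ennreal (e / 2) + ennreal (e / 2))"
    by (simp add: distrib_left add_ac)
  also have "ennreal (e / 2) + ennreal (e / 2) = ennreal e" using e by (simp flip: ennreal_plus)
  finally show "emeasure lborel A + emeasure lborel B \<le> 2 * emeasure lborel C + ennreal e" by (simp add: 5)
qed

lemma nn_integral_layer_cake:
  fixes f :: "real \<Rightarrow> ennreal"
  assumes [measurable]: "f \<in> borel_measurable lborel"
  shows "(\<integral>\<^sup>+x. f x \<partial>lborel) = (\<integral>\<^sup>+t\<in>{0..}. emeasure lborel {x. ennreal t < f x} \<partial>lborel)"
proof -
  have *: "f x = (\<integral>\<^sup>+t. indicator {0..} t * indicator {x. ennreal t < f x} x \<partial>lborel)" for x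
  proof -
    have "(\<integral>\<^sup>+t. indicator {0..} t * indicator {x. ennreal t < f x} x \<partial>lborel)
        = (\<integral>\<^sup>+t. indicator {t. 0 \<le> t \<and> ennreal t < f x} t \<partial>lborel)"
      by (intro nn_integral_cong) (auto simp: indicator_def)
    also have "\<dots> = emeasure lborel {t. 0 \<le> t \<and> ennreal t < f x}" by (intro nn_integral_indicator) measurable
    also have "\<dots> = f x"
    proof (cases "f x")
      case (real r)
      then have "{t. 0 \<le> t \<and> ennreal t < f x} = {0..<r}" by (auto simp: ennreal_less_iff)
      then show ?thesis using real by simp
    next
      case top
      then have "{t. 0 \<le> t \<and> ennreal t < f x} = {0..}" by auto
      moreover have "emeasure lborel {0::real..} = top"
      proof (rule ccontr)
        assume "emeasure lborel {0::real..} \<noteq> top"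
        then obtain r where r: "emeasure lborel {0::real..} = ennreal r" "r \<ge> 0" by (cases "emeasure lborel {0::real..}") auto
        have "emeasure lborel {0..r + 1} \<le> emeasure lborel {0::real..}" by (intro emeasure_mono) auto
        then show False using r by (simp add: ennreal_le_iff)
      qed
      ultimately show ?thesis using top by simp
    qed
    finally show ?thesis by simp
  qed
  have "(\<integral>\<^sup>+x. f x \<partial>lborel) = (\<integral>\<^sup>+x. \<integral>\<^sup>+t. indicator {0..} t * indicator {x. ennreal t < f x} x \<partial>lborel \<partial>lborel)"
    by (intro nn_integral_cong *)
  also have "\<dots> = (\<integral>\<^sup>+t. \<integral>\<^sup>+x. indicator {0..} t * indicator {x. ennreal t < f x} x \<partial>lborel \<partial>lborel)"
    by (rule lborel_pair.Fubini') measurable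
  also have "\<dots> = (\<integral>\<^sup>+t\<in>{0..}. emeasure lborel {x. ennreal t < f x} \<partial>lborel)"
    by (intro nn_integral_cong) (simp add: nn_integral_cmult mult.commute)
  finally show ?thesis .
qed

text \<open>When both functions have supremum 1, their level sets at every height below 1 are nonempty, and the
  inequality for sets can be integrated over the heights.\<close>

lemma prekopa_leindler_real_normalized:
  fixes f g h :: "real \<Rightarrow> ennreal"
  assumes [measurable]: "f \<in> borel_measurable lborel" "g \<in> borel_measurable lborel" "h \<in> borel_measurable lborel"
    and le: "\<And>x y. f x * g y \<le> (h ((x + y) / 2))\<^sup>2"
    and f1: "\<And>x. f x \<le> 1" "\<And>t. 0 \<le> t \<Longrightarrow> t < 1 \<Longrightarrow> \<exists>x. ennreal t < f x"
    and g1: "\<And>x. g x \<le> 1" "\<And>t. 0 \<le> t \<Longrightarrow> t < 1 \<Longrightarrow> \<exists>x. ennreal t < g x"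
    and supp: "bounded {x. f x \<noteq> 0}" "bounded {x. g x \<noteq> 0}"
  shows "(\<integral>\<^sup>+x. f x \<partial>lborel) + (\<integral>\<^sup>+x. g x \<partial>lborel) \<le> 2 * (\<integral>\<^sup>+x. h x \<partial>lborel)"
proof -
  have "(\<integral>\<^sup>+x. f x \<partial>lborel) + (\<integral>\<^sup>+x. g x \<partial>lborel) =
      (\<integral>\<^sup>+t\<in>{0..}. (emeasure lborel {x. ennreal t < f x} + emeasure lborel {x. ennreal t < g x}) \<partial>lborel)"
    unfolding nn_integral_layer_cake[OF assms(1)] nn_integral_layer_cake[OF assms(2)]
    by (simp add: distrib_right nn_integral_add)
  also have "\<dots> \<le> (\<integral>\<^sup>+t\<in>{0..}. (2 * emeasure lborel {x. ennreal t < h x}) \<partial>lborel)"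
  proof (intro nn_integral_mono)
    fix t :: real
    show "(emeasure lborel {x. ennreal t < f x} + emeasure lborel {x. ennreal t < g x}) * indicator {0..} t
        \<le> 2 * emeasure lborel {x. ennreal t < h x} * indicator {0..} t"
    proof (cases "0 \<le> t \<and> t < 1")
      case True
      have "emeasure lborel {x. ennreal t < f x} + emeasure lborel {x. ennreal t < g x}
          \<le> 2 * emeasure lborel {x. ennreal t < h x}"
      proof (rule brunn_minkowski_real)
        show "bounded {x. ennreal t < f x}" "bounded {x. ennreal t < g x}"
          by (rule bounded_subset[OF supp(1)] bounded_subset[OF supp(2)]; auto)+
        fix a b assume ab: "a \<in> {x. ennreal t < f x}" "b \<in> {x. ennreal t < g x}"
        have "(ennreal t)\<^sup>2 < f a * g b"
        proof -
          obtain u v where uv: "f a = ennreal u" "g b = ennreal v" "u \<ge> 0" "v \<ge> 0"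
            using f1(1)[of a] g1(1)[of b] by (cases "f a"; cases "g b") (auto simp: top_unique)
          then have "t < u" "t < v" using ab True by (auto simp: ennreal_less_iff)
          then have "t * t < u * v" using True by (intro mult_strict_mono') auto
          then show ?thesis using uv True by (simp add: power2_eq_square ennreal_less_iff flip: ennreal_mult)
        qed
        also have "\<dots> \<le> (h ((a + b) / 2))\<^sup>2" by (rule le)
        finally show "(a + b) / 2 \<in> {x. ennreal t < h x}"
          by (metis linorder_not_le mem_Collect_eq power_mono zero_le)
      qed (use f1(2) g1(2) True in auto)
      then show ?thesis using True by simp
    next
      case False
      have "{x. ennreal t < f x} = {}" "{x. ennreal t < g x} = {}" if "t \<ge> 1"
      proof -
        have "1 \<le> ennreal t" using that by (simp add: ennreal_leI flip: ennreal_1)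
        then have "f x \<le> ennreal t" "g x \<le> ennreal t" for x
          using f1(1)[of x] g1(1)[of x] by (auto intro: order_trans)
        then show "{x. ennreal t < f x} = {}" "{x. ennreal t < g x} = {}" by (simp_all add: not_less)
      qed
      then show ?thesis using False by (auto simp: indicator_def)
    qed
  qed
  also have "\<dots> = 2 * (\<integral>\<^sup>+x. h x \<partial>lborel)"
    unfolding nn_integral_layer_cake[OF assms(3)]
    by (simp add: mult.assoc nn_integral_cmult)
  finally show ?thesis .
qed

lemma ennreal_arith_geo_mean:
  fixes x y z :: ennreal
  assumes "x + y \<le> 2 * z"
  shows "x * y \<le> z\<^sup>2"
proof (cases "z = top")
  case False
  then obtain c where c: "z = ennreal c" "c \<ge> 0" by (cases z) auto
  have "2 * z < top" using c by (simp add: ennreal_mult_less_top)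
  with assms have "x + y < top" by (rule le_less_trans)
  then obtain a b where ab: "x = ennreal a" "a \<ge> 0" "y = ennreal b" "b \<ge> 0"
    by (cases x; cases y) auto
  have "ennreal (a + b) \<le> ennreal (2 * c)"
    using assms c ab by (simp add: ennreal_plus ennreal_mult)
  then have "a + b \<le> 2 * c" using ab c by (simp add: ennreal_le_iff del: ennreal_plus)
  then have "(a + b)\<^sup>2 \<le> (2 * c)\<^sup>2" using ab by (intro power_mono) auto
  then have "a * b \<le> c\<^sup>2" using zero_le_power2[of "a - b"] by (simp add: power2_eq_square algebra_simps)
  then show ?thesis using ab c by (simp add: ennreal_leI ennreal_power flip: ennreal_mult)
qed simp

text \<open>Dividing by the suprema turns the additive bound into a multiplicative one by the
  inequality of the arithmetic and geometric means.\<close>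

lemma prekopa_leindler_real_bounded:
  fixes f g h :: "real \<Rightarrow> ennreal"
  assumes [measurable]: "f \<in> borel_measurable lborel" "g \<in> borel_measurable lborel" "h \<in> borel_measurable lborel"
    and le: "\<And>x y. f x * g y \<le> (h ((x + y) / 2))\<^sup>2"
    and bd: "\<And>x. f x \<le> ennreal K" "\<And>x. g x \<le> ennreal K"
    and supp: "bounded {x. f x \<noteq> 0}" "bounded {x. g x \<noteq> 0}"
  shows "(\<integral>\<^sup>+x. f x \<partial>lborel) * (\<integral>\<^sup>+x. g x \<partial>lborel) \<le> (\<integral>\<^sup>+x. h x \<partial>lborel)\<^sup>2"
proof (cases "(SUP x. f x) = 0 \<or> (SUP x. g x) = 0")
  case True
  then have "(\<forall>x. f x = 0) \<or> (\<forall>x. g x = 0)" by (simp add: SUP_eq_iff bot_ennreal[symmetric])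
  then show ?thesis by auto
next
  case False
  have lt: "(SUP x. f x) < top" "(SUP x. g x) < top"
    using bd by (auto intro!: le_less_trans[OF SUP_least[of _ _ "ennreal K"]])
  obtain a where a: "(SUP x. f x) = ennreal a" "a > 0"
    using lt(1) False by (cases "SUP x. f x") (auto simp: less_le)
  obtain b where b: "(SUP x. g x) = ennreal b" "b > 0"
    using lt(2) False by (cases "SUP x. g x") (auto simp: less_le)
  define c where "c = sqrt (a * b)"
  have c: "c > 0" "c * c = a * b" using a b by (auto simp: c_def)
  have norm: "k x / ennreal r \<le> 1" "0 \<le> t \<Longrightarrow> t < 1 \<Longrightarrow> \<exists>x. ennreal t < k x / ennreal r"
    if k: "(SUP x. k x) = ennreal r" and r: "r > 0" for k :: "real \<Rightarrow> ennreal" and r t x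
  proof -
    have "k x \<le> ennreal r" using k by (metis SUP_upper UNIV_I)
    then show "k x / ennreal r \<le> 1" using r by (intro divide_le_posI_ennreal) auto
    show "\<exists>x. ennreal t < k x / ennreal r" if t: "0 \<le> t" "t < 1"
    proof -
      have "ennreal (t * r) < (SUP x. k x)" using t r k by (simp add: ennreal_less_iff)
      then obtain y where "ennreal (t * r) < k y" by (auto simp: less_SUP_iff)
      then have "ennreal t * ennreal r < k y" using t r by (simp add: ennreal_mult)
      then have "ennreal t < k y / ennreal r"
      proof (cases "k y")
        case (real s)
        then have "t * r < s" using \<open>ennreal t * ennreal r < k y\<close> t r by (simp add: ennreal_less_iff flip: ennreal_mult)
        then show ?thesis using real t r by (simp add: divide_ennreal ennreal_less_iff field_simps)
      next
        case top
        then show ?thesis using r by (simp add: ennreal_top_divide)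
      qed
      then show ?thesis ..
    qed
  qed
  define H where "H = (\<integral>\<^sup>+x. h x \<partial>lborel)"
  define F where "F = (\<integral>\<^sup>+x. f x \<partial>lborel)"
  define G where "G = (\<integral>\<^sup>+x. g x \<partial>lborel)"
  have "(\<integral>\<^sup>+x. f x / ennreal a \<partial>lborel) + (\<integral>\<^sup>+x. g x / ennreal b \<partial>lborel)
      \<le> 2 * (\<integral>\<^sup>+x. h x / ennreal c \<partial>lborel)"
  proof (rule prekopa_leindler_real_normalized)
    fix x y
    have "f x / ennreal a * (g y / ennreal b) = f x * g y * (inverse (ennreal a) * inverse (ennreal b))"
      by (simp add: divide_ennreal_def mult_ac)
    also have "inverse (ennreal a) * inverse (ennreal b) = inverse (ennreal c) * inverse (ennreal c)"
    proof -
      have "inverse a * inverse b = inverse c * inverse c" using c(2) a b c(1) by (simp add: field_simps)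
      then show ?thesis using a b c by (simp add: inverse_ennreal flip: ennreal_mult)
    qed
    also have "f x * g y * (inverse (ennreal c) * inverse (ennreal c))
        \<le> (h ((x + y) / 2))\<^sup>2 * (inverse (ennreal c) * inverse (ennreal c))"
      by (intro mult_right_mono le) auto
    also have "\<dots> = (h ((x + y) / 2) / ennreal c)\<^sup>2"
      by (simp add: divide_ennreal_def power2_eq_square mult_ac)
    finally show "f x / ennreal a * (g y / ennreal b) \<le> (h ((x + y) / 2) / ennreal c)\<^sup>2" .
  next
    show "bounded {x. f x / ennreal a \<noteq> 0}" "bounded {x. g x / ennreal b \<noteq> 0}"
      by (rule bounded_subset[OF supp(1)] bounded_subset[OF supp(2)]; auto)+
    show "f x / ennreal a \<le> 1" "g x / ennreal b \<le> 1" for x using norm(1) a b by blast+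
    show "0 \<le> t \<Longrightarrow> t < 1 \<Longrightarrow> \<exists>x. ennreal t < f x / ennreal a"
      "0 \<le> t \<Longrightarrow> t < 1 \<Longrightarrow> \<exists>x. ennreal t < g x / ennreal b" for t using norm(2) a b by blast+
  qed simp_all
  then have "F / ennreal a + G / ennreal b \<le> 2 * (H / ennreal c)"
    by (simp add: nn_integral_divide F_def G_def H_def)
  from ennreal_arith_geo_mean[OF this]
  have "F / ennreal a * (G / ennreal b) \<le> (H / ennreal c)\<^sup>2" .
  then have "F / ennreal a * (G / ennreal b) * (ennreal a * ennreal b) \<le> (H / ennreal c)\<^sup>2 * (ennreal a * ennreal b)"
    by (rule mult_right_mono) simp
  moreover have "F / ennreal a * (G / ennreal b) * (ennreal a * ennreal b) = F * G"
  proof -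
    have one: "ennreal r * inverse (ennreal r) = 1" if "r > 0" for r
      using that by (simp add: inverse_ennreal flip: ennreal_mult)
    have "F / ennreal a * (G / ennreal b) * (ennreal a * ennreal b)
        = F * (ennreal a * inverse (ennreal a)) * (G * (ennreal b * inverse (ennreal b)))"
      unfolding divide_ennreal_def by (simp only: mult_ac)
    also have "\<dots> = F * G" unfolding one[OF a(2)] one[OF b(2)] by simp
    finally show ?thesis .
  qed
  moreover have "(H / ennreal c)\<^sup>2 * (ennreal a * ennreal b) = H\<^sup>2"
  proof -
    have ab: "ennreal a * ennreal b = ennreal c * ennreal c" using a b c by (simp flip: ennreal_mult)
    have one: "ennreal c * inverse (ennreal c) = 1"
      using c by (simp add: inverse_ennreal flip: ennreal_mult)
    have "(H / ennreal c)\<^sup>2 * (ennreal c * ennreal c)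
        = H * (ennreal c * inverse (ennreal c)) * (H * (ennreal c * inverse (ennreal c)))"
      unfolding divide_ennreal_def power2_eq_square by (simp only: mult_ac)
    then show ?thesis unfolding ab one by (simp add: power2_eq_square)
  qed
  ultimately show ?thesis unfolding F_def G_def H_def by (simp only:)
qed

lemma prekopa_leindler_real:
  fixes f g h :: "real \<Rightarrow> ennreal"
  assumes [measurable]: "f \<in> borel_measurable lborel" "g \<in> borel_measurable lborel" "h \<in> borel_measurable lborel"
    and le: "\<And>x y. f x * g y \<le> (h ((x + y) / 2))\<^sup>2"
  shows "(\<integral>\<^sup>+x. f x \<partial>lborel) * (\<integral>\<^sup>+x. g x \<partial>lborel) \<le> (\<integral>\<^sup>+x. h x \<partial>lborel)\<^sup>2"
proof -
  define tr where "tr k n x = min (k x) (ennreal (real n)) * indicator {- real n..real n} x"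
    for k :: "real \<Rightarrow> ennreal" and n x
  have tr_le: "tr k n x \<le> k x" "tr k n x \<le> ennreal (real n)" for k n x
    by (auto simp: tr_def indicator_def)
  have tr_meas: "tr k n \<in> borel_measurable lborel" if [measurable]: "k \<in> borel_measurable lborel" for k n
    unfolding tr_def by measurable
  have inc: "incseq (tr k)" for k
    by (intro incseq_SucI le_funI) (auto simp: tr_def indicator_def min_def intro: order_trans)
  have sup: "(SUP n. tr k n x) = k x" for k x
  proof (rule antisym)
    show "(SUP n. tr k n x) \<le> k x" by (intro SUP_least tr_le)
    show "k x \<le> (SUP n. tr k n x)"
    proof (rule dense_le)
      fix z assume z: "z < k x"
      then obtain r where r: "z = ennreal r" "r \<ge> 0" by (cases z) auto
      obtain n where n: "max r \<bar>x\<bar> \<le> real n" using real_arch_simple by blast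
      have "z \<le> tr k n x" using z r n by (auto simp: tr_def indicator_def min_def ennreal_leI)
      then show "z \<le> (SUP n. tr k n x)" by (rule SUP_upper2[OF UNIV_I])
    qed
  qed
  have int: "(\<integral>\<^sup>+x. k x \<partial>lborel) = (SUP n. \<integral>\<^sup>+x. tr k n x \<partial>lborel)"
    if [measurable]: "k \<in> borel_measurable lborel" for k
  proof -
    have "(\<integral>\<^sup>+x. (SUP n. tr k n x) \<partial>lborel) = (SUP n. \<integral>\<^sup>+x. tr k n x \<partial>lborel)"
      by (rule nn_integral_monotone_convergence_SUP[OF inc tr_meas[OF that]])
    then show ?thesis by (simp add: sup)
  qed
  have part: "(\<integral>\<^sup>+x. tr f m x \<partial>lborel) * (\<integral>\<^sup>+x. tr g n x \<partial>lborel) \<le> (\<integral>\<^sup>+x. h x \<partial>lborel)\<^sup>2" for m n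
  proof (rule prekopa_leindler_real_bounded)
    show "tr f m \<in> borel_measurable lborel" "tr g n \<in> borel_measurable lborel" by (rule tr_meas; fact)+
    show "tr f m x * tr g n y \<le> (h ((x + y) / 2))\<^sup>2" for x y
      by (rule order_trans[OF mult_mono le]) (auto intro: tr_le)
    show "tr f m x \<le> ennreal (real (max m n))" "tr g n x \<le> ennreal (real (max m n))" for x
      by (rule order_trans[OF tr_le(2)], simp add: ennreal_leI)+
    show "bounded {x. tr f m x \<noteq> 0}" "bounded {x. tr g n x \<noteq> 0}"
      by (rule bounded_subset[OF bounded_closed_interval[of "- real m" "real m"]]
               bounded_subset[OF bounded_closed_interval[of "- real n" "real n"]]; auto simp: tr_def indicator_def)+
  qed simp
  show ?thesis
    unfolding int[OF assms(1)] int[OF assms(2)]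
    by (subst SUP_mult_right_ennreal, intro SUP_least, subst SUP_mult_left_ennreal, intro SUP_least part)
qed

text \<open>Induction over the coordinates: the integrals over slices satisfy the hypothesis in the remaining
  variable.\<close>

lemma prekopa_leindler_PiM:
  fixes f g h :: "('i \<Rightarrow> real) \<Rightarrow> ennreal"
  assumes "finite I"
    and "f \<in> borel_measurable (\<Pi>\<^sub>M i\<in>I. lborel)" "g \<in> borel_measurable (\<Pi>\<^sub>M i\<in>I. lborel)"
      "h \<in> borel_measurable (\<Pi>\<^sub>M i\<in>I. lborel)"
    and "\<And>x y. x \<in> space (\<Pi>\<^sub>M i\<in>I. lborel) \<Longrightarrow> y \<in> space (\<Pi>\<^sub>M i\<in>I. lborel) \<Longrightarrow>
      f x * g y \<le> (h (\<lambda>i\<in>I. (x i + y i) / 2))\<^sup>2"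
  shows "(\<integral>\<^sup>+x. f x \<partial>(\<Pi>\<^sub>M i\<in>I. lborel)) * (\<integral>\<^sup>+x. g x \<partial>(\<Pi>\<^sub>M i\<in>I. lborel))
    \<le> (\<integral>\<^sup>+x. h x \<partial>(\<Pi>\<^sub>M i\<in>I. lborel))\<^sup>2"
  using assms
proof (induction I arbitrary: f g h rule: finite_induct)
  case empty
  interpret product_sigma_finite "\<lambda>_::'i. lborel :: real measure" by standard
  have "f (\<lambda>_. undefined) * g (\<lambda>_. undefined) \<le> (h (\<lambda>i\<in>{}. ((\<lambda>_. undefined) i + (\<lambda>_. undefined) i) / 2))\<^sup>2"
    by (rule empty) (auto simp: space_PiM)
  then show ?case by (simp add: nn_integral_empty restrict_def)
next
  case (insert i I)
  interpret product_sigma_finite "\<lambda>_::'i. lborel :: real measure" by standard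
  note [measurable] = insert.prems(1-3)
  have slice: "(\<lambda>x. k (x(i := y))) \<in> borel_measurable (\<Pi>\<^sub>M i\<in>I. lborel)"
    if "k \<in> borel_measurable (\<Pi>\<^sub>M i\<in>insert i I. lborel)" for k :: "('i \<Rightarrow> real) \<Rightarrow> ennreal" and y
    using that by measurable
  have int_meas: "(\<lambda>y. \<integral>\<^sup>+x. k (x(i := y)) \<partial>(\<Pi>\<^sub>M i\<in>I. lborel)) \<in> borel_measurable lborel"
    if [measurable]: "k \<in> borel_measurable (\<Pi>\<^sub>M i\<in>insert i I. lborel)" for k :: "('i \<Rightarrow> real) \<Rightarrow> ennreal"
  proof -
    interpret finite_product_sigma_finite "\<lambda>_::'i. lborel :: real measure" I by standard (fact insert.hyps(1))
    show ?thesis by measurable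
  qed
  show ?case
    unfolding insert.prems(1-3)[THEN product_nn_integral_insert_rev[OF insert.hyps(1,2)]]
  proof (rule prekopa_leindler_real)
    fix y z
    show "(\<integral>\<^sup>+x. f (x(i := y)) \<partial>(\<Pi>\<^sub>M i\<in>I. lborel)) * (\<integral>\<^sup>+x. g (x(i := z)) \<partial>(\<Pi>\<^sub>M i\<in>I. lborel))
      \<le> (\<integral>\<^sup>+x. h (x(i := (y + z) / 2)) \<partial>(\<Pi>\<^sub>M i\<in>I. lborel))\<^sup>2"
    proof (rule insert.IH)
      fix a b assume ab: "a \<in> space (\<Pi>\<^sub>M i\<in>I. lborel :: real measure)" "b \<in> space (\<Pi>\<^sub>M i\<in>I. lborel :: real measure)"
      have "f (a(i := y)) * g (b(i := z)) \<le> (h (\<lambda>j\<in>insert i I. ((a(i := y)) j + (b(i := z)) j) / 2))\<^sup>2"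
        using ab by (intro insert.prems(4)) (auto simp: space_PiM PiE_def extensional_def)
      also have "(\<lambda>j\<in>insert i I. ((a(i := y)) j + (b(i := z)) j) / 2) = (\<lambda>j\<in>I. (a j + b j) / 2)(i := (y + z) / 2)"
        using insert.hyps by (auto simp: fun_eq_iff restrict_def)
      finally show "f (a(i := y)) * g (b(i := z)) \<le> (h ((\<lambda>j\<in>I. (a j + b j) / 2)(i := (y + z) / 2)))\<^sup>2" .
    qed (intro slice insert.prems)+
  qed (intro int_meas insert.prems)+
qed

text \<open>The multiplicative form of the Brunn-Minkowski inequality.\<close>

lemma brunn_minkowski_multiplicative:
  fixes A B C :: "'a::euclidean_space set"
  assumes [measurable]: "A \<in> sets borel" "B \<in> sets borel" "C \<in> sets borel"
    and mid: "\<And>a b. a \<in> A \<Longrightarrow> b \<in> B \<Longrightarrow> (1 / 2) *\<^sub>R (a + b) \<in> C"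
  shows "emeasure lborel A * emeasure lborel B \<le> (emeasure lborel C)\<^sup>2"
proof -
  let ?P = "\<Pi>\<^sub>M b\<in>(Basis :: 'a set). lborel :: real measure"
  define T :: "('a \<Rightarrow> real) \<Rightarrow> 'a" where "T x = (\<Sum>b\<in>Basis. x b *\<^sub>R b)" for x
  have [measurable]: "T \<in> ?P \<rightarrow>\<^sub>M borel" unfolding T_def by measurable
  have lb: "lborel = distr ?P borel T" unfolding T_def by (rule lborel_eq)
  have em: "emeasure lborel S = (\<integral>\<^sup>+x. indicator S (T x) \<partial>?P)" if [measurable]: "S \<in> sets borel" for S :: "'a set"
  proof -
    have "emeasure lborel S = (\<integral>\<^sup>+x. indicator S x \<partial>lborel)" by simp
    also have "\<dots> = (\<integral>\<^sup>+x. indicator S (T x) \<partial>?P)"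
      by (subst lb, subst nn_integral_distr) auto
    finally show ?thesis .
  qed
  show ?thesis unfolding em[OF assms(1)] em[OF assms(2)] em[OF assms(3)]
  proof (rule prekopa_leindler_PiM)
    fix x y
    have "T (\<lambda>i\<in>Basis. (x i + y i) / 2) = (1 / 2) *\<^sub>R (T x + T y)"
      unfolding T_def by (simp add: scaleR_sum_right sum.distrib[symmetric] scaleR_add_left[symmetric] add_divide_distrib cong: sum.cong)
    then show "indicator A (T x) * indicator B (T y)
        \<le> (indicator C (T (\<lambda>i\<in>Basis. (x i + y i) / 2)) :: ennreal)\<^sup>2"
      using mid by (auto simp: indicator_def)
  qed auto
qed

section \<open>The smoothed function and its gradient\<close>

lemma unif_ball_eq_density:
  "(unif_ball :: 'a::euclidean_space measure)
    = density lborel (\<lambda>w. ennreal (indicator (cball 0 1) w / measure lborel (cball (0::'a) 1)))"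
proof -
  have V: "emeasure lborel (cball (0::'a) 1) = ennreal (measure lborel (cball (0::'a) 1))"
    using emeasure_lborel_cball_finite[of "0::'a" 1] by (intro emeasure_eq_ennreal_measure) auto
  have "measure lborel (cball (0::'a) 1) > 0" by (rule content_cball_pos) simp
  then have "(\<lambda>w::'a. indicator (cball 0 1) w / emeasure lborel (cball (0::'a) 1))
      = (\<lambda>w. ennreal (indicator (cball 0 1) w / measure lborel (cball (0::'a) 1)))"
    unfolding V by (auto simp: fun_eq_iff indicator_def divide_ennreal ennreal_1[symmetric] simp del: ennreal_1)
  then show ?thesis by (simp add: unif_ball_def uniform_measure_def)
qed

lemma unif_ball_integral:
  fixes \<phi> :: "'a::euclidean_space \<Rightarrow> 'b::{banach, second_countable_topology}"
  assumes [measurable]: "\<phi> \<in> borel_measurable borel"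
  shows "(LINT w|unif_ball. \<phi> w)
    = (1 / measure lborel (cball (0::'a) 1)) *\<^sub>R (LINT w|lborel. indicator (cball 0 1) w *\<^sub>R \<phi> w)"
proof -
  have "(LINT w|unif_ball. \<phi> w) = (LINT w|lborel. (indicator (cball 0 1) w / measure lborel (cball (0::'a) 1)) *\<^sub>R \<phi> w)"
    unfolding unif_ball_eq_density by (subst integral_density) auto
  also have "\<dots> = (LINT w|lborel. (1 / measure lborel (cball (0::'a) 1)) *\<^sub>R (indicator (cball 0 1) w *\<^sub>R \<phi> w))"
    by (intro Bochner_Integration.integral_cong) auto
  also have "\<dots> = (1 / measure lborel (cball (0::'a) 1)) *\<^sub>R (LINT w|lborel. indicator (cball 0 1) w *\<^sub>R \<phi> w)"
    by (rule integral_scaleR_right)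
  finally show ?thesis .
qed

lemma sets_unif_ball [simp, measurable_cong]: "sets (unif_ball :: 'a::euclidean_space measure) = sets borel"
  by (simp add: unif_ball_def)

lemma space_unif_ball [simp]: "space (unif_ball :: 'a::euclidean_space measure) = UNIV"
  by (simp add: unif_ball_def)

lemma sets_unif_sphere [simp, measurable_cong]: "sets (unif_sphere :: 'a::euclidean_space measure) = sets borel"
  by (simp add: unif_sphere_def)

lemma space_unif_sphere [simp]: "space (unif_sphere :: 'a::euclidean_space measure) = UNIV"
  by (simp add: unif_sphere_def)

lemma prob_space_unif_ball: "prob_space (unif_ball :: 'a::euclidean_space measure)"
  unfolding unif_ball_def
proof (rule prob_space_uniform_measure)
  have "measure lborel (cball (0::'a) 1) > 0" by (rule content_cball_pos) simp
  then show "emeasure lborel (cball (0::'a) 1) \<noteq> 0" by (auto simp: measure_def)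
  show "emeasure lborel (cball (0::'a) 1) \<noteq> \<infinity>" using emeasure_lborel_cball_finite[of "0::'a" 1] by simp
qed

lemma sgn_measurable_unif_ball [measurable]: "sgn \<in> unif_ball \<rightarrow>\<^sub>M (borel :: 'a::euclidean_space measure)"
  using sgn_borel_measurable by (simp add: measurable_def)

lemma prob_space_unif_sphere: "prob_space (unif_sphere :: 'a::euclidean_space measure)"
  unfolding unif_sphere_def by (intro prob_space.prob_space_distr prob_space_unif_ball sgn_measurable_unif_ball)

lemma AE_unif_ball: "AE w in (unif_ball :: 'a::euclidean_space measure). norm w \<le> 1"
  unfolding unif_ball_def by (rule AE_uniform_measureI) auto

lemma AE_unif_sphere: "AE w in (unif_sphere :: 'a::euclidean_space measure). norm w \<le> 1"
  unfolding unif_sphere_def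
  by (subst AE_distr_iff) (auto simp: norm_sgn intro!: AE_I2)

lemma unif_sphere_integral:
  fixes \<phi> :: "'a::euclidean_space \<Rightarrow> 'b::{banach, second_countable_topology}"
  assumes [measurable]: "\<phi> \<in> borel_measurable borel"
  shows "(LINT w|unif_sphere. \<phi> w) = (LINT w|unif_ball. \<phi> (sgn w))"
  unfolding unif_sphere_def by (rule integral_distr) auto

lemma unif_ball_integrable:
  fixes \<phi> :: "'a::euclidean_space \<Rightarrow> 'b::{banach, second_countable_topology}"
  assumes [measurable]: "\<phi> \<in> borel_measurable borel" and bd: "\<And>w. norm w \<le> 1 \<Longrightarrow> norm (\<phi> w) \<le> K"
  shows "integrable unif_ball \<phi>"
proof -
  interpret prob_space "unif_ball :: 'a measure" by (rule prob_space_unif_ball)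
  show ?thesis by (rule integrable_const_bound[where B=K]) (use AE_unif_ball bd in \<open>auto elim: eventually_mono\<close>)
qed

lemma unif_sphere_integrable:
  fixes \<phi> :: "'a::euclidean_space \<Rightarrow> 'b::{banach, second_countable_topology}"
  assumes [measurable]: "\<phi> \<in> borel_measurable borel" and bd: "\<And>w. norm w \<le> 1 \<Longrightarrow> norm (\<phi> w) \<le> K"
  shows "integrable unif_sphere \<phi>"
proof -
  interpret prob_space "unif_sphere :: 'a measure" by (rule prob_space_unif_sphere)
  show ?thesis by (rule integrable_const_bound[where B=K]) (use AE_unif_sphere bd in \<open>auto elim: eventually_mono\<close>)
qed

lemma unif_sphere_integral_uminus:
  fixes \<phi> :: "'a::euclidean_space \<Rightarrow> 'b::{banach, second_countable_topology}"
  assumes [measurable]: "\<phi> \<in> borel_measurable borel"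
  shows "(LINT w|unif_sphere. \<phi> (- w)) = (LINT w|unif_sphere. \<phi> w)"
proof -
  have [measurable]: "(\<lambda>w. \<phi> (sgn w)) \<in> borel_measurable borel"
    by (rule measurable_compose[OF sgn_borel_measurable assms(1)])
  have [measurable]: "(\<lambda>w. \<phi> (- w)) \<in> borel_measurable borel"
    by (rule measurable_compose[OF _ assms(1)]) measurable
  have [measurable]: "(\<lambda>w. \<phi> (- sgn w)) \<in> borel_measurable borel"
    by (rule measurable_compose[OF sgn_borel_measurable]) measurable
  have "(LINT w|lborel. indicator (cball 0 1) w *\<^sub>R \<phi> (sgn w))
      = \<bar>- 1\<bar> ^ DIM('a) *\<^sub>R (LINT w|lborel. indicator (cball 0 1) ((- 1) *\<^sub>R w) *\<^sub>R \<phi> (sgn ((- 1) *\<^sub>R w)))"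
    by (rule lborel_integral_scale) auto
  also have "(\<lambda>w. indicator (cball 0 1) ((- 1) *\<^sub>R w) *\<^sub>R \<phi> (sgn ((- 1) *\<^sub>R w))) = (\<lambda>w. indicator (cball 0 1) w *\<^sub>R \<phi> (- sgn w))"
    by (auto simp: fun_eq_iff indicator_def sgn_minus)
  finally show ?thesis by (simp add: unif_sphere_integral unif_ball_integral)
qed

lemma GDERIV_unique:
  assumes "GDERIV f x :> D" "GDERIV f x :> E"
  shows "D = E"
proof -
  have "(\<lambda>h. h \<bullet> D) = (\<lambda>h. h \<bullet> E)"
    using assms unfolding gderiv_def by (rule has_derivative_unique)
  then have "(D - E) \<bullet> D = (D - E) \<bullet> E" by metis
  then have "(D - E) \<bullet> (D - E) = 0" by (simp add: inner_diff_right)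
  then show ?thesis by simp
qed

lemma GDERIV_along_line:
  assumes "GDERIV S (x + s *\<^sub>R v) :> D"
  shows "((\<lambda>t. S (x + t *\<^sub>R v)) has_real_derivative D \<bullet> v) (at s)"
proof -
  have "((\<lambda>t. x + t *\<^sub>R v) has_derivative (\<lambda>h. h *\<^sub>R v)) (at s)" by (auto intro!: derivative_eq_intros)
  from has_derivative_compose[OF this assms[unfolded gderiv_def]]
  have "((\<lambda>t. S (x + t *\<^sub>R v)) has_derivative (\<lambda>h. (h *\<^sub>R v) \<bullet> D)) (at s)" .
  also have "(\<lambda>h. (h *\<^sub>R v) \<bullet> D) = (*) (D \<bullet> v)" by (simp add: fun_eq_iff inner_commute)
  finally show ?thesis by (simp add: has_field_derivative_def)
qed

lemma gradient_eq: "GDERIV f x :> D \<Longrightarrow> gradient f x = D"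
  unfolding gradient_def by (rule the_equality) (auto intro: GDERIV_unique)

text \<open>The case \<open>\<delta> = 1\<close> for the rescaled function \<open>y \<mapsto> f (\<delta> *\<^sub>R y)\<close> is the divergence theorem above.\<close>

theorem smoothing_GDERIV:
  fixes f :: "'a::euclidean_space \<Rightarrow> real"
  assumes f: "continuous_on UNIV f" and \<delta>: "\<delta> > 0"
  shows "GDERIV (smoothing f \<delta>) x :> (real DIM('a) / \<delta>) *\<^sub>R (LINT w|unif_sphere. f (x + \<delta> *\<^sub>R w) *\<^sub>R w)"
proof -
  define u where "u y = f (\<delta> *\<^sub>R y)" for y
  have u: "continuous_on UNIV u" unfolding u_def
    by (intro continuous_on_compose2[OF f] continuous_intros) auto
  have fm [measurable]: "f \<in> borel_measurable borel" using f by (rule borel_measurable_continuous_onI)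
  define V where "V = measure lborel (cball (0::'a) 1)"
  have shift: "u ((1 / \<delta>) *\<^sub>R z + w) = f (z + \<delta> *\<^sub>R w)" for z w using \<delta> by (simp add: u_def scaleR_add_right)
  have S: "smoothing f \<delta> z = (1 / V) * (LINT w|lborel. indicator (cball 0 1) w * u ((1 / \<delta>) *\<^sub>R z + w))" for z
    unfolding smoothing_def shift by (subst unif_ball_integral) (auto simp: V_def)
  have I: "(1 / V) *\<^sub>R (LINT w|lborel. indicator (cball 0 1) w *\<^sub>R (u ((1 / \<delta>) *\<^sub>R x + sgn w) *\<^sub>R sgn w))
      = (LINT w|unif_sphere. f (x + \<delta> *\<^sub>R w) *\<^sub>R w)"
    unfolding shift by (subst unif_sphere_integral, measurable, subst unif_ball_integral, measurable, simp add: V_def)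
  have "((\<lambda>z. (1 / V) * (LINT w|lborel. indicator (cball 0 1) w * u ((1 / \<delta>) *\<^sub>R z + w))) has_derivative
      (\<lambda>h. (1 / V) * ((real DIM('a) *\<^sub>R (LINT w|lborel. indicator (cball 0 1) w *\<^sub>R (u ((1 / \<delta>) *\<^sub>R x + sgn w) *\<^sub>R sgn w))) \<bullet> ((1 / \<delta>) *\<^sub>R h)))) (at x)"
    by (intro has_derivative_mult_right
          has_derivative_compose[OF has_derivative_scaleR_right[OF has_derivative_ident] ball_average_has_derivative[OF u]])
  then have "(smoothing f \<delta> has_derivative
      (\<lambda>h. (1 / V) * ((real DIM('a) *\<^sub>R (LINT w|lborel. indicator (cball 0 1) w *\<^sub>R (u ((1 / \<delta>) *\<^sub>R x + sgn w) *\<^sub>R sgn w))) \<bullet> ((1 / \<delta>) *\<^sub>R h)))) (at x)"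
    unfolding S[abs_def] .
  moreover have "(1 / V) * ((real DIM('a) *\<^sub>R J) \<bullet> ((1 / \<delta>) *\<^sub>R h)) = h \<bullet> ((real DIM('a) / \<delta>) *\<^sub>R ((1 / V) *\<^sub>R J))" for J h :: 'a
    by (simp add: inner_commute)
  ultimately show ?thesis unfolding gderiv_def I[symmetric] by simp
qed

lemma gradient_smoothing:
  fixes f :: "'a::euclidean_space \<Rightarrow> real"
  assumes "continuous_on UNIV f" "\<delta> > 0"
  shows "gradient (smoothing f \<delta>) x = (real DIM('a) / \<delta>) *\<^sub>R (LINT w|unif_sphere. f (x + \<delta> *\<^sub>R w) *\<^sub>R w)"
    and "GDERIV (smoothing f \<delta>) x :> gradient (smoothing f \<delta>) x"
  using smoothing_GDERIV[OF assms] gradient_eq by metis+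

lemma continuous_bounded_cball:
  fixes f :: "'a::euclidean_space \<Rightarrow> real"
  assumes f: "continuous_on UNIV f" and \<delta>: "\<delta> \<ge> 0"
  obtains K where "\<And>w. norm w \<le> 1 \<Longrightarrow> \<bar>f (x + \<delta> *\<^sub>R w)\<bar> \<le> K" "\<And>w. norm w \<le> 1 \<Longrightarrow> \<bar>f (x - \<delta> *\<^sub>R w)\<bar> \<le> K"
proof -
  have "compact (f ` cball x \<delta>)" by (intro compact_continuous_image continuous_on_subset[OF f]) auto
  then have "\<exists>K. \<forall>y\<in>cball x \<delta>. \<bar>f y\<bar> \<le> K" by (auto dest!: compact_imp_bounded simp: bounded_iff)
  then obtain K where K: "\<And>y. y \<in> cball x \<delta> \<Longrightarrow> \<bar>f y\<bar> \<le> K" by metis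
  show thesis
    by (rule that[of K]; rule K) (use \<delta> in \<open>auto simp: dist_norm mult_left_le\<close>)
qed

lemma smoothing_integrable:
  fixes f :: "'a::euclidean_space \<Rightarrow> real"
  assumes f: "continuous_on UNIV f" and \<delta>: "\<delta> \<ge> 0"
  shows "integrable unif_ball (\<lambda>w. f (x + \<delta> *\<^sub>R w))"
proof -
  have [measurable]: "f \<in> borel_measurable borel" using f by (rule borel_measurable_continuous_onI)
  obtain K where K: "\<And>w. norm w \<le> 1 \<Longrightarrow> \<bar>f (x + \<delta> *\<^sub>R w)\<bar> \<le> K" using continuous_bounded_cball[OF f \<delta>] by metis
  show ?thesis by (rule unif_ball_integrable[where K=K]) (use K in auto)
qed

text \<open>By the symmetry of the sphere both halves of the two-point estimator have the same mean.\<close>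

lemma integral_grad_est:
  fixes f :: "'a::euclidean_space \<Rightarrow> real"
  assumes f: "continuous_on UNIV f" and \<delta>: "\<delta> > 0"
  shows "(LINT w|unif_sphere. grad_est f \<delta> x w) = gradient (smoothing f \<delta>) x"
proof -
  have [measurable]: "f \<in> borel_measurable borel" using f by (rule borel_measurable_continuous_onI)
  obtain K where K: "\<And>w. norm w \<le> 1 \<Longrightarrow> \<bar>f (x + \<delta> *\<^sub>R w)\<bar> \<le> K" "\<And>w. norm w \<le> 1 \<Longrightarrow> \<bar>f (x - \<delta> *\<^sub>R w)\<bar> \<le> K"
    using continuous_bounded_cball[OF f, of \<delta> x] \<delta> by (metis less_imp_le)
  have K0: "0 \<le> K" using K(1)[of 0] by simp
  have ip: "integrable unif_sphere (\<lambda>w. f (x + \<delta> *\<^sub>R w) *\<^sub>R w)"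
  proof (rule unif_sphere_integrable[where K=K])
    show "norm (f (x + \<delta> *\<^sub>R w) *\<^sub>R w) \<le> K" if "norm w \<le> 1" for w
      using mult_mono[OF K(1)[OF that] that K0] by simp
  qed measurable
  have im: "integrable unif_sphere (\<lambda>w. f (x - \<delta> *\<^sub>R w) *\<^sub>R w)"
  proof (rule unif_sphere_integrable[where K=K])
    show "norm (f (x - \<delta> *\<^sub>R w) *\<^sub>R w) \<le> K" if "norm w \<le> 1" for w
      using mult_mono[OF K(2)[OF that] that K0] by simp
  qed measurable
  have "(LINT w|unif_sphere. f (x - \<delta> *\<^sub>R w) *\<^sub>R w) = (LINT w|unif_sphere. f (x - \<delta> *\<^sub>R (- w)) *\<^sub>R (- w))"
    by (rule unif_sphere_integral_uminus[symmetric]) measurable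
  also have "\<dots> = - (LINT w|unif_sphere. f (x + \<delta> *\<^sub>R w) *\<^sub>R w)" by simp
  finally have neg: "(LINT w|unif_sphere. f (x - \<delta> *\<^sub>R w) *\<^sub>R w) = - (LINT w|unif_sphere. f (x + \<delta> *\<^sub>R w) *\<^sub>R w)" .
  have "(LINT w|unif_sphere. grad_est f \<delta> x w)
      = (LINT w|unif_sphere. (real DIM('a) / (2 * \<delta>)) *\<^sub>R (f (x + \<delta> *\<^sub>R w) *\<^sub>R w - f (x - \<delta> *\<^sub>R w) *\<^sub>R w))"
    unfolding grad_est_def by (intro Bochner_Integration.integral_cong refl) (simp add: scaleR_diff_left[symmetric])
  also have "\<dots> = (real DIM('a) / (2 * \<delta>)) *\<^sub>R (2 *\<^sub>R (LINT w|unif_sphere. f (x + \<delta> *\<^sub>R w) *\<^sub>R w))"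
    unfolding integral_scaleR_right Bochner_Integration.integral_diff[OF ip im] neg by (simp add: scaleR_2)
  finally show ?thesis unfolding gradient_smoothing(1)[OF f \<delta>] by simp
qed

lemma smoothing_ge:
  fixes f :: "'a::euclidean_space \<Rightarrow> real"
  assumes f: "continuous_on UNIV f" and \<delta>: "\<delta> \<ge> 0" and "\<And>y. m \<le> f y"
  shows "m \<le> smoothing f \<delta> x"
proof -
  interpret prob_space "unif_ball :: 'a measure" by (rule prob_space_unif_ball)
  show ?thesis unfolding smoothing_def
    by (rule integral_ge_const) (use smoothing_integrable[OF f \<delta>] assms(3) in auto)
qed

lemma continuous_on_smoothing:
  fixes f :: "'a::euclidean_space \<Rightarrow> real"
  assumes f: "continuous_on UNIV f" and \<delta>: "\<delta> > 0"
  shows "continuous_on UNIV (smoothing f \<delta>)"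
  using smoothing_GDERIV[OF f \<delta>] unfolding gderiv_def
  by (meson continuous_at_imp_continuous_on has_derivative_continuous)

lemma gradient_smoothing_measurable:
  fixes f :: "'a::euclidean_space \<Rightarrow> real"
  assumes f: "continuous_on UNIV f" and \<delta>: "\<delta> > 0"
  shows "gradient (smoothing f \<delta>) \<in> borel_measurable borel"
proof -
  interpret prob_space "unif_sphere :: 'a measure" by (rule prob_space_unif_sphere)
  have [measurable]: "f \<in> borel_measurable borel" using f by (rule borel_measurable_continuous_onI)
  have "(\<lambda>x. LINT w|unif_sphere. f (x + \<delta> *\<^sub>R w) *\<^sub>R w) \<in> borel_measurable borel"
    by (rule borel_measurable_lebesgue_integral) measurable
  then show ?thesis unfolding gradient_smoothing(1)[OF f \<delta>, abs_def] by measurable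
qed

text \<open>If the gradient were outside the Goldstein subdifferential, a hyperplane would separate
  them; in the direction of its normal every Clarke derivative on the ball, hence \<open>f\<close> and its
  average, would grow more slowly than the gradient says.\<close>

lemma gradient_smoothing_in_goldstein:
  fixes f :: "'a::euclidean_space \<Rightarrow> real"
  assumes lip: "locally_lipschitz f" and \<delta>: "\<delta> > 0"
    and comp: "compact (goldstein_subdiff f \<delta> x)"
  shows "gradient (smoothing f \<delta>) x \<in> goldstein_subdiff f \<delta> x"
proof (rule ccontr)
  define G where "G = gradient (smoothing f \<delta>) x"
  assume "gradient (smoothing f \<delta>) x \<notin> goldstein_subdiff f \<delta> x"
  moreover have "convex (goldstein_subdiff f \<delta> x)" by (simp add: goldstein_subdiff_def)
  ultimately obtain a b where ab: "a \<bullet> G < b" "\<And>z. z \<in> goldstein_subdiff f \<delta> x \<Longrightarrow> b < a \<bullet> z"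
    using separating_hyperplane_closed_point[of "goldstein_subdiff f \<delta> x" G] compact_imp_closed[OF comp] by (metis G_def)
  define v where "v = - a"
  obtain k where k: "- b < k" "k < G \<bullet> v" using ab(1) dense[of "- b" "G \<bullet> v"] by (auto simp: v_def inner_commute)
  have cont: "continuous_on UNIV f" by (rule locally_lipschitz_continuous[OF lip])
  have "\<exists>e>0. \<forall>z t. dist z y < e \<longrightarrow> 0 < t \<longrightarrow> t < e \<longrightarrow> f (z + t *\<^sub>R v) - f z \<le> k * t" if y: "y \<in> cball x \<delta>" for y
  proof -
    have "clarke_dderiv f y v \<le> ereal (- b)"
    proof (rule clarke_dderiv_le_of_subdiff[OF lip])
      fix \<zeta> assume "\<zeta> \<in> clarke_subdiff f y"
      then have "\<zeta> \<in> goldstein_subdiff f \<delta> x" unfolding goldstein_subdiff_def using y by (intro hull_inc) auto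
      from ab(2)[OF this] show "\<zeta> \<bullet> v \<le> - b" by (simp add: v_def inner_commute)
    qed
    also have "\<dots> < ereal k" using k by simp
    finally show ?thesis using quotient_bound_of_clarke_dderiv_less unfolding quotient_bound_def by metis
  qed
  then obtain e where e: "\<And>y. y \<in> cball x \<delta> \<Longrightarrow> e y > 0"
    "\<And>y z t. y \<in> cball x \<delta> \<Longrightarrow> dist z y < e y \<Longrightarrow> 0 < t \<Longrightarrow> t < e y \<Longrightarrow> f (z + t *\<^sub>R v) - f z \<le> k * t"
    by metis
  obtain Y where Y: "Y \<subseteq> cball x \<delta>" "finite Y" "cball x \<delta> \<subseteq> (\<Union>y\<in>Y. ball y (e y))"
    by (rule compactE_image[OF compact_cball[of x \<delta>], of "cball x \<delta>" "\<lambda>y. ball y (e y)"]) (use e(1) in force)+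
  have "Y \<noteq> {}" using Y(3) \<delta> by auto
  define \<tau> where "\<tau> = Min (e ` Y)"
  have \<tau>: "\<tau> > 0" using Y e(1) \<open>Y \<noteq> {}\<close> by (auto simp: \<tau>_def)
  have slow: "f (z + t *\<^sub>R v) - f z \<le> k * t" if z: "z \<in> cball x \<delta>" and t: "0 < t" "t < \<tau>" for z t
  proof -
    obtain y where y: "y \<in> Y" "dist z y < e y" using Y(3) z by (auto simp: dist_commute)
    moreover have "\<tau> \<le> e y" using Y y by (auto simp: \<tau>_def)
    ultimately show ?thesis using e(2)[of y z t] Y t by auto
  qed
  have S_slow: "smoothing f \<delta> (x + t *\<^sub>R v) - smoothing f \<delta> x \<le> k * t" if t: "0 < t" "t < \<tau>" for t
  proof -
    interpret prob_space "unif_ball :: 'a measure" by (rule prob_space_unif_ball)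
    have "integrable unif_ball (\<lambda>w. f (x + \<delta> *\<^sub>R w))" "integrable unif_ball (\<lambda>w. f ((x + t *\<^sub>R v) + \<delta> *\<^sub>R w))"
      using smoothing_integrable[OF cont] \<delta> by simp_all
    note i = this
    have "(LINT w|unif_ball. f ((x + t *\<^sub>R v) + \<delta> *\<^sub>R w) - f (x + \<delta> *\<^sub>R w)) \<le> k * t"
    proof (rule integral_le_const)
      show "integrable unif_ball (\<lambda>w. f ((x + t *\<^sub>R v) + \<delta> *\<^sub>R w) - f (x + \<delta> *\<^sub>R w))" using i by simp
      show "AE w in unif_ball. f ((x + t *\<^sub>R v) + \<delta> *\<^sub>R w) - f (x + \<delta> *\<^sub>R w) \<le> k * t"
        using AE_unif_ball
      proof eventually_elim
        case (elim w)
        have "x + \<delta> *\<^sub>R w \<in> cball x \<delta>" using elim \<delta> by (simp add: dist_norm mult_left_le)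
        from slow[OF this t] show ?case by (simp add: algebra_simps)
      qed
    qed
    then show ?thesis using i by (simp add: smoothing_def)
  qed
  have D: "GDERIV (smoothing f \<delta>) (x + 0 *\<^sub>R v) :> G" using gradient_smoothing(2)[OF cont \<delta>] by (simp add: G_def)
  from GDERIV_along_line[OF this]
  have "((\<lambda>t. smoothing f \<delta> (x + t *\<^sub>R v)) has_real_derivative G \<bullet> v) (at 0)" .
  then have "((\<lambda>t. smoothing f \<delta> (x + t *\<^sub>R v) - k * t) has_real_derivative (G \<bullet> v - k)) (at 0)"
    by (auto intro!: derivative_eq_intros)
  then obtain r where r: "r > 0"
    "\<And>h. 0 < h \<Longrightarrow> h < r \<Longrightarrow> smoothing f \<delta> x < smoothing f \<delta> (x + h *\<^sub>R v) - k * h"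
    using DERIV_pos_inc_right[of "\<lambda>t. smoothing f \<delta> (x + t *\<^sub>R v) - k * t" "G \<bullet> v - k" 0] k(2) by auto
  define h where "h = min r \<tau> / 2"
  have "0 < h" "h < r" "h < \<tau>" using r(1) \<tau> by (auto simp: h_def)
  with r(2)[of h] S_slow[of h] show False by simp
qed

lemma norm_goldstein_le:
  fixes f :: "'a::euclidean_space \<Rightarrow> real"
  assumes "\<And>y \<zeta>. y \<in> cball x \<delta> \<Longrightarrow> \<zeta> \<in> clarke_subdiff f y \<Longrightarrow> norm \<zeta> \<le> M" "g \<in> goldstein_subdiff f \<delta> x"
  shows "norm g \<le> M"
proof -
  have "convex hull (\<Union>y\<in>cball x \<delta>. clarke_subdiff f y) \<subseteq> cball 0 M"
    by (rule hull_minimal) (use assms(1) in auto)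
  then show ?thesis using assms(2) unfolding goldstein_subdiff_def by auto
qed

lemma goldstein_stationaryI:
  fixes f :: "'a::euclidean_space \<Rightarrow> real"
  assumes comp: "compact (goldstein_subdiff f \<delta> x)" and g: "g \<in> goldstein_subdiff f \<delta> x" "norm g \<le> \<epsilon>"
  shows "goldstein_stationary f \<delta> \<epsilon> x"
proof -
  obtain h where h: "h \<in> goldstein_subdiff f \<delta> x" "\<And>y. y \<in> goldstein_subdiff f \<delta> x \<Longrightarrow> norm h \<le> norm y"
    using continuous_attains_inf[OF comp, of norm] g by (auto intro: continuous_on_norm_id)
  have "norm h \<le> \<epsilon>" using h(2)[OF g(1)] g(2) by simp
  then show ?thesis unfolding goldstein_stationary_def is_arg_min_def using h
    by (intro exI[of _ h]) (auto simp: not_less)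
qed

text \<open>Comparing the two formulas for the gradient of a linear function yields the second moments of
  the uniform distribution on the sphere.\<close>

lemma unif_sphere_second_moment:
  fixes v :: "'a::euclidean_space"
  shows "(LINT w|unif_sphere. (v \<bullet> w)\<^sup>2) = (norm v)\<^sup>2 / real DIM('a)"
proof -
  interpret prob_space "unif_ball :: 'a measure" by (rule prob_space_unif_ball)
  have c: "continuous_on UNIV (\<lambda>y. v \<bullet> y)" by (intro continuous_intros)
  have i: "integrable unif_ball (\<lambda>w::'a. v \<bullet> w)" using smoothing_integrable[OF c, of 1 0] by simp
  have "smoothing (\<lambda>y. v \<bullet> y) 1 x = v \<bullet> x + (LINT w|unif_ball. v \<bullet> w)" for x
    unfolding smoothing_def using i by (simp add: inner_add_right prob_space[simplified])
  moreover have "GDERIV (\<lambda>x. v \<bullet> x + (LINT w|unif_ball. v \<bullet> w)) 0 :> v"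
    unfolding gderiv_def by (auto intro!: derivative_eq_intros simp: inner_commute)
  ultimately have "GDERIV (smoothing (\<lambda>y. v \<bullet> y) 1) 0 :> v" by presburger
  then have "v = gradient (smoothing (\<lambda>y. v \<bullet> y) 1) 0" by (rule gradient_eq[symmetric])
  also have "\<dots> = real DIM('a) *\<^sub>R (LINT w|unif_sphere. (v \<bullet> w) *\<^sub>R w)"
    using gradient_smoothing(1)[OF c, of 1 0] by simp
  finally have "v \<bullet> v = (real DIM('a) *\<^sub>R (LINT w|unif_sphere. (v \<bullet> w) *\<^sub>R w)) \<bullet> v"
    by (rule arg_cong[where f="\<lambda>z. z \<bullet> v"])
  then have "v \<bullet> v = real DIM('a) * ((LINT w|unif_sphere. (v \<bullet> w) *\<^sub>R w) \<bullet> v)"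
    by (simp only: inner_scaleR_left)
  also have "(LINT w|unif_sphere. (v \<bullet> w) *\<^sub>R w) \<bullet> v = (LINT w|unif_sphere. ((v \<bullet> w) *\<^sub>R w) \<bullet> v)"
  proof (rule integral_inner_left[symmetric])
    show "integrable unif_sphere (\<lambda>w. (v \<bullet> w) *\<^sub>R w)"
    proof (rule unif_sphere_integrable[where K="norm v"])
      fix w :: 'a assume w: "norm w \<le> 1"
      have "\<bar>v \<bullet> w\<bar> * norm w \<le> (norm v * norm w) * norm w"
        by (intro mult_right_mono Cauchy_Schwarz_ineq2) auto
      also have "\<dots> \<le> (norm v * 1) * 1" using w by (intro mult_mono) auto
      finally show "norm ((v \<bullet> w) *\<^sub>R w) \<le> norm v" by simp
    qed measurable
  qed
  also have "(LINT w|unif_sphere. ((v \<bullet> w) *\<^sub>R w) \<bullet> v) = (LINT w|unif_sphere. (v \<bullet> w)\<^sup>2)"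
    by (simp add: power2_eq_square inner_commute)
  finally have "(norm v)\<^sup>2 = real DIM('a) * (LINT w|unif_sphere. (v \<bullet> w)\<^sup>2)"
    by (simp add: power2_norm_eq_inner)
  then show ?thesis by simp
qed

lemma unif_ball_second_moment_le:
  fixes v :: "'a::euclidean_space"
  shows "(LINT w|unif_ball. (v \<bullet> w)\<^sup>2) \<le> (norm v)\<^sup>2 / real DIM('a)"
proof -
  have le: "\<bar>v \<bullet> w\<bar> \<le> norm v" if "norm w \<le> 1" for w :: 'a
    using Cauchy_Schwarz_ineq2[of v w] mult_left_mono[OF that, of "norm v"] by simp
  have le2: "(v \<bullet> w)\<^sup>2 \<le> (norm v)\<^sup>2" if "norm w \<le> 1" for w :: 'a
    using le[OF that] by (simp add: abs_le_square_iff[symmetric])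
  have "(LINT w|unif_ball. (v \<bullet> w)\<^sup>2) \<le> (LINT w|unif_ball. (v \<bullet> sgn w)\<^sup>2)"
  proof (rule integral_mono_AE)
    show "integrable unif_ball (\<lambda>w. (v \<bullet> w)\<^sup>2)"
      by (rule unif_ball_integrable[where K="(norm v)\<^sup>2"]) (use le2 in auto)
    show "integrable unif_ball (\<lambda>w. (v \<bullet> sgn w)\<^sup>2)"
      by (rule unif_ball_integrable[where K="(norm v)\<^sup>2"]) (use le2 in \<open>auto simp: norm_sgn\<close>)
    show "AE w in unif_ball. (v \<bullet> w)\<^sup>2 \<le> (v \<bullet> sgn w)\<^sup>2" using AE_unif_ball
    proof eventually_elim
      case (elim w)
      have "\<bar>v \<bullet> w\<bar> = norm w * \<bar>v \<bullet> sgn w\<bar>" by (cases "w = 0") (auto simp: sgn_div_norm abs_mult)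
      also have "\<dots> \<le> 1 * \<bar>v \<bullet> sgn w\<bar>" using elim by (intro mult_right_mono) auto
      finally show ?case by (simp add: abs_le_square_iff)
    qed
  qed
  also have "\<dots> = (LINT w|unif_sphere. (v \<bullet> w)\<^sup>2)" by (rule unif_sphere_integral[symmetric]) measurable
  finally show ?thesis by (simp add: unif_sphere_second_moment)
qed

lemma descent_lemma:
  fixes S :: "'a::euclidean_space \<Rightarrow> real"
  assumes D: "\<And>z. GDERIV S z :> G z"
    and lip: "\<And>s. 0 \<le> s \<Longrightarrow> s \<le> 1 \<Longrightarrow> norm (G (x + s *\<^sub>R h) - G x) \<le> l * (s * norm h)"
  shows "S (x + h) \<le> S x + G x \<bullet> h + l / 2 * (norm h)\<^sup>2"
proof -
  define \<phi> where "\<phi> s = S (x + s *\<^sub>R h) - s * (G x \<bullet> h) - l / 2 * s\<^sup>2 * (norm h)\<^sup>2" for s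
  have "\<phi> 1 \<le> \<phi> 0"
  proof (rule DERIV_nonpos_imp_nonincreasing[of 0 1 \<phi>])
    fix s :: real assume s: "0 \<le> s" "s \<le> 1"
    have "((\<lambda>t. S (x + t *\<^sub>R h)) has_real_derivative G (x + s *\<^sub>R h) \<bullet> h) (at s)"
      by (rule GDERIV_along_line[OF D])
    then have "(\<phi> has_real_derivative G (x + s *\<^sub>R h) \<bullet> h - G x \<bullet> h - l * s * (norm h)\<^sup>2) (at s)"
      unfolding \<phi>_def by (auto intro!: derivative_eq_intros)
    moreover have "G (x + s *\<^sub>R h) \<bullet> h - G x \<bullet> h - l * s * (norm h)\<^sup>2 \<le> 0"
    proof -
      have "G (x + s *\<^sub>R h) \<bullet> h - G x \<bullet> h \<le> norm (G (x + s *\<^sub>R h) - G x) * norm h"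
        unfolding inner_diff_left[symmetric] by (rule norm_cauchy_schwarz)
      also have "\<dots> \<le> l * (s * norm h) * norm h" using lip[OF s] by (rule mult_right_mono) simp
      finally show ?thesis by (simp add: power2_eq_square mult_ac)
    qed
    ultimately show "\<exists>y. (\<phi> has_real_derivative y) (at s) \<and> y \<le> 0" by blast
  qed simp
  then show ?thesis by (simp add: \<phi>_def)
qed


lemma rsgf_ell_mono:
  assumes "growth_condition f \<alpha> \<beta>" "c \<ge> 0" "0 < \<delta>" "0 \<le> r" "r \<le> r'"
  shows "rsgf_ell c d \<alpha> \<beta> \<delta> x r \<le> rsgf_ell c d \<alpha> \<beta> \<delta> x r'"
  unfolding rsgf_ell_def
  using growth_conditionD(5)[OF assms(1), of "r + \<delta>" "r' + \<delta>" x] assms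
  by (intro divide_right_mono mult_left_mono) auto

lemma smoothing_descent:
  fixes f :: "'a::euclidean_space \<Rightarrow> real"
  assumes lip: "locally_lipschitz f" and growth: "growth_condition f \<alpha> \<beta>" and "\<delta> > 0" "c \<ge> 0"
    and smooth: "\<And>x y. norm (gradient (smoothing f \<delta>) x - gradient (smoothing f \<delta>) y)
      \<le> rsgf_ell c DIM('a) \<alpha> \<beta> \<delta> x (norm (x - y)) * norm (x - y)"
  shows "smoothing f \<delta> (x + h) \<le> smoothing f \<delta> x + gradient (smoothing f \<delta>) x \<bullet> h
    + rsgf_ell c DIM('a) \<alpha> \<beta> \<delta> x (norm h) / 2 * (norm h)\<^sup>2"
proof (rule descent_lemma)
  show "GDERIV (smoothing f \<delta>) z :> gradient (smoothing f \<delta>) z" for z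
    by (rule gradient_smoothing(2)[OF locally_lipschitz_continuous[OF lip] \<open>\<delta> > 0\<close>])
  fix s :: real assume s: "0 \<le> s" "s \<le> 1"
  have "norm (gradient (smoothing f \<delta>) (x + s *\<^sub>R h) - gradient (smoothing f \<delta>) x)
      \<le> rsgf_ell c DIM('a) \<alpha> \<beta> \<delta> x (s * norm h) * (s * norm h)"
    using smooth[of x "x + s *\<^sub>R h"] s by (simp add: norm_minus_commute)
  also have "\<dots> \<le> rsgf_ell c DIM('a) \<alpha> \<beta> \<delta> x (norm h) * (s * norm h)"
    using s by (intro mult_right_mono rsgf_ell_mono[OF growth]) (auto simp: mult_left_le_one_le assms)
  finally show "norm (gradient (smoothing f \<delta>) (x + s *\<^sub>R h) - gradient (smoothing f \<delta>) x)
      \<le> rsgf_ell c DIM('a) \<alpha> \<beta> \<delta> x (norm h) * (s * norm h)" .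
qed

lemma clarke_subdiff_norm_lipschitz:
  fixes f :: "'a::euclidean_space \<Rightarrow> real"
  assumes "\<And>y z. \<bar>f y - f z\<bar> \<le> L * norm (y - z)" "\<zeta> \<in> clarke_subdiff f x"
  shows "norm \<zeta> \<le> L"
proof -
  have "quotient_bound f x \<zeta> (L * norm \<zeta>)"
    by (rule quotient_bound_lipschitz(1)[of 1]) (use assms(1) in auto)
  then have "clarke_dderiv f x \<zeta> \<le> ereal (L * norm \<zeta>)" by (rule clarke_dderiv_le_of_quotient_bound)
  then have "ereal (\<zeta> \<bullet> \<zeta>) \<le> ereal (L * norm \<zeta>)"
    using assms(2) unfolding clarke_subdiff_def by (blast intro: order_trans)
  then have le: "norm \<zeta> * norm \<zeta> \<le> L * norm \<zeta>" by (simp add: power2_norm_eq_inner[symmetric] power2_eq_square)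
  show ?thesis
  proof (cases "\<zeta> = 0")
    case True
    obtain b :: 'a where b: "b \<in> Basis" using nonempty_Basis by blast
    have "0 \<le> L" using order_trans[OF abs_ge_zero assms(1)[of b 0]] b by simp
    then show ?thesis using True by simp
  next
    case False
    then show ?thesis using le by simp
  qed
qed

text \<open>A constant that works for every function is not small: for the distance to a hyperplane the
  second difference of the smoothing at distance \<open>2 / \<surd>d\<close> is at least \<open>2 / \<surd>d\<close>, because
  a coordinate has standard deviation at most \<open>1 / \<surd>d\<close> on the ball.\<close>

lemma smoothness_constant_ge_half:
  fixes c :: real
  assumes c_pos: "c > 0"
    and smooth: "\<And>(g :: 'a::euclidean_space \<Rightarrow> real) a b s x y.
      locally_lipschitz g \<Longrightarrow> growth_condition g a b \<Longrightarrow> s > 0 \<Longrightarrow>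
      norm (gradient (smoothing g s) x - gradient (smoothing g s) y)
        \<le> rsgf_ell c DIM('a) a b s x (norm (x - y)) * norm (x - y)"
  shows "c \<ge> 1 / 2"
proof -
  obtain b :: 'a where b: "b \<in> Basis" using nonempty_Basis by blast
  then have nb: "norm b = 1" by simp
  define g where "g y = \<bar>b \<bullet> y\<bar>" for y :: 'a
  define d where "d = real DIM('a)"
  have d: "d \<ge> 1" using DIM_positive[where 'a='a] by (simp add: d_def)
  have g_lip: "\<bar>g y - g z\<bar> \<le> 1 * norm (y - z)" for y z
  proof -
    have "\<bar>g y - g z\<bar> \<le> \<bar>b \<bullet> (y - z)\<bar>" unfolding g_def inner_diff_right by (rule abs_triangle_ineq3)
    also have "\<dots> \<le> norm b * norm (y - z)" by (rule Cauchy_Schwarz_ineq2)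
    finally show ?thesis using nb by simp
  qed
  have lip: "locally_lipschitz g"
    unfolding locally_lipschitz_def
  proof
    fix x :: 'a
    have "1-lipschitz_on (cball x 1) g" using g_lip by (intro lipschitz_onI) (auto simp: dist_norm)
    then show "\<exists>u>0. \<exists>L. L-lipschitz_on (cball x u) g" by (intro exI[of _ 1]) auto
  qed
  have growth: "growth_condition g (\<lambda>_. 1) (\<lambda>_ _. 0)"
    unfolding growth_condition_def case_prod_unfold
    using clarke_subdiff_norm_lipschitz[of g 1] g_lip by (auto simp: mono_on_def)
  have cont: "continuous_on UNIV g" by (rule locally_lipschitz_continuous[OF lip])
  \<comment> \<open>The step that makes the resulting lower bound for \<open>c\<close> as large as possible.\<close>
  define t where "t = 2 / sqrt d"
  have t: "t > 0" using d by (simp add: t_def)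
  define S where "S = smoothing g 1"
  have desc: "S (0 + h) \<le> S 0 + gradient S 0 \<bullet> h + c * sqrt d / 2 * (norm h)\<^sup>2" for h
    using smoothing_descent[OF lip growth _ _ smooth[OF lip growth], of 1 0 h] c_pos
    by (simp add: S_def rsgf_ell_def d_def)
  have int: "integrable unif_ball (\<lambda>w. g (x + w))" for x
    using smoothing_integrable[OF cont, of 1 x] by simp
  interpret prob_space "unif_ball :: 'a measure" by (rule prob_space_unif_ball)
  have "2 * t \<le> S (t *\<^sub>R b) + S (- t *\<^sub>R b)"
  proof -
    have "2 * t \<le> (LINT w|unif_ball. g (t *\<^sub>R b + w) + g (- t *\<^sub>R b + w))"
    proof (rule integral_ge_const)
      show "integrable unif_ball (\<lambda>w. g (t *\<^sub>R b + w) + g (- t *\<^sub>R b + w))" by (intro Bochner_Integration.integrable_add int)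
      show "AE w in unif_ball. 2 * t \<le> g (t *\<^sub>R b + w) + g (- t *\<^sub>R b + w)"
      proof (rule AE_I2)
        fix w :: 'a
        have "b \<bullet> (t *\<^sub>R b + w) = t + b \<bullet> w" "b \<bullet> (- t *\<^sub>R b + w) = - t + b \<bullet> w"
          unfolding inner_add_right inner_scaleR_right using b by simp_all
        then show "2 * t \<le> g (t *\<^sub>R b + w) + g (- t *\<^sub>R b + w)" unfolding g_def by linarith
      qed
    qed
    also have "\<dots> = S (t *\<^sub>R b) + S (- t *\<^sub>R b)"
      unfolding S_def smoothing_def scaleR_one by (rule Bochner_Integration.integral_add[OF int int])
    finally show ?thesis .
  qed
  also have "\<dots> \<le> 2 * S 0 + c * sqrt d * t\<^sup>2"
    using desc[of "t *\<^sub>R b"] desc[of "- t *\<^sub>R b"] nb by (simp add: power_mult_distrib)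
  also have "S 0 \<le> 1 / sqrt d"
  proof -
    have sq: "integrable unif_ball (\<lambda>w::'a. (b \<bullet> w)\<^sup>2)"
    proof (rule unif_ball_integrable[where K=1])
      fix w :: 'a assume "norm w \<le> 1"
      then have "\<bar>b \<bullet> w\<bar> \<le> 1" using Cauchy_Schwarz_ineq2[of b w] nb by simp
      then show "norm ((b \<bullet> w)\<^sup>2) \<le> 1" by (simp add: abs_square_le_1)
    qed measurable
    have "S 0 = (LINT w|unif_ball. g (0 + w))" by (simp add: S_def smoothing_def)
    also have "\<dots> \<le> (LINT w|unif_ball. sqrt d / 2 * (b \<bullet> w)\<^sup>2 + 1 / (2 * sqrt d))"
    proof (rule integral_mono)
      show "integrable unif_ball (\<lambda>w. sqrt d / 2 * (b \<bullet> w)\<^sup>2 + 1 / (2 * sqrt d))" using sq by simp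
      fix w :: 'a
      have "0 \<le> (sqrt d * \<bar>b \<bullet> w\<bar> - 1)\<^sup>2 / (2 * sqrt d)" using d by simp
      also have "\<dots> = sqrt d / 2 * (b \<bullet> w)\<^sup>2 + 1 / (2 * sqrt d) - \<bar>b \<bullet> w\<bar>"
        using d by (simp add: power2_diff power_mult_distrib field_simps power2_eq_square)
      finally show "g (0 + w) \<le> sqrt d / 2 * (b \<bullet> w)\<^sup>2 + 1 / (2 * sqrt d)" by (simp add: g_def)
    qed (fact int)
    also have "\<dots> = sqrt d / 2 * (LINT w|unif_ball. (b \<bullet> w)\<^sup>2) + 1 / (2 * sqrt d)"
      using sq by (simp add: prob_space[simplified])
    also have "\<dots> \<le> sqrt d / 2 * (1 / d) + 1 / (2 * sqrt d)"
      using unif_ball_second_moment_le[of b] nb d by (intro add_right_mono mult_left_mono) (auto simp: d_def)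
    also have "\<dots> = 1 / sqrt d" using d by (simp add: field_simps)
    finally show ?thesis .
  qed
  finally have "2 * t \<le> 2 * (1 / sqrt d) + c * sqrt d * t\<^sup>2" by simp
  then have "2 / sqrt d \<le> 4 * c / sqrt d" using d by (simp add: t_def power_divide field_simps)
  then show ?thesis using d by (simp add: divide_le_cancel)
qed

section \<open>The gradient estimator\<close>

text \<open>The left-hand side is convex in each of \<open>a\<close> and \<open>b\<close>, hence largest at a corner of the square.\<close>

lemma half_sum_norm_bound:
  fixes a b \<kappa> :: real
  assumes "0 \<le> a" "a \<le> 1" "0 \<le> b" "b \<le> 1"
  shows "a\<^sup>2 + b\<^sup>2 + 2 * a * b * \<kappa> \<le> max (2 + 2 * \<kappa>) 1"
proof -
  have "a * a \<le> a" "b * b \<le> b" using assms by (auto simp: mult_left_le)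
  then have 1: "a\<^sup>2 + b\<^sup>2 + 2 * a * b * \<kappa> \<le> a + b + 2 * a * b * \<kappa>" by (simp add: power2_eq_square)
  show ?thesis
  proof (cases "1 + 2 * \<kappa> \<ge> 0")
    case True
    have "0 \<le> (1 - a) * (2 + 2 * \<kappa> - b) + a * ((1 - b) * (1 + 2 * \<kappa>))"
    proof -
      have "0 \<le> 1 - a" "0 \<le> 2 + 2 * \<kappa> - b" "0 \<le> 1 - b" using assms True by auto
      then show ?thesis using assms(1) True by (simp only: add_nonneg_nonneg mult_nonneg_nonneg)
    qed
    also have "\<dots> = 2 + 2 * \<kappa> - (a + b + 2 * a * b * \<kappa>)" by (simp add: algebra_simps)
    finally show ?thesis using 1 by simp
  next
    case False
    have "0 \<le> (1 - a) * (1 - b) + a * (b * (- 1 - 2 * \<kappa>))"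
    proof -
      have "0 \<le> 1 - a" "0 \<le> - 1 - 2 * \<kappa>" "0 \<le> 1 - b" using assms False by auto
      then show ?thesis using assms(1,3) by (simp only: add_nonneg_nonneg mult_nonneg_nonneg)
    qed
    also have "\<dots> = 1 - (a + b + 2 * a * b * \<kappa>)" by (simp add: algebra_simps)
    finally show ?thesis using 1 by simp
  qed
qed

text \<open>If both vectors are long, the angle between them makes the midpoint short; if one of them is
  short, the midpoint has norm about \<open>1/2\<close>, which is small enough because \<open>s\<close> cannot exceed 1.\<close>

lemma midpoint_norm_bound:
  fixes a b :: "'a::euclidean_space"
  assumes ab: "norm a \<le> 1" "norm b \<le> 1" "a \<noteq> 0" "b \<noteq> 0" and s: "0 \<le> s" "2 * s < norm (sgn a - sgn b)"
  shows "norm ((1 / 2) *\<^sub>R (a + b)) \<le> exp (- s\<^sup>2 / 2)"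
proof (rule power2_le_imp_le)
  define \<kappa> where "\<kappa> = sgn a \<bullet> sgn b"
  have "(2 * s)\<^sup>2 < (norm (sgn a - sgn b))\<^sup>2" using s by (intro power_strict_mono) auto
  also have "\<dots> = 2 - 2 * \<kappa>"
  proof -
    have "sgn a \<bullet> sgn a = 1" "sgn b \<bullet> sgn b = 1" using ab by (simp_all add: norm_sgn flip: norm_eq_1)
    then show ?thesis
      unfolding power2_norm_eq_inner inner_diff_left inner_diff_right \<kappa>_def by (simp add: inner_commute)
  qed
  finally have \<kappa>: "(1 + \<kappa>) / 2 \<le> 1 - s\<^sup>2" by (simp add: power2_eq_square)
  have "norm (sgn a - sgn b) \<le> 2" using norm_triangle_ineq4[of "sgn a" "sgn b"] ab by (simp add: norm_sgn)
  then have "s \<le> 1" using s by simp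
  then have "s\<^sup>2 \<le> 1" using s by (simp add: power_le_one)
  have "a = norm a *\<^sub>R sgn a" "b = norm b *\<^sub>R sgn b" using ab by (simp_all add: sgn_div_norm)
  then have "a \<bullet> b = norm a * norm b * \<kappa>" unfolding \<kappa>_def by (metis inner_scaleR_left inner_scaleR_right mult.assoc)
  then have "(norm ((1 / 2) *\<^sub>R (a + b)))\<^sup>2 = ((norm a)\<^sup>2 + (norm b)\<^sup>2 + 2 * norm a * norm b * \<kappa>) / 4"
    by (simp add: power2_norm_eq_inner power_mult_distrib power_divide inner_add_left inner_add_right inner_commute)
  also have "\<dots> \<le> max (2 + 2 * \<kappa>) 1 / 4" using half_sum_norm_bound[of "norm a" "norm b" \<kappa>] ab by simp
  also have "\<dots> \<le> exp (- s\<^sup>2)"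
  proof -
    have "(2 + 2 * \<kappa>) / 4 \<le> exp (- s\<^sup>2)" using \<kappa> exp_ge_add_one_self[of "- s\<^sup>2"] by simp
    moreover have "1 / 4 \<le> exp (- s\<^sup>2)"
    proof -
      have "1 / 4 \<le> 1 / exp (1::real)" using exp_le by (simp add: field_simps)
      also have "\<dots> = exp (- 1)" by (simp add: exp_minus inverse_eq_divide)
      also have "\<dots> \<le> exp (- s\<^sup>2)" using \<open>s\<^sup>2 \<le> 1\<close> by simp
      finally show ?thesis .
    qed
    ultimately show ?thesis by (simp add: max_def)
  qed
  also have "\<dots> = (exp (- s\<^sup>2 / 2))\<^sup>2" by (simp add: power2_eq_square flip: exp_add)
  finally show "(norm ((1 / 2) *\<^sub>R (a + b)))\<^sup>2 \<le> (exp (- s\<^sup>2 / 2))\<^sup>2" .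
qed simp

text \<open>Concentration on the sphere.  The difference is an odd function of the direction, so the cones
  over the sets where it is large and where it is very negative are mirror images.  They are so
  far apart that their midpoints lie in a small ball, and the Brunn-Minkowski inequality bounds
  the product of their volumes.\<close>

lemma ennreal_square_le_imp_le:
  assumes "0 \<le> a" "0 \<le> c" "ennreal a * ennreal a \<le> (ennreal c)\<^sup>2"
  shows "a \<le> c"
proof -
  have "ennreal (a * a) \<le> ennreal (c * c)" using assms by (simp add: power2_eq_square ennreal_mult)
  then have "a * a \<le> c * c" using assms by (simp add: ennreal_le_iff)
  then show ?thesis using assms by (intro power2_le_imp_le[of a c]) (simp_all add: power2_eq_square)
qed

lemma unif_sphere_concentration:
  fixes f :: "'a::euclidean_space \<Rightarrow> real"
  assumes f: "continuous_on UNIV f" and \<delta>: "\<delta> > 0" and M: "M \<ge> 0" and s: "s \<ge> 0"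
    and lip: "\<And>y z. y \<in> cball x \<delta> \<Longrightarrow> z \<in> cball x \<delta> \<Longrightarrow> \<bar>f y - f z\<bar> \<le> M * norm (y - z)"
  shows "measure unif_sphere {w. \<bar>f (x + \<delta> *\<^sub>R w) - f (x - \<delta> *\<^sub>R w)\<bar> > 2 * \<delta> * M * s}
    \<le> 2 * exp (- real DIM('a) * s\<^sup>2 / 2)"
proof -
  have [measurable]: "f \<in> borel_measurable borel" using f by (rule borel_measurable_continuous_onI)
  define F where "F w = f (x + \<delta> *\<^sub>R w) - f (x - \<delta> *\<^sub>R w)" for w
  have [measurable]: "F \<in> borel_measurable borel" unfolding F_def by measurable
  define k where "k = 2 * \<delta> * M * s"
  have k: "k \<ge> 0" using \<delta> M s by (simp add: k_def)
  define A where "A = {w \<in> cball 0 1. F (sgn w) > k}"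
  define B where "B = {w \<in> cball 0 1. F (sgn w) < - k}"
  define V where "V = measure lborel (cball (0::'a) 1)"
  define R where "R = exp (- s\<^sup>2 / 2)"
  have V: "V > 0" unfolding V_def by (rule content_cball_pos) simp
  have [measurable]: "A \<in> sets borel" "B \<in> sets borel" unfolding A_def B_def by measurable
  have F0: "F 0 = 0" by (simp add: F_def)
  have em_le: "emeasure lborel C = ennreal (measure lborel C)" if "C \<subseteq> cball 0 1" "C \<in> sets borel" for C :: "'a set"
  proof -
    have "emeasure lborel C \<le> emeasure lborel (cball (0::'a) 1)" using that by (intro emeasure_mono) auto
    then have "emeasure lborel C \<noteq> top"
      using emeasure_lborel_cball_finite[of "0::'a" 1] by (auto simp: top_unique)
    then show ?thesis by (simp add: emeasure_eq_ennreal_measure)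
  qed
  have AB: "measure lborel A = measure lborel B"
  proof -
    have "measure lborel A = (LINT w|lborel. indicator A w)" by simp
    also have "\<dots> = \<bar>- 1\<bar> ^ DIM('a) *\<^sub>R (LINT w|lborel. indicator A ((- 1) *\<^sub>R w))"
      by (rule lborel_integral_scale) auto
    also have "(\<lambda>w. indicator A ((- 1) *\<^sub>R w) :: real) = indicator B"
      by (auto simp: fun_eq_iff indicator_def A_def B_def F_def sgn_minus)
    finally show ?thesis by simp
  qed
  have "emeasure lborel A * emeasure lborel B \<le> (emeasure lborel (cball (0::'a) R))\<^sup>2"
  proof (rule brunn_minkowski_multiplicative)
    fix a b assume a: "a \<in> A" and b: "b \<in> B"
    have "a \<noteq> 0" "b \<noteq> 0" using a b k F0 by (auto simp: A_def B_def)
    have "F (sgn a) - F (sgn b) \<le> 2 * M * \<delta> * norm (sgn a - sgn b)"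
    proof -
      have in_ball: "x + \<delta> *\<^sub>R sgn c \<in> cball x \<delta>" "x - \<delta> *\<^sub>R sgn c \<in> cball x \<delta>" for c
        using \<delta> by (auto simp: dist_norm norm_sgn)
      have "norm ((x + \<delta> *\<^sub>R sgn a) - (x + \<delta> *\<^sub>R sgn b)) = \<delta> * norm (sgn a - sgn b)"
        using \<delta> by (simp flip: scaleR_diff_right)
      moreover have "norm ((x - \<delta> *\<^sub>R sgn b) - (x - \<delta> *\<^sub>R sgn a)) = \<delta> * norm (sgn a - sgn b)"
        using \<delta> by (simp flip: scaleR_diff_right)
      ultimately show ?thesis
        using lip[OF in_ball(1)[of a] in_ball(1)[of b]] lip[OF in_ball(2)[of b] in_ball(2)[of a]]
        unfolding F_def by (simp add: mult_ac)
    qed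
    moreover have "2 * k < F (sgn a) - F (sgn b)" using a b by (simp add: A_def B_def)
    ultimately have "2 * k < 2 * M * \<delta> * norm (sgn a - sgn b)" by (rule less_le_trans[rotated])
    then have "2 * \<delta> * M * (2 * s) < 2 * \<delta> * M * norm (sgn a - sgn b)" by (simp only: k_def mult_ac)
    then have "2 * s < norm (sgn a - sgn b)"
      by (rule mult_left_less_imp_less) (use \<delta> M in simp)
    then show "(1 / 2) *\<^sub>R (a + b) \<in> cball 0 R"
      using midpoint_norm_bound[of a b s] a b \<open>a \<noteq> 0\<close> \<open>b \<noteq> 0\<close> s by (simp add: A_def B_def R_def)
  qed auto
  moreover have R: "R \<le> 1" "R > 0" by (auto simp: R_def)
  have "A \<subseteq> cball 0 1" "B \<subseteq> cball 0 1" by (auto simp: A_def B_def)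
  then have emA: "emeasure lborel A = ennreal (measure lborel A)" and emB: "emeasure lborel B = ennreal (measure lborel B)"
    using em_le by simp_all
  have emR: "emeasure lborel (cball (0::'a) R) = ennreal (measure lborel (cball (0::'a) R))"
    using R by (intro em_le) auto
  ultimately have "ennreal (measure lborel A) * ennreal (measure lborel A) \<le> (ennreal (measure lborel (cball (0::'a) R)))\<^sup>2"
    by (simp only: emA emB emR AB)
  then have "measure lborel A \<le> measure lborel (cball (0::'a) R)"
    by (rule ennreal_square_le_imp_le[OF measure_nonneg measure_nonneg])
  also have "\<dots> = R ^ DIM('a) * V"
    unfolding V_def using \<open>R > 0\<close> by (simp add: content_cball)
  finally have mA: "measure lborel A \<le> R ^ DIM('a) * V" .
  have "measure unif_sphere {w. \<bar>F w\<bar> > k} = measure unif_ball (sgn -` {w. \<bar>F w\<bar> > k} \<inter> space unif_ball)"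
    unfolding unif_sphere_def by (rule measure_distr) auto
  also have "\<dots> = measure lborel (cball 0 1 \<inter> sgn -` {w. \<bar>F w\<bar> > k}) / V"
  proof -
    have "sgn -` {w. \<bar>F w\<bar> > k} \<in> sets borel" using measurable_sets[OF sgn_borel_measurable, of "{w. \<bar>F w\<bar> > k}"] by simp
    moreover have "emeasure lborel (cball (0::'a) 1) = ennreal V" unfolding V_def by (rule em_le) auto
    ultimately show ?thesis unfolding V_def[symmetric] unif_ball_def using V
      by (subst measure_uniform_measure) (auto simp: V_def)
  qed
  also have "cball 0 1 \<inter> sgn -` {w. \<bar>F w\<bar> > k} = A \<union> B" using k by (auto simp: A_def B_def)
  also have "measure lborel (A \<union> B) \<le> measure lborel A + measure lborel B"
    by (rule measure_subadditive) (simp_all add: emA emB)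
  also have "\<dots> \<le> 2 * (R ^ DIM('a) * V)" using mA AB by simp
  finally have "measure unif_sphere {w. \<bar>F w\<bar> > k} \<le> 2 * R ^ DIM('a)"
    using V by (simp add: divide_right_mono)
  also have "R ^ DIM('a) = exp (- real DIM('a) * s\<^sup>2 / 2)"
    by (simp add: R_def exp_of_nat_mult[symmetric])
  finally show ?thesis by (simp add: F_def k_def)
qed

lemma norm_grad_est_le:
  fixes f :: "'a::euclidean_space \<Rightarrow> real"
  assumes \<delta>: "\<delta> > 0" and w: "norm w \<le> 1"
    and F: "\<bar>f (x + \<delta> *\<^sub>R w) - f (x - \<delta> *\<^sub>R w)\<bar> \<le> 2 * \<delta> * M * s"
  shows "norm (grad_est f \<delta> x w) \<le> real DIM('a) * M * s"
    and "\<bar>v \<bullet> grad_est f \<delta> x w\<bar> \<le> real DIM('a) * M * s * \<bar>v \<bullet> w\<bar>"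
proof -
  have le: "\<bar>real DIM('a) * (f (x + \<delta> *\<^sub>R w) - f (x - \<delta> *\<^sub>R w)) / (2 * \<delta>)\<bar> \<le> real DIM('a) * M * s"
  proof -
    have "\<bar>real DIM('a) * (f (x + \<delta> *\<^sub>R w) - f (x - \<delta> *\<^sub>R w)) / (2 * \<delta>)\<bar> = real DIM('a) * \<bar>f (x + \<delta> *\<^sub>R w) - f (x - \<delta> *\<^sub>R w)\<bar> / (2 * \<delta>)"
      using \<delta> by (simp add: abs_mult abs_divide)
    also have "\<dots> \<le> real DIM('a) * (2 * \<delta> * M * s) / (2 * \<delta>)" using F \<delta> by (intro divide_right_mono mult_left_mono) auto
    also have "\<dots> = real DIM('a) * M * s" using \<delta> by simp
    finally show ?thesis .
  qed
  show "\<bar>v \<bullet> grad_est f \<delta> x w\<bar> \<le> real DIM('a) * M * s * \<bar>v \<bullet> w\<bar>"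
    unfolding grad_est_def inner_scaleR_right abs_mult using le by (intro mult_right_mono) auto
  have "norm (grad_est f \<delta> x w) = \<bar>real DIM('a) * (f (x + \<delta> *\<^sub>R w) - f (x - \<delta> *\<^sub>R w)) / (2 * \<delta>)\<bar> * norm w"
    by (simp add: grad_est_def)
  also have "\<dots> \<le> (real DIM('a) * M * s) * 1" using le w order_trans[OF abs_ge_zero le] by (intro mult_mono) auto
  finally show "norm (grad_est f \<delta> x w) \<le> real DIM('a) * M * s" by simp
qed

lemma symmetric_difference_le:
  fixes f :: "'a::euclidean_space \<Rightarrow> real"
  assumes \<delta>: "\<delta> > 0" and M: "M \<ge> 0" and w: "norm w \<le> 1"
    and lip: "\<And>y z. y \<in> cball x \<delta> \<Longrightarrow> z \<in> cball x \<delta> \<Longrightarrow> \<bar>f y - f z\<bar> \<le> M * norm (y - z)"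
  shows "\<bar>f (x + \<delta> *\<^sub>R w) - f (x - \<delta> *\<^sub>R w)\<bar> \<le> 2 * \<delta> * M * 1"
proof -
  have "\<delta> * norm w \<le> \<delta>" using \<delta> w by (simp add: mult_left_le)
  then have "x + \<delta> *\<^sub>R w \<in> cball x \<delta>" "x - \<delta> *\<^sub>R w \<in> cball x \<delta>" using \<delta> by (auto simp: dist_norm)
  from lip[OF this] have "\<bar>f (x + \<delta> *\<^sub>R w) - f (x - \<delta> *\<^sub>R w)\<bar> \<le> M * norm ((x + \<delta> *\<^sub>R w) - (x - \<delta> *\<^sub>R w))" .
  also have "(x + \<delta> *\<^sub>R w) - (x - \<delta> *\<^sub>R w) = (2 * \<delta>) *\<^sub>R w" by (simp add: algebra_simps scaleR_2 flip: scaleR_scaleR)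
  also have "M * norm ((2 * \<delta>) *\<^sub>R w) \<le> M * (2 * \<delta>)" using \<delta> M w by (intro mult_left_mono) (auto simp: mult_left_le)
  finally show ?thesis by (simp add: mult_ac)
qed

text \<open>The difference of the two function values may be replaced by its largest possible value here,
  because the second moments of the direction already supply a factor \<open>1 / DIM('a)\<close>.\<close>

lemma grad_est_second_moment:
  fixes f :: "'a::euclidean_space \<Rightarrow> real"
  assumes f: "continuous_on UNIV f" and \<delta>: "\<delta> > 0" and M: "M \<ge> 0"
    and lip: "\<And>y z. y \<in> cball x \<delta> \<Longrightarrow> z \<in> cball x \<delta> \<Longrightarrow> \<bar>f y - f z\<bar> \<le> M * norm (y - z)"
  shows "(LINT w|unif_sphere. (v \<bullet> grad_est f \<delta> x w)\<^sup>2) \<le> real DIM('a) * M\<^sup>2 * (norm v)\<^sup>2"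
proof -
  have [measurable]: "f \<in> borel_measurable borel" using f by (rule borel_measurable_continuous_onI)
  have [measurable]: "grad_est f \<delta> x \<in> borel_measurable borel" unfolding grad_est_def[abs_def] by measurable
  have le: "(v \<bullet> grad_est f \<delta> x w)\<^sup>2 \<le> (real DIM('a) * M)\<^sup>2 * (v \<bullet> w)\<^sup>2" if "norm w \<le> 1" for w
  proof -
    have "\<bar>v \<bullet> grad_est f \<delta> x w\<bar> \<le> \<bar>real DIM('a) * M * (v \<bullet> w)\<bar>"
    proof -
      have "\<bar>f (x + \<delta> *\<^sub>R w) - f (x - \<delta> *\<^sub>R w)\<bar> \<le> 2 * \<delta> * M * 1"
        by (rule symmetric_difference_le[OF \<delta> M that]) (rule lip)
      from norm_grad_est_le(2)[OF \<delta> that this, of v] show ?thesis using M by (simp add: abs_mult)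
    qed
    then show ?thesis by (simp add: abs_le_square_iff power_mult_distrib)
  qed
  have le1: "(v \<bullet> w)\<^sup>2 \<le> (norm v)\<^sup>2" if "norm w \<le> 1" for w :: 'a
    using Cauchy_Schwarz_ineq2[of v w] mult_left_mono[OF that, of "norm v"] by (simp add: abs_le_square_iff[symmetric])
  have "(LINT w|unif_sphere. (v \<bullet> grad_est f \<delta> x w)\<^sup>2) \<le> (LINT w|unif_sphere. (real DIM('a) * M)\<^sup>2 * (v \<bullet> w)\<^sup>2)"
  proof (rule integral_mono_AE)
    show "integrable unif_sphere (\<lambda>w. (v \<bullet> grad_est f \<delta> x w)\<^sup>2)"
    proof (rule unif_sphere_integrable[where K="(real DIM('a) * M)\<^sup>2 * (norm v)\<^sup>2"])
      show "norm ((v \<bullet> grad_est f \<delta> x w)\<^sup>2) \<le> (real DIM('a) * M)\<^sup>2 * (norm v)\<^sup>2" if "norm w \<le> 1" for w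
        using order_trans[OF le[OF that] mult_left_mono[OF le1[OF that]]] by simp
    qed measurable
    show "integrable unif_sphere (\<lambda>w. (real DIM('a) * M)\<^sup>2 * (v \<bullet> w)\<^sup>2)"
      by (rule integrable_mult_right, rule unif_sphere_integrable[where K="(norm v)\<^sup>2"]) (use le1 in auto)
    show "AE w in unif_sphere. (v \<bullet> grad_est f \<delta> x w)\<^sup>2 \<le> (real DIM('a) * M)\<^sup>2 * (v \<bullet> w)\<^sup>2"
      using AE_unif_sphere by eventually_elim (rule le)
  qed
  also have "\<dots> = (real DIM('a) * M)\<^sup>2 * ((norm v)\<^sup>2 / real DIM('a))" by (simp add: unif_sphere_second_moment)
  also have "\<dots> = real DIM('a) * M\<^sup>2 * (norm v)\<^sup>2" by (simp add: power2_eq_square)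
  finally show ?thesis .
qed

section \<open>Step sizes\<close>

text \<open>Replacing an omitted term by the first one, which is always present, turns the minimum over a set of
  varying size into a formula whose measurability is evident.\<close>

lemma rsgf_C_eq_min:
  fixes \<alpha> :: "'a \<Rightarrow> real" and \<beta> :: "'a \<Rightarrow> real \<Rightarrow> real" and \<delta> \<Delta> c :: real and d T :: nat
  defines "m \<equiv> \<lambda>x. \<alpha> x + \<beta> x (3 * \<delta>)" and "s \<equiv> \<lambda>x. rsgf_sigma d \<alpha> \<beta> \<delta> x * (\<alpha> x + \<beta> x \<delta>)"
  defines "l \<equiv> \<lambda>x. rsgf_ell c d \<alpha> \<beta> \<delta> x (\<Delta> / (real d * (m x + 1) * sqrt (real T)))"
  shows "rsgf_C c d \<alpha> \<beta> \<delta> \<Delta> T x =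
    (let a = \<Delta> / (2 * (real d + 1) * (m x + 1)\<^sup>2)
     in min a (min (if s x = 0 then a else sqrt 6 / 12 * (\<Delta> / s x))
       (if m x = 0 \<or> l x = 0 then a else 1 / (real d * m x) * sqrt (\<Delta> / l x))))"
  unfolding rsgf_C_def Let_def m_def s_def l_def by (auto simp: min_def)

lemma rsgf_C_le:
  fixes \<alpha> :: "'a \<Rightarrow> real" and \<beta> :: "'a \<Rightarrow> real \<Rightarrow> real" and \<delta> \<Delta> c :: real and d T :: nat
  defines "m \<equiv> \<lambda>x. \<alpha> x + \<beta> x (3 * \<delta>)" and "s \<equiv> \<lambda>x. rsgf_sigma d \<alpha> \<beta> \<delta> x * (\<alpha> x + \<beta> x \<delta>)"
  defines "l \<equiv> \<lambda>x. rsgf_ell c d \<alpha> \<beta> \<delta> x (\<Delta> / (real d * (m x + 1) * sqrt (real T)))"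
  shows "rsgf_C c d \<alpha> \<beta> \<delta> \<Delta> T x \<le> \<Delta> / (2 * (real d + 1) * (m x + 1)\<^sup>2)"
    and "s x \<noteq> 0 \<Longrightarrow> rsgf_C c d \<alpha> \<beta> \<delta> \<Delta> T x \<le> sqrt 6 / 12 * (\<Delta> / s x)"
    and "m x \<noteq> 0 \<Longrightarrow> l x \<noteq> 0 \<Longrightarrow> rsgf_C c d \<alpha> \<beta> \<delta> \<Delta> T x \<le> 1 / (real d * m x) * sqrt (\<Delta> / l x)"
  unfolding rsgf_C_eq_min Let_def m_def s_def l_def by (auto simp: min_le_iff_disj)

lemma rsgf_C_ge:
  fixes \<alpha> :: "'a \<Rightarrow> real" and \<beta> :: "'a \<Rightarrow> real \<Rightarrow> real" and \<delta> \<Delta> c :: real and d T :: nat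
  defines "m \<equiv> \<lambda>x. \<alpha> x + \<beta> x (3 * \<delta>)" and "s \<equiv> \<lambda>x. rsgf_sigma d \<alpha> \<beta> \<delta> x * (\<alpha> x + \<beta> x \<delta>)"
  defines "l \<equiv> \<lambda>x. rsgf_ell c d \<alpha> \<beta> \<delta> x (\<Delta> / (real d * (m x + 1) * sqrt (real T)))"
  assumes "K \<le> \<Delta> / (2 * (real d + 1) * (m x + 1)\<^sup>2)" "s x \<noteq> 0 \<Longrightarrow> K \<le> sqrt 6 / 12 * (\<Delta> / s x)"
    "m x \<noteq> 0 \<Longrightarrow> l x \<noteq> 0 \<Longrightarrow> K \<le> 1 / (real d * m x) * sqrt (\<Delta> / l x)"
  shows "K \<le> rsgf_C c d \<alpha> \<beta> \<delta> \<Delta> T x"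
  using assms unfolding rsgf_C_eq_min Let_def m_def s_def l_def by auto

lemma rsgf_sigma_nonneg: "rsgf_sigma d \<alpha> \<beta> \<delta> x \<ge> 0"
  by (simp add: rsgf_sigma_def)

lemma rsgf_sigma_ge:
  assumes "0 \<le> M" "M \<le> \<alpha> x + \<beta> x (2 * \<delta>)"
  shows "40 * real d * M\<^sup>2 \<le> (rsgf_sigma d \<alpha> \<beta> \<delta> x)\<^sup>2"
proof -
  \<comment> \<open>The constant 40 is \<open>16 * 5 / 2\<close>.\<close>
  have "5 / 2 \<le> sqrt (2 * pi)" by (rule real_le_rsqrt) (use pi_gt3 pi_approx in \<open>simp add: power2_eq_square\<close>)
  then have "40 \<le> 16 * sqrt (2 * pi)" by simp
  then have "40 * real d * M\<^sup>2 \<le> 16 * sqrt (2 * pi) * real d * (\<alpha> x + \<beta> x (2 * \<delta>))\<^sup>2"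
    using assms by (intro mult_mono power_mono) auto
  then show ?thesis by (simp add: rsgf_sigma_def)
qed

lemma rsgf_C_pos:
  assumes "\<Delta> > 0" "0 \<le> \<alpha> x" "\<And>r. r \<ge> 0 \<Longrightarrow> 0 \<le> \<beta> x r" "c \<ge> 0" "\<delta> > 0" "d \<ge> 1"
  shows "rsgf_C c d \<alpha> \<beta> \<delta> \<Delta> T x > 0"
proof -
  have b: "0 \<le> \<beta> x \<delta>" "0 \<le> \<beta> x (2 * \<delta>)" "0 \<le> \<beta> x (3 * \<delta>)"
    "0 \<le> \<beta> x (\<Delta> / (real d * (\<alpha> x + \<beta> x (3 * \<delta>) + 1) * sqrt (real T)) + \<delta>)"
  proof -
    show b1: "0 \<le> \<beta> x \<delta>" "0 \<le> \<beta> x (2 * \<delta>)" "0 \<le> \<beta> x (3 * \<delta>)"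
      by (rule assms(3), use assms(5) in simp)+
    have "0 \<le> \<alpha> x + \<beta> x (3 * \<delta>) + 1" using b1(3) assms(2) by simp
    then have "0 \<le> \<Delta> / (real d * (\<alpha> x + \<beta> x (3 * \<delta>) + 1) * sqrt (real T)) + \<delta>"
      using assms(1,5) by simp
    then show "0 \<le> \<beta> x (\<Delta> / (real d * (\<alpha> x + \<beta> x (3 * \<delta>) + 1) * sqrt (real T)) + \<delta>)" by (rule assms(3))
  qed
  have l: "rsgf_ell c d \<alpha> \<beta> \<delta> x (\<Delta> / (real d * (\<alpha> x + \<beta> x (3 * \<delta>) + 1) * sqrt (real T))) \<ge> 0"
    unfolding rsgf_ell_def using b assms(1,2,4-6) by (intro divide_nonneg_nonneg mult_nonneg_nonneg) auto
  have m: "0 \<le> \<alpha> x + \<beta> x (3 * \<delta>)" using b assms(1,2,4-6) by simp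
  have 1: "0 < \<Delta> / (2 * (real d + 1) * (\<alpha> x + \<beta> x (3 * \<delta>) + 1)\<^sup>2)"
    using m assms(1,2,4-6) by (intro divide_pos_pos mult_pos_pos zero_less_power) auto
  have 2: "0 < sqrt 6 / 12 * (\<Delta> / (rsgf_sigma d \<alpha> \<beta> \<delta> x * (\<alpha> x + \<beta> x \<delta>)))"
    if "rsgf_sigma d \<alpha> \<beta> \<delta> x * (\<alpha> x + \<beta> x \<delta>) \<noteq> 0"
  proof -
    have "0 \<le> rsgf_sigma d \<alpha> \<beta> \<delta> x * (\<alpha> x + \<beta> x \<delta>)"
      using b assms(1,2,4-6) by (intro mult_nonneg_nonneg rsgf_sigma_nonneg) auto
    then have "0 < rsgf_sigma d \<alpha> \<beta> \<delta> x * (\<alpha> x + \<beta> x \<delta>)" using that by (simp only: less_le not_False_eq_True) auto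
    then have "0 < \<Delta> / (rsgf_sigma d \<alpha> \<beta> \<delta> x * (\<alpha> x + \<beta> x \<delta>))" by (rule divide_pos_pos[OF assms(1)])
    moreover have "0 < sqrt 6 / (12 :: real)" by simp
    ultimately show ?thesis by (rule mult_pos_pos[rotated])
  qed
  have 3: "0 < 1 / (real d * (\<alpha> x + \<beta> x (3 * \<delta>))) * sqrt (\<Delta> / rsgf_ell c d \<alpha> \<beta> \<delta> x (\<Delta> / (real d * (\<alpha> x + \<beta> x (3 * \<delta>) + 1) * sqrt (real T))))"
    if "\<alpha> x + \<beta> x (3 * \<delta>) \<noteq> 0"
      "rsgf_ell c d \<alpha> \<beta> \<delta> x (\<Delta> / (real d * (\<alpha> x + \<beta> x (3 * \<delta>) + 1) * sqrt (real T))) \<noteq> 0"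
  proof -
    have "0 < \<alpha> x + \<beta> x (3 * \<delta>)"
      "0 < rsgf_ell c d \<alpha> \<beta> \<delta> x (\<Delta> / (real d * (\<alpha> x + \<beta> x (3 * \<delta>) + 1) * sqrt (real T)))"
      using that m l by (simp_all only: less_le not_False_eq_True) auto
    then show ?thesis using assms(1,2,4-6) by (intro mult_pos_pos divide_pos_pos) auto
  qed
  show ?thesis
    unfolding rsgf_C_eq_min Let_def using 1 2 3 by (simp only: min_less_iff_conj if_split) blast
qed

text \<open>A step longer than both the radius for which the smoothness modulus enters the step size and
  the length \<open>2\<delta>\<close> up to which \<open>\<beta> x (3 * \<delta>)\<close> controls it would need a directional difference that is
  \<open>\<surd>2 L\<close> standard deviations large.  This uses that \<open>c\<close> is at least \<open>1/2\<close> and that there are at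
  least two iterations.\<close>

lemma step_length_dichotomy:
  fixes d M m L \<tau> \<Delta> \<delta> c C l s r :: real
  assumes d: "d \<ge> 1" and M: "0 < M" "M \<le> m" and L: "L > 0" and \<tau>: "\<tau> \<ge> sqrt 2" and \<Delta>: "\<Delta> > 0" and \<delta>: "\<delta> > 0"
    and c: "c \<ge> 1 / 2" and C1: "C \<le> \<Delta> / (2 * (d + 1) * (m + 1)\<^sup>2)" and C3: "C \<le> 1 / (d * m) * sqrt (\<Delta> / l)"
    and l: "c * sqrt d * M / \<delta> \<le> l" and s: "0 \<le> s" "s * sqrt d \<le> sqrt 2 * L"
    and r: "r \<le> C / (L * \<tau>) * (d * M * s)"
  shows "r \<le> \<Delta> / (d * (m + 1) * \<tau>) \<or> r \<le> 2 * \<delta>"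
proof (rule ccontr)
  assume "\<not> ?thesis"
  then have r1: "\<Delta> / (d * (m + 1) * \<tau>) < r" and r2: "2 * \<delta> < r" by auto
  have \<tau>0: "\<tau> > 0" using \<tau> by (rule less_le_trans[rotated]) simp
  have m0: "m > 0" using M by simp
  have r0: "r > 0" using r2 \<delta> by simp
  define D where "D = sqrt d"
  have D: "D > 0" "D * D = d" using d by (auto simp: D_def)
  have l0: "l > 0" using l c M \<delta> d by (intro less_le_trans[OF _ l]) auto
  define q where "q = d * M * s"
  have q: "q \<ge> 0" using d M s by (simp add: q_def)
  \<comment> \<open>The first term in the step size and \<open>r1\<close> show that \<open>s\<close> is large.\<close>
  have one: "2 * (m + 1) * L < d * M * s"
  proof -
    define X where "X = \<Delta> / ((m + 1) * \<tau>)"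
    have X: "X > 0" using \<Delta> m0 \<tau>0 by (simp add: X_def)
    have "X * (1 / d) = \<Delta> / (d * (m + 1) * \<tau>)" by (simp add: X_def)
    also have "\<dots> < r" by (rule r1)
    also have "r \<le> C / (L * \<tau>) * q" using r by (simp add: q_def)
    also have "\<dots> \<le> (\<Delta> / (2 * (d + 1) * (m + 1)\<^sup>2)) / (L * \<tau>) * q"
      using C1 L \<tau>0 q by (intro mult_right_mono divide_right_mono) auto
    also have "\<dots> = X * (q / (2 * (d + 1) * (m + 1) * L))" by (simp add: X_def power2_eq_square)
    finally have "1 / d < q / (2 * (d + 1) * (m + 1) * L)" using X by (simp only: mult_less_cancel_left_pos)
    then have "2 * (d + 1) * (m + 1) * L < d * q"
      using d m0 L by (simp add: divide_less_eq less_divide_eq mult.commute)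
    moreover have "d * (2 * (m + 1) * L) \<le> 2 * (d + 1) * (m + 1) * L"
      using d m0 L by (simp add: algebra_simps)
    ultimately have "d * (2 * (m + 1) * L) < d * q" by simp
    then show ?thesis using d by (simp add: q_def)
  qed
  then have s0: "s > 0" using s m0 L by (cases "s = 0") (auto simp: mult_less_0_iff)
  \<comment> \<open>The third term bounds \<open>r\<^sup>2\<close> by a multiple of \<open>\<Delta>\<close>, and \<open>r1\<close> bounds \<open>\<Delta>\<close> by a multiple of \<open>r\<close>.\<close>
  have "r \<le> C / (L * \<tau>) * q" using r by (simp add: q_def)
  also have "\<dots> \<le> (1 / (d * m) * sqrt (\<Delta> / l)) / (L * \<tau>) * q"
    using C3 L \<tau>0 q by (intro mult_right_mono divide_right_mono) auto
  also have "\<dots> = M * s / (m * L * \<tau>) * sqrt (\<Delta> / l)" using d by (simp add: q_def mult_ac)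
  finally have "r\<^sup>2 \<le> (M * s / (m * L * \<tau>) * sqrt (\<Delta> / l))\<^sup>2" using r0 by (intro power_mono) auto
  also have "\<dots> = (M * s / (m * L * \<tau>))\<^sup>2 * (sqrt (\<Delta> / l))\<^sup>2" by (rule power_mult_distrib)
  also have "(sqrt (\<Delta> / l))\<^sup>2 = \<Delta> / l" using \<Delta> l0 by simp
  also have "(M * s / (m * L * \<tau>))\<^sup>2 * (\<Delta> / l) \<le> (M * s / (m * L * \<tau>))\<^sup>2 * (\<Delta> / (c * D * M / \<delta>))"
    using \<Delta> l c D M \<delta> l0 by (intro mult_left_mono divide_left_mono) (auto simp: D_def)
  also have "\<dots> = (M * s\<^sup>2 * \<delta> * \<Delta>) / ((m * L * \<tau>)\<^sup>2 * (c * D))"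
    using M \<delta> by (simp add: power2_eq_square mult_ac)
  finally have "r\<^sup>2 * ((m * L * \<tau>)\<^sup>2 * (c * D)) \<le> M * s\<^sup>2 * \<delta> * \<Delta>"
    using m0 L \<tau>0 c D by (simp add: pos_le_divide_eq)
  also have "\<dots> < M * s\<^sup>2 * \<delta> * (r * (d * (m + 1) * \<tau>))"
    using r1 M s0 \<delta> d m0 \<tau>0 by (intro mult_strict_left_mono) (auto simp: pos_divide_less_eq)
  finally have "(r * \<tau>) * (r * (m\<^sup>2 * L\<^sup>2 * \<tau> * c * D)) < (r * \<tau>) * (M * s\<^sup>2 * \<delta> * d * (m + 1))"
    by (simp add: power2_eq_square mult_ac)
  then have "r * (m\<^sup>2 * L\<^sup>2 * \<tau> * c * D) < M * s\<^sup>2 * \<delta> * d * (m + 1)"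
    using r0 \<tau>0 by (simp only: mult_less_cancel_left_pos mult_pos_pos)
  moreover have "2 * \<delta> * (m\<^sup>2 * L\<^sup>2 * \<tau> * c * D) \<le> r * (m\<^sup>2 * L\<^sup>2 * \<tau> * c * D)"
    using r2 m0 L \<tau>0 c D by (intro mult_right_mono) auto
  ultimately have "2 * \<delta> * (m\<^sup>2 * L\<^sup>2 * \<tau> * c * D) < M * s\<^sup>2 * \<delta> * d * (m + 1)" by simp
  then have "(\<delta> * D) * (2 * m\<^sup>2 * L\<^sup>2 * \<tau> * c) < (\<delta> * D) * (M * s\<^sup>2 * D * (m + 1))"
    unfolding D(2)[symmetric] by (simp add: mult_ac)
  then have two: "2 * m\<^sup>2 * L\<^sup>2 * \<tau> * c < M * s\<^sup>2 * D * (m + 1)"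
    using \<delta> D by (simp only: mult_less_cancel_left_pos mult_pos_pos)
  have "(2 * m\<^sup>2 * L\<^sup>2 * \<tau> * c) * (2 * (m + 1) * L) < (M * s\<^sup>2 * D * (m + 1)) * (d * M * s)"
  proof (rule mult_strict_mono[OF two one])
    show "0 < M * s\<^sup>2 * D * (m + 1)" using m0 M s0 D by simp
    show "0 \<le> 2 * (m + 1) * L" using m0 L by simp
  qed
  also have "\<dots> = (m + 1) * (M\<^sup>2 * (s * D) ^ 3)"
    unfolding D(2)[symmetric] by (simp add: power2_eq_square power3_eq_cube mult_ac)
  also have "\<dots> \<le> (m + 1) * (m\<^sup>2 * (sqrt 2 * L) ^ 3)"
  proof (rule mult_left_mono[OF mult_mono])
    show "M\<^sup>2 \<le> m\<^sup>2" using M by (intro power_mono) auto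
    have "0 \<le> s * D" using s0 D by simp
    then show "(s * D) ^ 3 \<le> (sqrt 2 * L) ^ 3" "0 \<le> (s * D) ^ 3" using s(2) unfolding D_def by (auto intro: power_mono)
  qed (use m0 in auto)
  also have "\<dots> = (m + 1) * m\<^sup>2 * L ^ 3 * (2 * sqrt 2)"
    by (simp add: power_mult_distrib power3_eq_cube)
  finally have "((m + 1) * m\<^sup>2 * L ^ 3) * (4 * \<tau> * c) < ((m + 1) * m\<^sup>2 * L ^ 3) * (2 * sqrt 2)"
    by (simp add: power2_eq_square power3_eq_cube mult_ac)
  then have "4 * \<tau> * c < 2 * sqrt 2"
    using m0 L by (simp add: mult_less_cancel_left_pos)
  moreover have "sqrt 2 * (1 / 2) \<le> \<tau> * c" using \<tau> c \<tau>0 by (intro mult_mono) auto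
  ultimately show False by simp
qed

text \<open>Here \<open>l\<close> is the modulus in the step size and \<open>l'\<close> the modulus at the actual step length.  The
  former may be smaller by the factor \<open>2 * M / (M + m)\<close>, which the quotient of the bound \<open>d * M\<close> for the
  estimator and the \<open>d * m\<close> in the step size makes up for.\<close>

lemma step_quadratic_bound:
  fixes d M m L \<tau> \<Delta> C l l' r :: real
  assumes d: "d \<ge> 1" and M: "0 < M" "M \<le> m" and L: "L > 0" and \<tau>: "\<tau> > 0" and \<Delta>: "\<Delta> > 0" and l: "l > 0"
    and C: "0 \<le> C" "C \<le> 1 / (d * m) * sqrt (\<Delta> / l)"
    and r: "0 \<le> r" "r \<le> C / (L * \<tau>) * (d * M)"
    and l': "2 * M * l' \<le> (M + m) * l"
  shows "l' / 2 * r\<^sup>2 \<le> \<Delta> / (2 * L\<^sup>2 * \<tau>\<^sup>2)"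
proof -
  have m0: "m > 0" using M by simp
  have "r \<le> (1 / (d * m) * sqrt (\<Delta> / l)) / (L * \<tau>) * (d * M)"
    using r(2) C L \<tau> d M by (elim order_trans) (intro mult_right_mono divide_right_mono; simp)
  also have "\<dots> = M / (m * L * \<tau>) * sqrt (\<Delta> / l)" using d by (simp add: mult_ac)
  finally have "r\<^sup>2 \<le> (M / (m * L * \<tau>) * sqrt (\<Delta> / l))\<^sup>2" using r by (intro power_mono) auto
  also have "\<dots> = (M / (m * L * \<tau>))\<^sup>2 * (sqrt (\<Delta> / l))\<^sup>2" by (rule power_mult_distrib)
  also have "(sqrt (\<Delta> / l))\<^sup>2 = \<Delta> / l" using \<Delta> l by simp
  also have "(M / (m * L * \<tau>))\<^sup>2 * (\<Delta> / l) = (M / m)\<^sup>2 * (\<Delta> / (l * (L * \<tau>)\<^sup>2))"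
    by (simp add: power_mult_distrib power_divide mult_ac)
  finally have r2: "r\<^sup>2 \<le> (M / m)\<^sup>2 * (\<Delta> / (l * (L * \<tau>)\<^sup>2))" .
  have "l' \<le> (M + m) * l / (2 * M)" using l' M by (simp add: field_simps)
  then have "l' * r\<^sup>2 \<le> ((M + m) * l / (2 * M)) * r\<^sup>2" by (rule mult_right_mono) simp
  also have "\<dots> \<le> ((M + m) * l / (2 * M)) * ((M / m)\<^sup>2 * (\<Delta> / (l * (L * \<tau>)\<^sup>2)))"
    using r2 M m0 l by (intro mult_left_mono) auto
  also have "\<dots> = ((M + m) * M / (2 * m\<^sup>2)) * (\<Delta> / (L * \<tau>)\<^sup>2)"
    using M l by (simp add: power2_eq_square)
  also have "\<dots> \<le> 1 * (\<Delta> / (L * \<tau>)\<^sup>2)"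
  proof (intro mult_right_mono)
    have "(M + m) * M \<le> (m + m) * m" using M by (intro mult_mono) auto
    then show "(M + m) * M / (2 * m\<^sup>2) \<le> 1" using m0 by (simp add: power2_eq_square)
  qed (use \<Delta> in simp)
  finally show ?thesis by (simp add: power_mult_distrib)
qed

lemma exp_le_quadratic:
  fixes x :: real
  assumes "\<bar>x\<bar> \<le> 1"
  shows "exp x \<le> 1 + x + x\<^sup>2"
proof (cases "0 \<le> x")
  case True
  then show ?thesis using assms exp_bound[of x] by simp
next
  case False
  define y where "y = - x"
  have y: "0 \<le> y" "y \<le> 1" using False assms by (auto simp: y_def)
  have pos: "0 < 1 + y + y\<^sup>2 / 2" using y by (simp add: add_pos_nonneg)
  have "1 + 0 \<le> 1 + (y\<^sup>2 / 2 + y ^ 3 / 2 + y ^ 4 / 2)" using y by (intro add_left_mono add_nonneg_nonneg) auto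
  also have "\<dots> = (1 - y + y\<^sup>2) * (1 + y + y\<^sup>2 / 2)"
    by (simp add: field_simps power2_eq_square power3_eq_cube power4_eq_xxxx)
  finally have "1 / (1 + y + y\<^sup>2 / 2) \<le> 1 - y + y\<^sup>2" using pos by (simp add: pos_divide_le_eq)
  moreover have "exp (- y) \<le> 1 / (1 + y + y\<^sup>2 / 2)"
    using exp_lower_Taylor_quadratic[OF y(1)] pos by (simp add: exp_minus inverse_eq_divide frac_le)
  ultimately show ?thesis by (simp add: y_def)
qed

text \<open>The failure probabilities of one iteration, in units of \<open>exp (- L) = p / (2 * T)\<close>.\<close>

lemma failure_budget:
  fixes L :: real
  assumes L: "L \<ge> 4 / 3"
  shows "2 * exp (- L\<^sup>2) + exp (1 / 100 - 7 / 5 * L) \<le> 2 * exp (- L)"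
proof -
  have inv: "exp (- x) \<le> 1 / (1 + y + y\<^sup>2 / 2)" if "0 \<le> y" "y \<le> x" for x y :: real
  proof -
    have "1 + y + y\<^sup>2 / 2 \<le> exp x"
      using exp_lower_Taylor_quadratic[of y] that by (meson exp_le_cancel_iff order_trans)
    moreover have "0 < 1 + y + y\<^sup>2 / 2" using that by (simp add: add_pos_nonneg)
    ultimately show ?thesis by (simp add: exp_minus inverse_eq_divide frac_le)
  qed
  have "4 / 9 \<le> L * (L - 1)" using mult_mono[of "4/3" L "1/3" "L - 1"] L by simp
  then have "exp (- (L * (L - 1))) \<le> 1 / (1 + 4 / 9 + (4 / 9)\<^sup>2 / 2)" by (intro inv) auto
  moreover have "exp (- (2 / 5 * L - 1 / 100)) \<le> 1 / (1 + 52 / 100 + (52 / 100)\<^sup>2 / 2)" using L by (intro inv) auto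
  ultimately have "2 * exp (- (L * (L - 1))) + exp (- (2 / 5 * L - 1 / 100)) \<le> 2"
    by (simp add: power2_eq_square)
  then have "exp (- L) * (2 * exp (- (L * (L - 1))) + exp (- (2 / 5 * L - 1 / 100))) \<le> exp (- L) * 2"
    by (intro mult_left_mono) auto
  also have "exp (- L) * (2 * exp (- (L * (L - 1))) + exp (- (2 / 5 * L - 1 / 100)))
      = 2 * exp (- L\<^sup>2) + exp (1 / 100 - 7 / 5 * L)"
    by (simp add: distrib_left power2_eq_square algebra_simps flip: exp_add)
  finally show ?thesis by simp
qed

section \<open>One iteration\<close>

locale rsgf_run =
  fixes f :: "'a::euclidean_space \<Rightarrow> real" and \<alpha> :: "'a \<Rightarrow> real" and \<beta> :: "'a \<Rightarrow> real \<Rightarrow> real"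
    and fstar \<delta> p \<Delta> c :: real and x1 :: 'a and T :: nat
  assumes lip: "locally_lipschitz f"
    and bounded_below: "\<And>x. fstar \<le> f x"
    and growth: "growth_condition f \<alpha> \<beta>"
    and \<delta>_pos: "\<delta> > 0"
    and p_pos: "0 < p" and p_less: "p < 1"
    and \<Delta>: "\<Delta> > smoothing f \<delta> x1 - fstar"
    and c_ge: "c \<ge> 1 / 2"
    and smooth: "\<And>x y. norm (gradient (smoothing f \<delta>) x - gradient (smoothing f \<delta>) y)
      \<le> rsgf_ell c DIM('a) \<alpha> \<beta> \<delta> x (norm (x - y)) * norm (x - y)"
    and T_ge: "T \<ge> 1"
begin

abbreviation "S \<equiv> smoothing f \<delta>"
abbreviation "G \<equiv> gradient (smoothing f \<delta>)"
abbreviation "C \<equiv> rsgf_C c DIM('a) \<alpha> \<beta> \<delta> \<Delta> T"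
abbreviation "\<eta> \<equiv> rsgf_eta c DIM('a) \<alpha> \<beta> \<delta> \<Delta> p T"
abbreviation "X w t \<equiv> rsgf_iter f c \<alpha> \<beta> \<delta> \<Delta> p T x1 w t"
text \<open>\<open>M\<close> is a Lipschitz constant of \<open>f\<close> on the ball of radius \<open>\<delta>\<close>, and \<open>s0\<close> the fraction of its
  largest possible value that the difference in the estimator exceeds only with small probability.
  The martingale differences \<open>Z\<close> carry the factor \<open>C\<close> and not the step size; this way they are
  bounded in terms of \<open>\<Delta>\<close> alone.\<close>

definition "M x = \<alpha> x + \<beta> x \<delta>"
definition "m x = \<alpha> x + \<beta> x (3 * \<delta>)"
definition "L = ln (2 * real T / p)"
definition "s0 = sqrt 2 * L / sqrt (real DIM('a))"
definition "Z x y = C x * (G x \<bullet> (G x - grad_est f \<delta> x y))"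

lemma cont: "continuous_on UNIV f"
  by (rule locally_lipschitz_continuous[OF lip])

lemma f_measurable [measurable]: "f \<in> borel_measurable borel"
  by (rule borel_measurable_continuous_onI[OF cont])

lemma d_ge: "real DIM('a) \<ge> 1"
  using DIM_positive[where 'a='a] by simp

lemma S_ge: "fstar \<le> S x"
  by (rule smoothing_ge[OF cont]) (use \<delta>_pos bounded_below in auto)

lemma \<Delta>_pos: "\<Delta> > 0"
  using \<Delta> S_ge[of x1] by simp

lemma ln_le_L:
  assumes "0 < k" "k \<le> 2 * real T"
  shows "ln k \<le> L"
proof -
  have "k * p \<le> 2 * real T" using assms p_less mult_left_mono[of p 1 k] by linarith
  then have "k \<le> 2 * real T / p" using p_pos by (simp add: pos_le_divide_eq)
  then show ?thesis using assms by (simp add: L_def)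
qed

lemma L_pos: "L \<ge> 2 / 3"
  using ln_le_L[of 2] T_ge ln2_ge_two_thirds by simp

lemma L_ge:
  assumes "T \<ge> 2"
  shows "L \<ge> 4 / 3"
proof -
  have "2 * ln 2 = ln ((2::real)\<^sup>2)" by (subst ln_realpow) auto
  also have "\<dots> \<le> L" using assms by (intro ln_le_L) auto
  finally show ?thesis using ln2_ge_two_thirds by simp
qed

lemma T_sqrt: "sqrt (real T) > 0"
  using T_ge by auto

lemma eta_eq: "\<eta> x = C x / (L * sqrt (real T))"
  by (simp add: rsgf_eta_def L_def)

lemma growth_nonneg: "0 \<le> \<alpha> x" "r \<ge> 0 \<Longrightarrow> 0 \<le> \<beta> x r"
  using growth_conditionD[OF growth] by auto

lemma M_le: "0 \<le> M x" "M x \<le> m x" "M x \<le> \<alpha> x + \<beta> x (2 * \<delta>)"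
  using growth_nonneg \<delta>_pos growth_conditionD(5)[OF growth] by (auto simp: M_def m_def)

lemma C_pos: "C x > 0"
  by (rule rsgf_C_pos) (use \<Delta>_pos growth_nonneg c_ge \<delta>_pos d_ge in auto)

lemma eta_pos: "\<eta> x > 0"
  unfolding eta_eq using C_pos[of x] L_pos T_sqrt by simp

lemma f_lip:
  assumes "y \<in> cball x \<delta>" "z \<in> cball x \<delta>"
  shows "\<bar>f y - f z\<bar> \<le> M x * norm (y - z)"
  unfolding M_def by (rule growth_condition_lipschitz[OF lip growth assms])

lemma compact_goldstein: "compact (goldstein_subdiff f \<delta> x)"
  by (rule compact_goldstein_subdiff[where M="M x"]) (use clarke_subdiff_norm_cball[OF growth] in \<open>auto simp: M_def\<close>)

lemma G_in_goldstein: "G x \<in> goldstein_subdiff f \<delta> x"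
  by (rule gradient_smoothing_in_goldstein[OF lip \<delta>_pos compact_goldstein])

lemma G_norm: "norm (G x) \<le> M x"
  by (rule norm_goldstein_le[OF _ G_in_goldstein]) (use clarke_subdiff_norm_cball[OF growth] in \<open>auto simp: M_def\<close>)

lemma grad_est_measurable [measurable]: "grad_est f \<delta> x \<in> borel_measurable borel"
  unfolding grad_est_def[abs_def] by measurable

lemma difference_le: "norm y \<le> 1 \<Longrightarrow> \<bar>f (x + \<delta> *\<^sub>R y) - f (x - \<delta> *\<^sub>R y)\<bar> \<le> 2 * \<delta> * M x * 1"
  by (rule symmetric_difference_le[OF \<delta>_pos M_le(1) _ f_lip])

lemma grad_est_norm: "norm y \<le> 1 \<Longrightarrow> norm (grad_est f \<delta> x y) \<le> (real DIM('a)) * M x"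
  using norm_grad_est_le(1)[OF \<delta>_pos _ difference_le, of y x] by simp

text \<open>This is what the first term of the minimum \<open>C\<close> is for.\<close>

lemma Z_bound:
  assumes y: "norm y \<le> 1"
  shows "\<bar>Z x y\<bar> \<le> \<Delta> / 2"
proof -
  have "norm (G x - grad_est f \<delta> x y) \<le> M x + (real DIM('a)) * M x"
    using norm_triangle_ineq4[of "G x" "grad_est f \<delta> x y"] G_norm[of x] grad_est_norm[OF y, of x] by linarith
  then have "\<bar>G x \<bullet> (G x - grad_est f \<delta> x y)\<bar> \<le> M x * (M x + (real DIM('a)) * M x)"
    using G_norm M_le(1) by (intro order_trans[OF Cauchy_Schwarz_ineq2] mult_mono) auto
  then have "\<bar>Z x y\<bar> \<le> C x * (M x * (M x + (real DIM('a)) * M x))"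
    using C_pos[of x] by (simp add: Z_def abs_mult mult_left_mono)
  also have "\<dots> \<le> \<Delta> / (2 * ((real DIM('a)) + 1) * (m x + 1)\<^sup>2) * (((real DIM('a)) + 1) * (m x + 1)\<^sup>2)"
  proof (rule mult_mono)
    show "C x \<le> \<Delta> / (2 * ((real DIM('a)) + 1) * (m x + 1)\<^sup>2)" unfolding m_def by (rule rsgf_C_le(1))
    have "M x * (M x + (real DIM('a)) * M x) = ((real DIM('a)) + 1) * (M x)\<^sup>2" by (simp add: power2_eq_square algebra_simps)
    also have "\<dots> \<le> ((real DIM('a)) + 1) * (m x + 1)\<^sup>2" using M_le[of x] d_ge by (intro mult_left_mono power_mono) auto
    finally show "M x * (M x + (real DIM('a)) * M x) \<le> ((real DIM('a)) + 1) * (m x + 1)\<^sup>2" .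
    show "0 \<le> \<Delta> / (2 * ((real DIM('a)) + 1) * (m x + 1)\<^sup>2)" using \<Delta>_pos d_ge by simp
    show "0 \<le> M x * (M x + (real DIM('a)) * M x)" using M_le(1)[of x] by simp
  qed
  also have "\<dots> = \<Delta> / 2" using d_ge M_le[of x] by (simp add: field_simps add_nonneg_eq_0_iff)
  finally show ?thesis .
qed

lemma Z_measurable [measurable]: "Z x \<in> borel_measurable borel"
  unfolding Z_def[abs_def] by measurable

lemma Z_integrable: "integrable unif_sphere (Z x)"
  by (rule unif_sphere_integrable[where K="\<Delta> / 2"]) (use Z_bound in auto)

lemma grad_est_integrable: "integrable unif_sphere (grad_est f \<delta> x)"
  by (rule unif_sphere_integrable[where K="(real DIM('a)) * M x"]) (use grad_est_norm in auto)

lemma Z_mean: "(LINT y|unif_sphere. Z x y) = 0"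
proof -
  interpret prob_space "unif_sphere :: 'a measure" by (rule prob_space_unif_sphere)
  have "(LINT y|unif_sphere. Z x y) = C x * (LINT y|unif_sphere. G x \<bullet> (G x - grad_est f \<delta> x y))"
    unfolding Z_def by (rule integral_mult_right_zero)
  also have "(LINT y|unif_sphere. G x \<bullet> (G x - grad_est f \<delta> x y)) = G x \<bullet> (LINT y|unif_sphere. G x - grad_est f \<delta> x y)"
    by (rule integral_inner_right) (use grad_est_integrable in auto)
  also have "(LINT y|unif_sphere. G x - grad_est f \<delta> x y) = 0"
    using grad_est_integrable by (simp add: integral_grad_est[OF cont \<delta>_pos] prob_space[simplified])
  finally show ?thesis by simp
qed

text \<open>This is what the second term of the minimum \<open>C\<close> is for.\<close>

lemma Z_second_moment: "(LINT y|unif_sphere. (Z x y)\<^sup>2) \<le> \<Delta>\<^sup>2 / 960"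
proof -
  interpret prob_space "unif_sphere :: 'a measure" by (rule prob_space_unif_sphere)
  have int: "integrable unif_sphere (\<lambda>y. G x \<bullet> grad_est f \<delta> x y)"
    by (intro integrable_inner_right) (use grad_est_integrable in auto)
  have int2: "integrable unif_sphere (\<lambda>y. (G x \<bullet> grad_est f \<delta> x y)\<^sup>2)"
  proof (rule unif_sphere_integrable[where K="(M x * ((real DIM('a)) * M x))\<^sup>2"])
    fix y :: 'a assume "norm y \<le> 1"
    then have "\<bar>G x \<bullet> grad_est f \<delta> x y\<bar> \<le> M x * ((real DIM('a)) * M x)"
      using G_norm grad_est_norm M_le(1) by (intro order_trans[OF Cauchy_Schwarz_ineq2] mult_mono) auto
    then show "norm ((G x \<bullet> grad_est f \<delta> x y)\<^sup>2) \<le> (M x * ((real DIM('a)) * M x))\<^sup>2"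
      using M_le(1)[of x] by (simp add: abs_le_square_iff[symmetric])
  qed measurable
  have mean: "(LINT y|unif_sphere. G x \<bullet> grad_est f \<delta> x y) = (norm (G x))\<^sup>2"
  proof -
    have "(LINT y|unif_sphere. G x \<bullet> grad_est f \<delta> x y) = G x \<bullet> (LINT y|unif_sphere. grad_est f \<delta> x y)"
      by (rule integral_inner_right) (use grad_est_integrable in auto)
    then show ?thesis by (simp add: integral_grad_est[OF cont \<delta>_pos] power2_norm_eq_inner)
  qed
  have "(LINT y|unif_sphere. (Z x y)\<^sup>2)
      = (LINT y|unif_sphere. (C x)\<^sup>2 * ((norm (G x)) ^ 4 - 2 * (norm (G x))\<^sup>2 * (G x \<bullet> grad_est f \<delta> x y) + (G x \<bullet> grad_est f \<delta> x y)\<^sup>2))"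
  proof (intro Bochner_Integration.integral_cong refl)
    fix y
    have "(Z x y)\<^sup>2 = (C x)\<^sup>2 * ((norm (G x))\<^sup>2 - G x \<bullet> grad_est f \<delta> x y)\<^sup>2"
      by (simp add: Z_def power_mult_distrib inner_diff_right power2_norm_eq_inner)
    also have "((norm (G x))\<^sup>2 - G x \<bullet> grad_est f \<delta> x y)\<^sup>2
        = (norm (G x)) ^ 4 - 2 * (norm (G x))\<^sup>2 * (G x \<bullet> grad_est f \<delta> x y) + (G x \<bullet> grad_est f \<delta> x y)\<^sup>2"
      by (simp add: power2_diff flip: power_mult)
    finally show "(Z x y)\<^sup>2 = (C x)\<^sup>2 * ((norm (G x)) ^ 4 - 2 * (norm (G x))\<^sup>2 * (G x \<bullet> grad_est f \<delta> x y) + (G x \<bullet> grad_est f \<delta> x y)\<^sup>2)" .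
  qed
  also have "\<dots> = (C x)\<^sup>2 * ((norm (G x)) ^ 4 - 2 * (norm (G x))\<^sup>2 * (norm (G x))\<^sup>2 + (LINT y|unif_sphere. (G x \<bullet> grad_est f \<delta> x y)\<^sup>2))"
    using int int2 mean by (simp add: prob_space[simplified])
  also have "\<dots> \<le> (C x)\<^sup>2 * (LINT y|unif_sphere. (G x \<bullet> grad_est f \<delta> x y)\<^sup>2)"
  proof (rule mult_left_mono)
    define b where "b = (norm (G x))\<^sup>2"
    have "(norm (G x)) ^ 4 = b * b" unfolding b_def by (simp flip: power_add)
    moreover have "0 \<le> b * b" by simp
    ultimately show "(norm (G x)) ^ 4 - 2 * (norm (G x))\<^sup>2 * (norm (G x))\<^sup>2 + (LINT y|unif_sphere. (G x \<bullet> grad_est f \<delta> x y)\<^sup>2)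
        \<le> (LINT y|unif_sphere. (G x \<bullet> grad_est f \<delta> x y)\<^sup>2)"
      unfolding b_def[symmetric] by linarith
  qed simp
  also have "\<dots> \<le> (C x)\<^sup>2 * ((real DIM('a)) * (M x)\<^sup>2 * (norm (G x))\<^sup>2)"
    by (intro mult_left_mono grad_est_second_moment cont \<delta>_pos M_le f_lip) auto
  also have "\<dots> \<le> (C x)\<^sup>2 * ((real DIM('a)) * (M x)\<^sup>2 * (M x)\<^sup>2)"
    using G_norm[of x] by (intro mult_left_mono power_mono) auto
  also have "\<dots> \<le> \<Delta>\<^sup>2 / 960"
  proof (cases "M x = 0")
    case False
    then have Mx: "M x > 0" using M_le(1)[of x] by simp
    define \<sigma> where "\<sigma> = rsgf_sigma DIM('a) \<alpha> \<beta> \<delta> x"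
    have \<sigma>2: "40 * (real DIM('a)) * (M x)\<^sup>2 \<le> \<sigma>\<^sup>2" unfolding \<sigma>_def by (rule rsgf_sigma_ge; rule M_le)
    have "0 < 40 * (real DIM('a)) * (M x)\<^sup>2" using Mx d_ge by simp
    then have "\<sigma>\<^sup>2 > 0" using \<sigma>2 by linarith
    then have \<sigma>: "\<sigma> > 0" using rsgf_sigma_nonneg[of "DIM('a)" \<alpha> \<beta> \<delta> x] by (simp add: \<sigma>_def less_le)
    have "C x \<le> sqrt 6 / 12 * (\<Delta> / (\<sigma> * M x))"
      unfolding \<sigma>_def M_def by (rule rsgf_C_le(2)) (use \<sigma> Mx in \<open>auto simp: \<sigma>_def M_def\<close>)
    then have "C x * (\<sigma> * M x) \<le> sqrt 6 / 12 * \<Delta>" using \<sigma> Mx by (simp add: pos_le_divide_eq)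
    then have "(C x * (\<sigma> * M x))\<^sup>2 \<le> (sqrt 6 / 12 * \<Delta>)\<^sup>2" using C_pos[of x] \<sigma> Mx by (intro power_mono) auto
    also have "\<dots> = \<Delta>\<^sup>2 / 24" by (simp add: power_mult_distrib power_divide)
    finally have "(C x)\<^sup>2 * \<sigma>\<^sup>2 * (M x)\<^sup>2 \<le> \<Delta>\<^sup>2 / 24" by (simp add: power_mult_distrib mult_ac)
    moreover have "(C x)\<^sup>2 * (40 * (real DIM('a)) * (M x)\<^sup>2) * (M x)\<^sup>2 \<le> (C x)\<^sup>2 * \<sigma>\<^sup>2 * (M x)\<^sup>2"
      using \<sigma>2 by (intro mult_right_mono mult_left_mono) auto
    ultimately show ?thesis by (simp add: mult_ac)
  qed simp
  finally show ?thesis .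
qed

lemma Z_mgf:
  assumes \<mu>: "0 \<le> \<mu>" "\<mu> * \<Delta> \<le> 2"
  shows "(\<integral>\<^sup>+y. ennreal (exp (\<mu> * Z x y)) \<partial>unif_sphere) \<le> ennreal (exp (\<mu>\<^sup>2 * \<Delta>\<^sup>2 / 960))"
proof -
  interpret prob_space "unif_sphere :: 'a measure" by (rule prob_space_unif_sphere)
  have small: "\<bar>\<mu> * Z x y\<bar> \<le> 1" if "norm y \<le> 1" for y
  proof -
    have "\<bar>\<mu> * Z x y\<bar> \<le> \<mu> * (\<Delta> / 2)" unfolding abs_mult using \<mu> Z_bound[OF that, of x] by (intro mult_mono) auto
    then show ?thesis using \<mu> by simp
  qed
  have int2: "integrable unif_sphere (\<lambda>y. (Z x y)\<^sup>2)"
  proof (rule unif_sphere_integrable[where K="(\<Delta> / 2)\<^sup>2"])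
    fix y :: 'a assume "norm y \<le> 1"
    from Z_bound[OF this, of x] show "norm ((Z x y)\<^sup>2) \<le> (\<Delta> / 2)\<^sup>2"
      using \<Delta>_pos by (simp add: abs_le_square_iff[symmetric] del: power_divide)
  qed measurable
  have int: "integrable unif_sphere (\<lambda>y. 1 + \<mu> * Z x y + \<mu>\<^sup>2 * (Z x y)\<^sup>2)"
    using Z_integrable int2 by simp
  have inte: "integrable unif_sphere (\<lambda>y. exp (\<mu> * Z x y))"
    by (rule unif_sphere_integrable[where K="exp 1"]) (use small in \<open>auto dest: abs_le_D1\<close>)
  have "(LINT y|unif_sphere. exp (\<mu> * Z x y)) \<le> (LINT y|unif_sphere. 1 + \<mu> * Z x y + \<mu>\<^sup>2 * (Z x y)\<^sup>2)"
  proof (rule integral_mono_AE[OF inte int])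
    show "AE y in unif_sphere. exp (\<mu> * Z x y) \<le> 1 + \<mu> * Z x y + \<mu>\<^sup>2 * (Z x y)\<^sup>2"
      using AE_unif_sphere
    proof eventually_elim
      case (elim y)
      from exp_le_quadratic[OF small[OF this]] show ?case by (simp add: power_mult_distrib)
    qed
  qed
  also have "\<dots> = 1 + \<mu>\<^sup>2 * (LINT y|unif_sphere. (Z x y)\<^sup>2)"
    using Z_integrable int2 Z_mean by (simp add: prob_space[simplified])
  also have "\<dots> \<le> 1 + \<mu>\<^sup>2 * (\<Delta>\<^sup>2 / 960)" using Z_second_moment by (intro add_left_mono mult_left_mono) auto
  also have "\<dots> \<le> exp (\<mu>\<^sup>2 * \<Delta>\<^sup>2 / 960)" using exp_ge_add_one_self[of "\<mu>\<^sup>2 * (\<Delta>\<^sup>2 / 960)"] by simp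
  finally have "(LINT y|unif_sphere. exp (\<mu> * Z x y)) \<le> exp (\<mu>\<^sup>2 * \<Delta>\<^sup>2 / 960)" .
  then show ?thesis by (subst nn_integral_eq_integral[OF inte]) (auto intro: ennreal_leI)
qed

text \<open>This is what the third term of the minimum \<open>C\<close> is for.  If the step has at most the radius at which
  the modulus was evaluated, monotonicity of the modulus suffices; if it has at most length \<open>2 * \<delta>\<close>,
  the modulus at the step is governed by \<open>m\<close>.\<close>

lemma step_quadratic_term:
  assumes T2: "T \<ge> 2" and y: "norm y \<le> 1" and F: "\<bar>f (x + \<delta> *\<^sub>R y) - f (x - \<delta> *\<^sub>R y)\<bar> \<le> 2 * \<delta> * M x * s0"
  defines "h \<equiv> - (\<eta> x *\<^sub>R grad_est f \<delta> x y)"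
  shows "rsgf_ell c DIM('a) \<alpha> \<beta> \<delta> x (norm h) / 2 * (norm h)\<^sup>2 \<le> \<Delta> / (2 * L\<^sup>2 * real T)"
proof (cases "M x = 0")
  case True
  then have "grad_est f \<delta> x y = 0" using grad_est_norm[OF y, of x] by simp
  then show ?thesis using \<Delta>_pos by (simp add: h_def)
next
  case False
  then have Mx: "M x > 0" using M_le(1)[of x] by simp
  then have mx: "m x > 0" using M_le(2)[of x] by simp
  define \<tau> where "\<tau> = sqrt (real T)"
  have \<tau>: "\<tau> \<ge> sqrt 2" "\<tau> > 0" "\<tau>\<^sup>2 = real T" using T2 T_sqrt by (auto simp: \<tau>_def)
  have L0: "L > 0" using L_pos by simp
  have c0: "c > 0" using c_ge by simp
  define \<rho> where "\<rho> = \<Delta> / ((real DIM('a)) * (m x + 1) * \<tau>)"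
  have \<rho>: "\<rho> \<ge> 0" using \<Delta>_pos mx \<tau> by (simp add: \<rho>_def)
  define l where "l = rsgf_ell c DIM('a) \<alpha> \<beta> \<delta> x \<rho>"
  have l_ge: "c * sqrt (real DIM('a)) * M x / \<delta> \<le> l"
  proof -
    have "\<beta> x \<delta> \<le> \<beta> x (\<rho> + \<delta>)" using \<rho> \<delta>_pos by (intro growth_conditionD(5)[OF growth]) auto
    then have "c * sqrt (real DIM('a)) * (2 * M x) / (2 * \<delta>) \<le> l"
      unfolding l_def rsgf_ell_def using c0 \<delta>_pos by (intro divide_right_mono mult_left_mono) (auto simp: M_def)
    then show ?thesis by simp
  qed
  moreover have "c * sqrt (real DIM('a)) * M x / \<delta> > 0" using c0 Mx \<delta>_pos d_ge by simp
  ultimately have l0: "l > 0" by linarith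
  have C3: "C x \<le> 1 / ((real DIM('a)) * m x) * sqrt (\<Delta> / l)"
    unfolding l_def \<rho>_def \<tau>_def m_def
    by (rule rsgf_C_le(3)) (use mx l0 in \<open>auto simp: m_def l_def \<rho>_def \<tau>_def\<close>)
  have C1: "C x \<le> \<Delta> / (2 * ((real DIM('a)) + 1) * (m x + 1)\<^sup>2)" unfolding m_def by (rule rsgf_C_le(1))
  have hn: "norm h = C x / (L * \<tau>) * norm (grad_est f \<delta> x y)"
    unfolding h_def eta_eq \<tau>_def[symmetric] using C_pos[of x] L0 \<tau> by simp
  have h1: "norm h \<le> C x / (L * \<tau>) * ((real DIM('a)) * M x)"
    unfolding hn using C_pos[of x] L0 \<tau> grad_est_norm[OF y, of x] by (intro mult_left_mono) auto
  have h2: "norm h \<le> C x / (L * \<tau>) * ((real DIM('a)) * M x * s0)"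
    unfolding hn using C_pos[of x] L0 \<tau> norm_grad_est_le(1)[OF \<delta>_pos y F] by (intro mult_left_mono) auto
  have "norm h \<le> \<Delta> / ((real DIM('a)) * (m x + 1) * \<tau>) \<or> norm h \<le> 2 * \<delta>"
  proof (rule step_length_dichotomy[where s=s0 and l=l and M="M x" and m="m x" and L=L and C="C x" and c=c])
    show "s0 * sqrt (real DIM('a)) \<le> sqrt 2 * L" "0 \<le> s0" using d_ge L0 by (auto simp: s0_def)
  qed (use d_ge Mx M_le L0 \<tau> \<Delta>_pos \<delta>_pos c_ge C1 C3 l_ge h2 in auto)
  then have "2 * M x * rsgf_ell c DIM('a) \<alpha> \<beta> \<delta> x (norm h) \<le> (M x + m x) * l"
  proof
    assume "norm h \<le> \<Delta> / ((real DIM('a)) * (m x + 1) * \<tau>)"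
    then have "rsgf_ell c DIM('a) \<alpha> \<beta> \<delta> x (norm h) \<le> l"
      unfolding l_def \<rho>_def using c0 \<delta>_pos by (intro rsgf_ell_mono[OF growth]) auto
    then show ?thesis using Mx M_le(2)[of x] l0
      by (intro order_trans[OF mult_left_mono[of _ l "2 * M x"] mult_right_mono[of "2 * M x" _ l]]) auto
  next
    assume "norm h \<le> 2 * \<delta>"
    then have "\<beta> x (norm h + \<delta>) \<le> \<beta> x (3 * \<delta>)" using \<delta>_pos by (intro growth_conditionD(5)[OF growth]) auto
    then have "rsgf_ell c DIM('a) \<alpha> \<beta> \<delta> x (norm h) \<le> c * sqrt (real DIM('a)) * (M x + m x) / (2 * \<delta>)"
      unfolding rsgf_ell_def M_def m_def using c0 \<delta>_pos by (intro divide_right_mono mult_left_mono) auto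
    then have "2 * M x * rsgf_ell c DIM('a) \<alpha> \<beta> \<delta> x (norm h) \<le> 2 * M x * (c * sqrt (real DIM('a)) * (M x + m x) / (2 * \<delta>))"
      using Mx by (intro mult_left_mono) auto
    also have "\<dots> = (M x + m x) * (c * sqrt (real DIM('a)) * M x / \<delta>)" by (simp add: mult_ac)
    also have "\<dots> \<le> (M x + m x) * l" using l_ge Mx mx by (intro mult_left_mono) auto
    finally show ?thesis .
  qed
  from step_quadratic_bound[OF d_ge Mx M_le(2) L0 \<tau>(2) \<Delta>_pos l0 less_imp_le[OF C_pos] C3 _ h1 this]
  show ?thesis unfolding \<tau>(3) by simp
qed

lemma descent_step:
  assumes T2: "T \<ge> 2" and y: "norm y \<le> 1" and F: "\<bar>f (x + \<delta> *\<^sub>R y) - f (x - \<delta> *\<^sub>R y)\<bar> \<le> 2 * \<delta> * M x * s0"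
  shows "S (x - \<eta> x *\<^sub>R grad_est f \<delta> x y) + \<eta> x * (norm (G x))\<^sup>2
    \<le> S x + Z x y / (L * sqrt (real T)) + \<Delta> / (2 * L\<^sup>2 * real T)"
proof -
  define h where "h = - (\<eta> x *\<^sub>R grad_est f \<delta> x y)"
  have "S (x + h) \<le> S x + G x \<bullet> h + rsgf_ell c DIM('a) \<alpha> \<beta> \<delta> x (norm h) / 2 * (norm h)\<^sup>2"
    using c_ge by (intro smoothing_descent[OF lip growth \<delta>_pos _ smooth]) auto
  also have "rsgf_ell c DIM('a) \<alpha> \<beta> \<delta> x (norm h) / 2 * (norm h)\<^sup>2 \<le> \<Delta> / (2 * L\<^sup>2 * real T)"
    unfolding h_def by (rule step_quadratic_term[OF T2 y F])
  also have "G x \<bullet> h = - \<eta> x * (norm (G x))\<^sup>2 + Z x y / (L * sqrt (real T))"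
    unfolding h_def Z_def eta_eq by (simp add: inner_diff_right power2_norm_eq_inner algebra_simps diff_divide_distrib)
  finally show ?thesis by (simp add: h_def)
qed

end

section \<open>The random iterates\<close>

lemma growth_measurable:
  assumes growth: "growth_condition f \<alpha> \<beta>" and [measurable]: "r \<in> borel_measurable borel" and r: "\<And>x. 0 \<le> r x"
  shows "(\<lambda>x :: 'a::euclidean_space. \<beta> x (r x)) \<in> borel_measurable borel"
proof -
  have "continuous_on UNIV (\<lambda>z. (\<lambda>(x, r). \<beta> x r) (fst z, max 0 (snd z)))"
    by (rule continuous_on_compose2[OF growth_conditionD(3)[OF growth]]) (auto intro!: continuous_intros)
  then have [measurable]: "(\<lambda>z. \<beta> (fst z) (max 0 (snd z))) \<in> borel_measurable (borel \<Otimes>\<^sub>M borel)"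
    unfolding borel_prod by (intro borel_measurable_continuous_onI) simp
  have "(\<lambda>x. (x, r x)) \<in> borel \<rightarrow>\<^sub>M borel \<Otimes>\<^sub>M borel" by measurable
  from measurable_compose[OF this, of "\<lambda>z. \<beta> (fst z) (max 0 (snd z))" borel]
  have "(\<lambda>x. \<beta> x (max 0 (r x))) \<in> borel_measurable borel" by simp
  then show ?thesis using r by (simp add: max_absorb2)
qed

lemma alpha_measurable: "growth_condition f \<alpha> \<beta> \<Longrightarrow> \<alpha> \<in> borel_measurable (borel :: 'a::euclidean_space measure)"
  by (rule borel_measurable_continuous_onI[OF growth_conditionD(1)])

lemma rsgf_C_measurable:
  fixes \<alpha> :: "'a::euclidean_space \<Rightarrow> real"
  assumes growth: "growth_condition f \<alpha> \<beta>" and \<delta>: "\<delta> > 0" and \<Delta>: "\<Delta> > 0"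
  shows "rsgf_C c d \<alpha> \<beta> \<delta> \<Delta> T \<in> borel_measurable borel"
proof -
  have [measurable]: "\<alpha> \<in> borel_measurable borel" by (rule alpha_measurable[OF growth])
  have b [measurable]: "(\<lambda>x. \<beta> x r) \<in> borel_measurable borel" if "r \<ge> 0" for r
    by (rule growth_measurable[OF growth]) (use that in auto)
  have [measurable]: "(\<lambda>x. \<beta> x \<delta>) \<in> borel_measurable borel" "(\<lambda>x. \<beta> x (2 * \<delta>)) \<in> borel_measurable borel"
      "(\<lambda>x. \<beta> x (3 * \<delta>)) \<in> borel_measurable borel"
    using \<delta> by (auto intro: b)
  have pos: "0 \<le> \<alpha> x + \<beta> x (3 * \<delta>) + 1" for x
    using growth_conditionD(2,4)[OF growth] \<delta> by (simp add: add_nonneg_nonneg)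
  have [measurable]: "(\<lambda>x. \<beta> x (\<Delta> / (real d * (\<alpha> x + \<beta> x (3 * \<delta>) + 1) * sqrt (real T)) + \<delta>)) \<in> borel_measurable borel"
  proof (rule growth_measurable[OF growth])
    show "0 \<le> \<Delta> / (real d * (\<alpha> x + \<beta> x (3 * \<delta>) + 1) * sqrt (real T)) + \<delta>" for x
      using pos[of x] \<delta> \<Delta> by simp
  qed measurable
  show ?thesis
    unfolding rsgf_C_eq_min[abs_def] Let_def rsgf_sigma_def rsgf_ell_def by measurable
qed

text \<open>Integrating out one coordinate of the noise first.\<close>

lemma nn_integral_noise_coordinate:
  fixes \<phi> :: "(nat \<Rightarrow> 'a::euclidean_space) \<Rightarrow> 'a \<Rightarrow> ennreal"
  assumes t: "t \<in> {1..T}"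
    and [measurable]: "case_prod \<phi> \<in> borel_measurable (rsgf_noise T \<Otimes>\<^sub>M unif_sphere)"
    and indep: "\<And>w z y. \<phi> (w(t := z)) y = \<phi> w y"
  shows "(\<integral>\<^sup>+w. \<phi> w (w t) \<partial>rsgf_noise T) = (\<integral>\<^sup>+w. \<integral>\<^sup>+y. \<phi> w y \<partial>unif_sphere \<partial>rsgf_noise T)"
proof -
  let ?Q = "unif_sphere :: 'a measure"
  interpret Q: prob_space ?Q by (rule prob_space_unif_sphere)
  interpret P: product_sigma_finite "\<lambda>_::nat. ?Q" by standard
  define J where "J = {1..T} - {t}"
  have J: "finite J" "t \<notin> J" "insert t J = {1..T}" using t by (auto simp: J_def)
  have N: "rsgf_noise T = (\<Pi>\<^sub>M i\<in>insert t J. ?Q)" by (simp add: rsgf_noise_def J)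
  have [measurable]: "(\<lambda>w. w t) \<in> rsgf_noise T \<rightarrow>\<^sub>M ?Q"
    unfolding N by (rule measurable_component_singleton) simp
  have indep': "\<phi> (w(t := z)) = \<phi> w" for w z by (rule ext) (rule indep)
  have m1: "(\<lambda>w. \<phi> w (w t)) \<in> borel_measurable (\<Pi>\<^sub>M i\<in>insert t J. ?Q)"
  proof -
    have "(\<lambda>w. (w, w t)) \<in> rsgf_noise T \<rightarrow>\<^sub>M rsgf_noise T \<Otimes>\<^sub>M ?Q" by measurable
    from measurable_compose[OF this assms(2)] show ?thesis unfolding N[symmetric] by simp
  qed
  have m2: "(\<lambda>w. \<integral>\<^sup>+y. \<phi> w y \<partial>?Q) \<in> borel_measurable (\<Pi>\<^sub>M i\<in>insert t J. ?Q)"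
    unfolding N[symmetric] by measurable
  have "(\<integral>\<^sup>+w. \<phi> w (w t) \<partial>rsgf_noise T) = (\<integral>\<^sup>+w. \<integral>\<^sup>+z. \<phi> w z \<partial>?Q \<partial>(\<Pi>\<^sub>M i\<in>J. ?Q))"
    unfolding N P.product_nn_integral_insert[OF J(1,2) m1] by (simp add: indep')
  also have "\<dots> = (\<integral>\<^sup>+w. \<integral>\<^sup>+y. \<phi> w y \<partial>?Q \<partial>rsgf_noise T)"
    unfolding N P.product_nn_integral_insert[OF J(1,2) m2] by (simp add: indep' Q.emeasure_space_1[simplified])
  finally show ?thesis .
qed

lemma prob_space_noise: "prob_space (rsgf_noise T :: (nat \<Rightarrow> 'a::euclidean_space) measure)"
  unfolding rsgf_noise_def by (intro prob_space_PiM prob_space_unif_sphere)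

context rsgf_run
begin

abbreviation "N \<equiv> (rsgf_noise T :: (nat \<Rightarrow> 'a) measure)"
definition "U w t = (\<Sum>s=1..t. Z (X w s) (w s))"
definition "F x y = f (x + \<delta> *\<^sub>R y) - f (x - \<delta> *\<^sub>R y)"

lemma component_measurable: "t \<in> {1..T} \<Longrightarrow> (\<lambda>w. w t) \<in> N \<rightarrow>\<^sub>M (borel :: 'a measure)"
  using measurable_component_singleton[of t "{1..T}" "\<lambda>_. unif_sphere :: 'a measure"]
  by (simp add: rsgf_noise_def cong: measurable_cong_sets)

lemma C_measurable [measurable]: "C \<in> borel_measurable borel"
  by (rule rsgf_C_measurable[OF growth \<delta>_pos \<Delta>_pos])

lemma eta_measurable [measurable]: "\<eta> \<in> borel_measurable borel"
  unfolding eta_eq[abs_def] by measurable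

lemma G_measurable [measurable]: "G \<in> borel_measurable borel"
  by (rule gradient_smoothing_measurable[OF cont \<delta>_pos])

lemma S_measurable [measurable]: "S \<in> borel_measurable borel"
  by (rule borel_measurable_continuous_onI[OF continuous_on_smoothing[OF cont \<delta>_pos]])

lemma M_measurable [measurable]: "M \<in> borel_measurable borel"
  unfolding M_def[abs_def]
  by (intro borel_measurable_add alpha_measurable[OF growth] growth_measurable[OF growth]) (use \<delta>_pos in auto)

lemma grad_est_pair_measurable [measurable (raw)]:
  assumes [measurable]: "a \<in> K \<rightarrow>\<^sub>M borel" "b \<in> K \<rightarrow>\<^sub>M borel"
  shows "(\<lambda>k. grad_est f \<delta> (a k) (b k)) \<in> K \<rightarrow>\<^sub>M borel"
  unfolding grad_est_def by measurable

lemma Z_pair_measurable [measurable (raw)]: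
  assumes [measurable]: "a \<in> K \<rightarrow>\<^sub>M borel" "b \<in> K \<rightarrow>\<^sub>M borel"
  shows "(\<lambda>k. Z (a k) (b k)) \<in> K \<rightarrow>\<^sub>M borel"
  unfolding Z_def by measurable

lemma F_pair_measurable [measurable (raw)]:
  assumes [measurable]: "a \<in> K \<rightarrow>\<^sub>M borel" "b \<in> K \<rightarrow>\<^sub>M borel"
  shows "(\<lambda>k. F (a k) (b k)) \<in> K \<rightarrow>\<^sub>M borel"
  unfolding F_def by measurable

lemma X_Suc: "t \<ge> 1 \<Longrightarrow> X w (Suc t) = X w t - \<eta> (X w t) *\<^sub>R grad_est f \<delta> (X w t) (w t)"
  by (simp add: Let_def)

lemma X_measurable: "t \<le> Suc T \<Longrightarrow> (\<lambda>w. X w t) \<in> N \<rightarrow>\<^sub>M borel"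
proof (induction t)
  case (Suc t)
  show ?case
  proof (cases "t = 0")
    case False
    have [measurable]: "(\<lambda>w. X w t) \<in> N \<rightarrow>\<^sub>M borel" using Suc by simp
    have [measurable]: "(\<lambda>w. w t) \<in> N \<rightarrow>\<^sub>M (borel :: 'a measure)"
      using Suc.prems False by (intro component_measurable) simp
    have "(\<lambda>w. X w t - \<eta> (X w t) *\<^sub>R grad_est f \<delta> (X w t) (w t)) \<in> N \<rightarrow>\<^sub>M borel" by measurable
    then show ?thesis using False by (simp only: X_Suc)
  qed simp
qed simp

lemma X_upd: "t \<le> s \<Longrightarrow> X (w(s := z)) t = X w t"
proof (induction t)
  case (Suc t)
  then show ?case by (cases "t = 0") (simp_all add: Let_def)
qed simp

lemma U_upd: "t < s \<Longrightarrow> U (w(s := z)) t = U w t"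
  unfolding U_def by (intro sum.cong refl) (simp add: X_upd)

lemma U_measurable: "t \<le> T \<Longrightarrow> (\<lambda>w. U w t) \<in> N \<rightarrow>\<^sub>M borel"
  unfolding U_def by (intro borel_measurable_sum Z_pair_measurable X_measurable component_measurable) auto

text \<open>Conditionally on the past, each factor contributes at most the bound of \<open>Z_mgf\<close>, wherever the
  current iterate is.\<close>

lemma U_mgf:
  assumes \<mu>: "0 \<le> \<mu>" "\<mu> * \<Delta> \<le> 2" and t: "t \<le> T"
  shows "(\<integral>\<^sup>+w. ennreal (exp (\<mu> * U w t)) \<partial>N) \<le> ennreal (exp (real t * (\<mu>\<^sup>2 * \<Delta>\<^sup>2 / 960)))"
  using t
proof (induction t)
  case 0
  interpret prob_space N by (rule prob_space_noise)
  show ?case by (simp add: U_def emeasure_space_1)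
next
  case (Suc t)
  have [measurable]: "(\<lambda>w. X w (Suc t)) \<in> N \<rightarrow>\<^sub>M borel" by (rule X_measurable) (use Suc in simp)
  have [measurable]: "(\<lambda>w. U w t) \<in> N \<rightarrow>\<^sub>M borel" by (rule U_measurable) (use Suc in simp)
  let ?\<phi> = "\<lambda>w y. ennreal (exp (\<mu> * U w t)) * ennreal (exp (\<mu> * Z (X w (Suc t)) y))"
  have "(\<integral>\<^sup>+w. ennreal (exp (\<mu> * U w (Suc t))) \<partial>N) = (\<integral>\<^sup>+w. ?\<phi> w (w (Suc t)) \<partial>N)"
    by (simp add: U_def distrib_left exp_add ennreal_mult del: rsgf_iter.simps)
  also have "\<dots> = (\<integral>\<^sup>+w. \<integral>\<^sup>+y. ?\<phi> w y \<partial>unif_sphere \<partial>N)"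
  proof (rule nn_integral_noise_coordinate)
    show "?\<phi> (w(Suc t := z)) y = ?\<phi> w y" for w z y by (simp only: U_upd[OF lessI] X_upd[OF order_refl])
    show "case_prod ?\<phi> \<in> borel_measurable (N \<Otimes>\<^sub>M unif_sphere)" by measurable
  qed (use Suc in auto)
  also have "\<dots> = (\<integral>\<^sup>+w. ennreal (exp (\<mu> * U w t)) * (\<integral>\<^sup>+y. ennreal (exp (\<mu> * Z (X w (Suc t)) y)) \<partial>unif_sphere) \<partial>N)"
    by (intro nn_integral_cong nn_integral_cmult) measurable
  also have "\<dots> \<le> (\<integral>\<^sup>+w. ennreal (exp (\<mu> * U w t)) * ennreal (exp (\<mu>\<^sup>2 * \<Delta>\<^sup>2 / 960)) \<partial>N)"
    by (intro nn_integral_mono mult_left_mono Z_mgf[OF \<mu>]) auto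
  also have "\<dots> = (\<integral>\<^sup>+w. ennreal (exp (\<mu> * U w t)) \<partial>N) * ennreal (exp (\<mu>\<^sup>2 * \<Delta>\<^sup>2 / 960))"
    by (rule nn_integral_multc) measurable
  also have "\<dots> \<le> ennreal (exp (real t * (\<mu>\<^sup>2 * \<Delta>\<^sup>2 / 960))) * ennreal (exp (\<mu>\<^sup>2 * \<Delta>\<^sup>2 / 960))"
    using Suc by (intro mult_right_mono) auto
  also have "\<dots> = ennreal (exp (real (Suc t) * (\<mu>\<^sup>2 * \<Delta>\<^sup>2 / 960)))"
  proof -
    have "exp (real t * v) * exp v = exp (real (Suc t) * v)" for v :: real
      by (simp add: algebra_simps flip: exp_add)
    then show ?thesis by (simp only: ennreal_mult[symmetric] exp_ge_zero)
  qed
  finally show ?case .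
qed

text \<open>A Bernstein bound: the increments are at most \<open>\<Delta> / 2\<close> in absolute value, and their conditional
  variances are so small that the exponential moments for an exponent of order \<open>1 / (\<Delta> \<surd>T)\<close> are
  essentially 1.\<close>

lemma U_tail:
  assumes T2: "T \<ge> 2" and t: "t \<le> T"
  shows "measure N {w \<in> space N. \<Delta> * L * sqrt (real T) / 2 < U w t} \<le> exp (1 / 100 - 7 / 5 * L)"
proof -
  interpret prob_space N by (rule prob_space_noise)
  have [measurable]: "(\<lambda>w. U w t) \<in> N \<rightarrow>\<^sub>M borel" by (rule U_measurable[OF t])
  \<comment> \<open>The largest convenient exponent with \<open>\<mu> * \<Delta> \<le> 2\<close>, as \<open>Z_mgf\<close> requires; for \<open>T \<ge> 2\<close> the root is at
    least \<open>7 / 5\<close>.\<close>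
  define \<mu> where "\<mu> = 14 / (5 * \<Delta> * sqrt (real T))"
  have T0: "sqrt (real T) > 0" by (rule T_sqrt)
  have \<mu>0: "\<mu> \<ge> 0" using \<Delta>_pos by (simp add: \<mu>_def)
  have "7 / 5 \<le> sqrt (real T)" by (rule real_le_rsqrt) (use T2 in \<open>simp add: power2_eq_square\<close>)
  then have \<mu>1: "\<mu> * \<Delta> \<le> 2" using \<Delta>_pos T0 by (simp add: \<mu>_def divide_le_eq)
  define u where "u = \<Delta> * L * sqrt (real T) / 2"
  have \<mu>u: "\<mu> * u = 7 / 5 * L" using \<Delta>_pos T0 by (simp add: \<mu>_def u_def)
  have var: "real t * (\<mu>\<^sup>2 * \<Delta>\<^sup>2 / 960) \<le> 1 / 100"
  proof -
    have "\<mu>\<^sup>2 * \<Delta>\<^sup>2 = 196 / (25 * real T)" using \<Delta>_pos T_ge by (simp add: \<mu>_def power_divide power_mult_distrib)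
    then have "real t * (\<mu>\<^sup>2 * \<Delta>\<^sup>2 / 960) = (real t / real T) * (196 / 24000)" by simp
    also have "\<dots> \<le> 1 * (196 / 24000)" using t T_ge by (intro mult_right_mono) auto
    finally show ?thesis by simp
  qed
  have "emeasure N {w \<in> space N. u < U w t} \<le> emeasure N {w \<in> space N. 1 \<le> ennreal (exp (- (\<mu> * u))) * ennreal (exp (\<mu> * U w t))}"
  proof (rule emeasure_mono)
    show "{w \<in> space N. u < U w t} \<subseteq> {w \<in> space N. 1 \<le> ennreal (exp (- (\<mu> * u))) * ennreal (exp (\<mu> * U w t))}"
    proof safe
      fix w assume "u < U w t"
      then have "0 \<le> - (\<mu> * u) + \<mu> * U w t" using \<mu>0 by (simp add: mult_left_mono)
      then have "1 \<le> exp (- (\<mu> * u) + \<mu> * U w t)" by simp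
      also have "\<dots> = exp (- (\<mu> * u)) * exp (\<mu> * U w t)" by (rule exp_add)
      finally have "ennreal 1 \<le> ennreal (exp (- (\<mu> * u)) * exp (\<mu> * U w t))" by (rule ennreal_leI)
      then show "1 \<le> ennreal (exp (- (\<mu> * u))) * ennreal (exp (\<mu> * U w t))"
        by (simp only: ennreal_mult[OF exp_ge_zero exp_ge_zero] ennreal_1)
    qed
  qed measurable
  also have "\<dots> \<le> ennreal (exp (- (\<mu> * u))) * (\<integral>\<^sup>+w. ennreal (exp (\<mu> * U w t)) * indicator (space N) w \<partial>N)"
    by (rule nn_integral_Markov_inequality) measurable
  also have "(\<integral>\<^sup>+w. ennreal (exp (\<mu> * U w t)) * indicator (space N) w \<partial>N) = (\<integral>\<^sup>+w. ennreal (exp (\<mu> * U w t)) \<partial>N)"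
    by (intro nn_integral_cong) simp
  also have "ennreal (exp (- (\<mu> * u))) * (\<integral>\<^sup>+w. ennreal (exp (\<mu> * U w t)) \<partial>N)
      \<le> ennreal (exp (- (\<mu> * u))) * ennreal (exp (1 / 100))"
    by (intro mult_left_mono order_trans[OF U_mgf[OF \<mu>0 \<mu>1 t]] ennreal_leI) (use var in auto)
  also have "\<dots> = ennreal (exp (1 / 100 - 7 / 5 * L))"
    unfolding \<mu>u ennreal_mult[OF exp_ge_zero exp_ge_zero, symmetric] exp_add[symmetric] uminus_add_conv_diff ..
  finally show ?thesis by (simp add: emeasure_eq_measure u_def)
qed

text \<open>Conditionally on the past this is concentration on the sphere at a fixed point.\<close>

lemma F_tail:
  assumes t: "t \<in> {1..T}"
  shows "measure N {w \<in> space N. 2 * \<delta> * M (X w t) * s0 < \<bar>F (X w t) (w t)\<bar>} \<le> 2 * exp (- L\<^sup>2)"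
proof -
  interpret prob_space N by (rule prob_space_noise)
  interpret Q: prob_space "unif_sphere :: 'a measure" by (rule prob_space_unif_sphere)
  have [measurable]: "(\<lambda>w. X w t) \<in> N \<rightarrow>\<^sub>M borel" by (rule X_measurable) (use t in simp)
  have [measurable]: "(\<lambda>w. w t) \<in> N \<rightarrow>\<^sub>M (borel :: 'a measure)" by (rule component_measurable[OF t])
  let ?\<phi> = "\<lambda>w y. indicator {(x, y). 2 * \<delta> * M x * s0 < \<bar>F x y\<bar>} (X w t, y) :: ennreal"
  have "emeasure N {w \<in> space N. 2 * \<delta> * M (X w t) * s0 < \<bar>F (X w t) (w t)\<bar>}
      = (\<integral>\<^sup>+w. indicator {w \<in> space N. 2 * \<delta> * M (X w t) * s0 < \<bar>F (X w t) (w t)\<bar>} w \<partial>N)"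
    by (rule nn_integral_indicator[symmetric]) measurable
  also have "\<dots> = (\<integral>\<^sup>+w. ?\<phi> w (w t) \<partial>N)" by (intro nn_integral_cong) (simp add: indicator_def)
  also have "\<dots> = (\<integral>\<^sup>+w. \<integral>\<^sup>+y. ?\<phi> w y \<partial>unif_sphere \<partial>N)"
  proof (rule nn_integral_noise_coordinate[OF t])
    show "?\<phi> (w(t := z)) y = ?\<phi> w y" for w z y by (simp only: X_upd[OF order_refl])
    show "case_prod ?\<phi> \<in> borel_measurable (N \<Otimes>\<^sub>M unif_sphere)"
      unfolding case_prod_unfold indicator_def by measurable
  qed
  also have "\<dots> \<le> (\<integral>\<^sup>+w. ennreal (2 * exp (- L\<^sup>2)) \<partial>N)"
  proof (rule nn_integral_mono)
    fix w
    have "(\<integral>\<^sup>+y. ?\<phi> w y \<partial>unif_sphere) = (\<integral>\<^sup>+y. indicator {y. 2 * \<delta> * M (X w t) * s0 < \<bar>F (X w t) y\<bar>} y \<partial>unif_sphere)"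
      by (intro nn_integral_cong) (simp add: indicator_def)
    also have "\<dots> = emeasure unif_sphere {y. 2 * \<delta> * M (X w t) * s0 < \<bar>F (X w t) y\<bar>}"
      by (rule nn_integral_indicator) measurable
    also have "\<dots> = ennreal (measure unif_sphere {y. 2 * \<delta> * M (X w t) * s0 < \<bar>F (X w t) y\<bar>})"
      by (rule Q.emeasure_eq_measure)
    also have "\<dots> \<le> ennreal (2 * exp (- L\<^sup>2))"
    proof (rule ennreal_leI)
      have "measure unif_sphere {y. \<bar>f (X w t + \<delta> *\<^sub>R y) - f (X w t - \<delta> *\<^sub>R y)\<bar> > 2 * \<delta> * M (X w t) * s0}
          \<le> 2 * exp (- real DIM('a) * s0\<^sup>2 / 2)"
        using L_pos by (intro unif_sphere_concentration cont \<delta>_pos M_le f_lip) (auto simp: s0_def)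
      also have "- real DIM('a) * s0\<^sup>2 / 2 = - L\<^sup>2" using d_ge by (simp add: s0_def power_divide power_mult_distrib)
      finally show "measure unif_sphere {y. 2 * \<delta> * M (X w t) * s0 < \<bar>F (X w t) y\<bar>} \<le> 2 * exp (- L\<^sup>2)" by (simp add: F_def)
    qed
    finally show "(\<integral>\<^sup>+y. ?\<phi> w y \<partial>unif_sphere) \<le> ennreal (2 * exp (- L\<^sup>2))" .
  qed
  also have "\<dots> = ennreal (2 * exp (- L\<^sup>2))" by (simp add: emeasure_space_1)
  finally show ?thesis by (simp add: emeasure_eq_measure)
qed

lemma norm_tail:
  assumes t: "t \<in> {1..T}"
  shows "measure N {w \<in> space N. 1 < norm (w t)} = 0"
proof -
  interpret prob_space N by (rule prob_space_noise)
  have [measurable]: "(\<lambda>w. w t) \<in> N \<rightarrow>\<^sub>M (borel :: 'a measure)" by (rule component_measurable[OF t])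
  let ?\<phi> = "\<lambda>(w :: nat \<Rightarrow> 'a) (y :: 'a). indicator {y. 1 < norm y} y :: ennreal"
  have "emeasure N {w \<in> space N. 1 < norm (w t)} = (\<integral>\<^sup>+w. indicator {w \<in> space N. 1 < norm (w t)} w \<partial>N)"
    by (rule nn_integral_indicator[symmetric]) measurable
  also have "\<dots> = (\<integral>\<^sup>+w. ?\<phi> w (w t) \<partial>N)" by (intro nn_integral_cong) (simp add: indicator_def)
  also have "\<dots> = (\<integral>\<^sup>+w. \<integral>\<^sup>+y. ?\<phi> w y \<partial>unif_sphere \<partial>N)"
    by (rule nn_integral_noise_coordinate[OF t, where \<phi>="?\<phi>"]) (auto simp: case_prod_unfold)
  also have "(\<integral>\<^sup>+y. indicator {y :: 'a. 1 < norm y} y \<partial>unif_sphere) = (\<integral>\<^sup>+(y :: 'a). 0 \<partial>unif_sphere)"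
    by (rule nn_integral_cong_AE) (use AE_unif_sphere in \<open>auto elim!: eventually_mono simp: indicator_def\<close>)
  finally show ?thesis by (simp add: emeasure_eq_measure)
qed

definition "good w \<longleftrightarrow> (\<forall>t\<in>{1..T}. norm (w t) \<le> 1 \<and> \<bar>F (X w t) (w t)\<bar> \<le> 2 * \<delta> * M (X w t) * s0
  \<and> U w t \<le> \<Delta> * L * sqrt (real T) / 2)"

text \<open>A union bound over the iterations.\<close>

lemma prob_good:
  assumes T2: "T \<ge> 2"
  shows "{w \<in> space N. good w} \<in> sets N" and "measure N {w \<in> space N. good w} \<ge> 1 - p"
proof -
  interpret prob_space N by (rule prob_space_noise)
  define B0 where "B0 t = {w \<in> space N. 1 < norm (w t)}" for t
  define B1 where "B1 t = {w \<in> space N. 2 * \<delta> * M (X w t) * s0 < \<bar>F (X w t) (w t)\<bar>}" for t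
  define B2 where "B2 t = {w \<in> space N. \<Delta> * L * sqrt (real T) / 2 < U w t}" for t
  have sets: "B0 t \<in> sets N" "B1 t \<in> sets N" "B2 t \<in> sets N" if t: "t \<in> {1..T}" for t
  proof -
    have [measurable]: "(\<lambda>w. X w t) \<in> N \<rightarrow>\<^sub>M borel" by (rule X_measurable) (use t in simp)
    have [measurable]: "(\<lambda>w. w t) \<in> N \<rightarrow>\<^sub>M (borel :: 'a measure)" by (rule component_measurable[OF t])
    have [measurable]: "(\<lambda>w. U w t) \<in> N \<rightarrow>\<^sub>M borel" by (rule U_measurable) (use t in simp)
    show "B0 t \<in> sets N" "B1 t \<in> sets N" "B2 t \<in> sets N" unfolding B0_def B1_def B2_def by measurable
  qed
  define B where "B = (\<Union>t\<in>{1..T}. B0 t \<union> B1 t \<union> B2 t)"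
  have B: "B \<in> sets N" unfolding B_def using sets by (intro sets.finite_UN) auto
  have good: "{w \<in> space N. good w} = space N - B"
    by (auto simp: good_def B_def B0_def B1_def B2_def not_less not_le)
  show "{w \<in> space N. good w} \<in> sets N" unfolding good using B by auto
  have "measure N B \<le> (\<Sum>t\<in>{1..T}. measure N (B0 t \<union> B1 t \<union> B2 t))"
    unfolding B_def using sets by (intro finite_measure_subadditive_finite) auto
  also have "\<dots> \<le> (\<Sum>t\<in>{1..T}. 2 * exp (- L))"
  proof (rule sum_mono)
    fix t assume t: "t \<in> {1..T}"
    have "measure N (B0 t \<union> B1 t \<union> B2 t) \<le> measure N (B0 t \<union> B1 t) + measure N (B2 t)"
      using sets[OF t] by (intro measure_Un_le) auto
    also have "measure N (B0 t \<union> B1 t) \<le> measure N (B0 t) + measure N (B1 t)"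
      using sets[OF t] by (intro measure_Un_le) auto
    also have "measure N (B0 t) = 0" unfolding B0_def by (rule norm_tail[OF t])
    also have "measure N (B1 t) \<le> 2 * exp (- L\<^sup>2)" unfolding B1_def by (rule F_tail[OF t])
    also have "measure N (B2 t) \<le> exp (1 / 100 - 7 / 5 * L)" unfolding B2_def by (rule U_tail[OF T2]) (use t in simp)
    finally show "measure N (B0 t \<union> B1 t \<union> B2 t) \<le> 2 * exp (- L)" using failure_budget[OF L_ge[OF T2]] by simp
  qed
  also have "\<dots> = p"
  proof -
    have "exp (- L) = p / (2 * real T)" using p_pos T_ge by (simp add: L_def exp_minus)
    then show ?thesis using T_ge by simp
  qed
  finally have "measure N B \<le> p" .
  then show "measure N {w \<in> space N. good w} \<ge> 1 - p" unfolding good using prob_compl[OF B] by simp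
qed

lemma good_descent:
  assumes T2: "T \<ge> 2" and good: "good w" and t: "t \<le> T"
  shows "S (X w (Suc t)) + (\<Sum>s=1..t. \<eta> (X w s) * (norm (G (X w s)))\<^sup>2)
    \<le> S x1 + U w t / (L * sqrt (real T)) + real t * (\<Delta> / (2 * L\<^sup>2 * real T))"
  using t
proof (induction t)
  case 0
  show ?case by (simp add: U_def)
next
  case (Suc t)
  define x where "x = X w (Suc t)"
  have w: "norm (w (Suc t)) \<le> 1" "\<bar>f (x + \<delta> *\<^sub>R w (Suc t)) - f (x - \<delta> *\<^sub>R w (Suc t))\<bar> \<le> 2 * \<delta> * M x * s0"
    using good Suc.prems by (auto simp: good_def F_def x_def simp del: rsgf_iter.simps)
  have X: "X w (Suc (Suc t)) = x - \<eta> x *\<^sub>R grad_est f \<delta> x (w (Suc t))" unfolding x_def by (rule X_Suc) simp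
  have U: "U w (Suc t) = U w t + Z x (w (Suc t))" by (simp add: U_def x_def del: rsgf_iter.simps)
  have sum: "(\<Sum>s=1..Suc t. \<eta> (X w s) * (norm (G (X w s)))\<^sup>2) = (\<Sum>s=1..t. \<eta> (X w s) * (norm (G (X w s)))\<^sup>2) + \<eta> x * (norm (G x))\<^sup>2"
    by (simp add: x_def del: rsgf_iter.simps)
  have IH: "S x + (\<Sum>s=1..t. \<eta> (X w s) * (norm (G (X w s)))\<^sup>2)
      \<le> S x1 + U w t / (L * sqrt (real T)) + real t * (\<Delta> / (2 * L\<^sup>2 * real T))"
    using Suc unfolding x_def by simp
  define v where "v = \<Delta> / (2 * L\<^sup>2 * real T)"
  have "real (Suc t) * v = real t * v + v" by (simp add: distrib_right)
  then show ?case unfolding X U sum add_divide_distrib using IH descent_step[OF T2 w]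
    unfolding v_def[symmetric] by linarith
qed

lemma good_bounds:
  assumes T2: "T \<ge> 2" and good: "good w"
  shows "t \<in> {1..T} \<Longrightarrow> S (X w t) - fstar \<le> 2 * \<Delta>"
    and "(\<Sum>s=1..T. \<eta> (X w s) * (norm (G (X w s)))\<^sup>2) \<le> 2 * \<Delta>"
proof -
  have main: "S (X w (Suc t)) + (\<Sum>s=1..t. \<eta> (X w s) * (norm (G (X w s)))\<^sup>2) \<le> fstar + 2 * \<Delta>" if t: "t \<le> T" for t
  proof -
    have L: "L > 1" using L_ge[OF T2] by simp
    have "U w t \<le> \<Delta> * L * sqrt (real T) / 2"
    proof (cases "t = 0")
      case True
      then show ?thesis using \<Delta>_pos L by (simp add: U_def)
    next
      case False
      then show ?thesis using good t by (simp add: good_def)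
    qed
    then have "U w t / (L * sqrt (real T)) \<le> \<Delta> / 2"
      using L T_sqrt by (simp add: pos_divide_le_eq mult_ac)
    moreover have "real t * (\<Delta> / (2 * L\<^sup>2 * real T)) \<le> \<Delta> / 2"
    proof -
      have "real t * (\<Delta> / (2 * L\<^sup>2 * real T)) = (real t / real T) * (1 / L\<^sup>2) * (\<Delta> / 2)" by simp
      also have "\<dots> \<le> 1 * 1 * (\<Delta> / 2)"
        using t T_ge \<Delta>_pos L by (intro mult_mono) (auto simp: power_le_one_iff one_le_power)
      finally show ?thesis by simp
    qed
    ultimately show ?thesis using good_descent[OF T2 good t] \<Delta> by linarith
  qed
  have nonneg: "0 \<le> (\<Sum>s=1..t. \<eta> (X w s) * (norm (G (X w s)))\<^sup>2)" for t
    using eta_pos by (intro sum_nonneg mult_nonneg_nonneg) (auto simp: less_imp_le)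
  show "S (X w t) - fstar \<le> 2 * \<Delta>" if "t \<in> {1..T}"
  proof -
    have "Suc (t - 1) = t" "t - 1 \<le> T" using that by auto
    then show ?thesis using main[OF \<open>t - 1 \<le> T\<close>] nonneg[of "t - 1"] by (simp only:)
  qed
  show "(\<Sum>s=1..T. \<eta> (X w s) * (norm (G (X w s)))\<^sup>2) \<le> 2 * \<Delta>"
    using main[of T] S_ge[of "X w (Suc T)"] by (simp del: rsgf_iter.simps)
qed

definition "conclusion w \<longleftrightarrow> (\<forall>t\<in>{1..T}. S (X w t) - fstar \<le> 2 * \<Delta>) \<and>
  (\<Sum>t=1..T. \<eta> (X w t) / (\<Sum>s=1..T. \<eta> (X w s)) * (norm (G (X w t)))\<^sup>2)
    \<le> 2 * \<Delta> * ln (2 * real T / p) / ((\<Sum>t=1..T. C (X w t)) / real T * sqrt (real T))"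

lemma good_conclusion:
  assumes T2: "T \<ge> 2" and good: "good w"
  shows "conclusion w"
proof -
  define E where "E = (\<Sum>s=1..T. \<eta> (X w s))"
  define K where "K = (\<Sum>s=1..T. C (X w s))"
  have K: "K > 0" unfolding K_def using C_pos T_ge by (intro sum_pos) auto
  have E: "E = K / (L * sqrt (real T))" unfolding E_def K_def eta_eq by (simp add: sum_divide_distrib)
  have L0: "L > 0" using L_pos by simp
  have E0: "E > 0" using K L0 T_sqrt by (simp add: E)
  have "(\<Sum>t=1..T. \<eta> (X w t) / E * (norm (G (X w t)))\<^sup>2) = (\<Sum>t=1..T. \<eta> (X w t) * (norm (G (X w t)))\<^sup>2) / E"
    by (simp add: sum_divide_distrib)
  also have "\<dots> \<le> 2 * \<Delta> / E" using good_bounds(2)[OF T2 good] E0 by (intro divide_right_mono) auto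
  also have "\<dots> = 2 * \<Delta> * L / (K / real T * sqrt (real T))"
  proof -
    have "sqrt (real T) * sqrt (real T) = real T" by simp
    then have "K / real T * sqrt (real T) = K / sqrt (real T)" using T_sqrt T_ge
      by (simp add: field_simps)
    then show ?thesis using K L0 T_sqrt by (simp add: E)
  qed
  finally show ?thesis using good_bounds(1)[OF T2 good] unfolding conclusion_def E_def K_def L_def by blast
qed

text \<open>Only the starting point is involved, and the gradient there is bounded by \<open>M x1\<close>.\<close>

lemma T1_conclusion:
  assumes T1: "T = 1"
  shows "conclusion w"
proof -
  have X1: "X w 1 = x1" by simp
  have "(norm (G x1))\<^sup>2 \<le> (m x1 + 1)\<^sup>2" using G_norm[of x1] M_le[of x1] by (intro power_mono) auto
  also have "\<dots> \<le> 2 * L * (2 * (real DIM('a) + 1)) * (m x1 + 1)\<^sup>2"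
  proof -
    have "1 * 1 \<le> (2 * L) * (2 * (real DIM('a) + 1))" using L_pos d_ge by (intro mult_mono) auto
    from mult_right_mono[OF this, of "(m x1 + 1)\<^sup>2"] show ?thesis by simp
  qed
  also have "\<dots> \<le> 2 * \<Delta> * L / C x1"
  proof -
    have "C x1 \<le> \<Delta> / (2 * (real DIM('a) + 1) * (m x1 + 1)\<^sup>2)" unfolding m_def by (rule rsgf_C_le(1))
    moreover have "0 < 2 * (real DIM('a) + 1) * (m x1 + 1)\<^sup>2" using M_le[of x1] d_ge by (intro mult_pos_pos zero_less_power) auto
    ultimately have "C x1 * (2 * (real DIM('a) + 1) * (m x1 + 1)\<^sup>2) \<le> \<Delta>" by (simp add: pos_le_divide_eq)
    then have "2 * L * (C x1 * (2 * (real DIM('a) + 1) * (m x1 + 1)\<^sup>2)) \<le> 2 * L * \<Delta>" using L_pos by (intro mult_left_mono) auto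
    then show ?thesis using C_pos[of x1] by (simp add: pos_le_divide_eq mult_ac)
  qed
  finally have bound: "(norm (G x1))\<^sup>2 \<le> 2 * \<Delta> * L / C x1" .
  have set1: "{1..T} = {1}" and rT: "real T = 1" using T1 by auto
  have A: "(\<Sum>t=1..T. \<eta> (X w t) / (\<Sum>s=1..T. \<eta> (X w s)) * (norm (G (X w t)))\<^sup>2) = (norm (G x1))\<^sup>2"
    using eta_pos[of x1] unfolding set1 by simp
  have B: "(\<Sum>t=1..T. C (X w t)) / real T * sqrt (real T) = C x1" unfolding set1 rT by simp
  have "\<forall>t\<in>{1..T}. S (X w t) - fstar \<le> 2 * \<Delta>" unfolding set1 using \<Delta> \<Delta>_pos by simp
  then show ?thesis unfolding conclusion_def L_def[symmetric] A B using bound by (rule conjI)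
qed

lemma conclusion_measurable: "{w \<in> space N. conclusion w} \<in> sets N"
proof -
  have X [measurable]: "(\<lambda>w. X w t) \<in> N \<rightarrow>\<^sub>M borel" if "t \<in> {1..T}" for t
    by (rule X_measurable) (use that in simp)
  have [measurable]: "(\<lambda>w. \<Sum>s=1..T. \<eta> (X w s)) \<in> borel_measurable N" "(\<lambda>w. \<Sum>s=1..T. C (X w s)) \<in> borel_measurable N"
    by (intro borel_measurable_sum measurable_compose[OF X eta_measurable] measurable_compose[OF X C_measurable]; simp)+
  have SX [measurable]: "(\<lambda>w. S (X w t)) \<in> borel_measurable N" if "t \<in> {1..T}" for t
    by (rule measurable_compose[OF X[OF that] S_measurable])
  have [measurable]: "(\<lambda>w. \<Sum>t=1..T. \<eta> (X w t) / (\<Sum>s=1..T. \<eta> (X w s)) * (norm (G (X w t)))\<^sup>2) \<in> borel_measurable N"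
  proof (rule borel_measurable_sum)
    fix t assume "t \<in> {1..T}"
    note [measurable] = X[OF this]
    show "(\<lambda>w. \<eta> (X w t) / (\<Sum>s=1..T. \<eta> (X w s)) * (norm (G (X w t)))\<^sup>2) \<in> borel_measurable N" by measurable
  qed
  have "{w \<in> space N. conclusion w} = (\<Inter>t\<in>{1..T}. {w \<in> space N. S (X w t) - fstar \<le> 2 * \<Delta>}) \<inter>
    {w \<in> space N. (\<Sum>t=1..T. \<eta> (X w t) / (\<Sum>s=1..T. \<eta> (X w s)) * (norm (G (X w t)))\<^sup>2)
      \<le> 2 * \<Delta> * ln (2 * real T / p) / ((\<Sum>t=1..T. C (X w t)) / real T * sqrt (real T))}"
    using T_ge by (auto simp: conclusion_def)
  also have "\<dots> \<in> sets N"
  proof (rule sets.Int)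
    show "(\<Inter>t\<in>{1..T}. {w \<in> space N. S (X w t) - fstar \<le> 2 * \<Delta>}) \<in> sets N"
    proof (rule sets.finite_INT)
      fix t assume "t \<in> {1..T}"
      note [measurable] = SX[OF this]
      show "{w \<in> space N. S (X w t) - fstar \<le> 2 * \<Delta>} \<in> sets N" by measurable
    qed (use T_ge in auto)
  qed measurable
  finally show ?thesis .
qed

theorem prob_conclusion: "measure N {w \<in> space N. conclusion w} \<ge> 1 - p"
proof -
  interpret prob_space N by (rule prob_space_noise)
  show ?thesis
  proof (cases "T \<ge> 2")
    case True
    have "measure N {w \<in> space N. good w} \<le> measure N {w \<in> space N. conclusion w}"
      using good_conclusion[OF True] by (intro finite_measure_mono conclusion_measurable) auto
    then show ?thesis using prob_good(2)[OF True] by simp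
  next
    case False
    then have "T = 1" using T_ge by simp
    then have "{w \<in> space N. conclusion w} = space N" using T1_conclusion by auto
    then show ?thesis using p_pos by (simp add: prob_space)
  qed
qed

end

section \<open>Complexity\<close>

text \<open>The logarithm of \<open>y\<close> is at most four times the fourth root of \<open>y\<close>.\<close>

lemma ln_linear_le_sqrt:
  fixes a K :: real
  assumes a: "a > 0" and K: "K > 0"
  obtains n :: nat where "n \<ge> 1" "K * ln (a * real n) \<le> sqrt (real n)"
proof -
  define q where "q = 4 * K * sqrt (sqrt a)"
  obtain n :: nat where n: "max 1 (q ^ 4) \<le> real n" using real_arch_simple by blast
  have n1: "n \<ge> 1" using n by simp
  have q: "q > 0" using a K by (simp add: q_def)
  have "q \<le> sqrt (sqrt (real n))"
  proof (rule real_le_rsqrt, rule real_le_rsqrt)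
    show "(q\<^sup>2)\<^sup>2 \<le> real n" using n by (simp flip: power_mult)
  qed
  have an: "a * real n > 0" using a n1 by simp
  have "ln (a * real n) = 4 * ln (sqrt (sqrt (a * real n)))" using an by (simp add: ln_sqrt)
  also have "\<dots> \<le> 4 * sqrt (sqrt (a * real n))"
    using an ln_le_minus_one[of "sqrt (sqrt (a * real n))"] by simp
  also have "\<dots> = 4 * sqrt (sqrt a) * sqrt (sqrt (real n))" by (simp add: real_sqrt_mult)
  finally have "K * ln (a * real n) \<le> K * (4 * sqrt (sqrt a) * sqrt (sqrt (real n)))" using K by (intro mult_left_mono) auto
  also have "\<dots> = q * sqrt (sqrt (real n))" by (simp add: q_def mult_ac)
  also have "\<dots> \<le> sqrt (sqrt (real n)) * sqrt (sqrt (real n))"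
    using \<open>q \<le> sqrt (sqrt (real n))\<close> by (intro mult_right_mono) auto
  also have "\<dots> = sqrt (real n)" by simp
  finally show thesis using that n1 by blast
qed

lemma rsgf_C_const_indep:
  "rsgf_C c d (\<lambda>_. A) (\<lambda>_ _. B) \<delta> \<Delta> T (0::real) = rsgf_C c d (\<lambda>_. A) (\<lambda>_ _. B) \<delta> \<Delta> 1 (0::real)"
  by (simp add: rsgf_C_def rsgf_ell_def)

lemma rsgf_C_const_pos:
  assumes "\<Delta> > 0" "A \<ge> 0" "B \<ge> 0" "c > 0" "\<delta> > 0" "d \<ge> 1"
  shows "rsgf_C c d (\<lambda>_. A) (\<lambda>_ _. B) \<delta> \<Delta> T (0::real) > 0"
  by (rule rsgf_C_pos) (use assms in auto)

lemma rsgf_T_exists: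
  assumes \<Delta>: "\<Delta> > 0" and AB: "A \<ge> 0" "B \<ge> 0" and c: "c > 0" and \<delta>: "\<delta> > 0" and d: "d \<ge> 1"
    and \<epsilon>: "\<epsilon> > 0" and p: "0 < p"
  defines "T \<equiv> rsgf_T c \<Delta> A B d \<delta> \<epsilon> p"
  shows "T \<ge> 1"
    and "2 * \<Delta> * ln (2 * real T / p) / (rsgf_C c d (\<lambda>_. A) (\<lambda>_ _. B) \<delta> \<Delta> T (0::real) * sqrt (real T)) \<le> \<epsilon>\<^sup>2"
proof -
  define C where "C = rsgf_C c d (\<lambda>_. A) (\<lambda>_ _. B) \<delta> \<Delta> 1 (0::real)"
  have C: "C > 0" unfolding C_def by (rule rsgf_C_const_pos) (use assms in auto)
  have "2 * \<Delta> / (C * \<epsilon>\<^sup>2) > 0" using \<Delta> C \<epsilon> by simp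
  then obtain n :: nat where n: "n \<ge> 1" "2 * \<Delta> / (C * \<epsilon>\<^sup>2) * ln (2 / p * real n) \<le> sqrt (real n)"
    using ln_linear_le_sqrt[of "2 / p" "2 * \<Delta> / (C * \<epsilon>\<^sup>2)"] p by auto
  have "2 * \<Delta> * ln (2 * real n / p) \<le> \<epsilon>\<^sup>2 * (C * sqrt (real n))"
    using n(2) C \<epsilon> by (simp add: divide_le_eq mult_ac)
  then have "2 * \<Delta> * ln (2 * real n / p) / (C * sqrt (real n)) \<le> \<epsilon>\<^sup>2"
    using C n(1) by (simp add: pos_divide_le_eq)
  then have ex: "n \<ge> 1 \<and> 2 * \<Delta> * ln (2 * real n / p) / (rsgf_C c d (\<lambda>_. A) (\<lambda>_ _. B) \<delta> \<Delta> n (0::real) * sqrt (real n)) \<le> \<epsilon>\<^sup>2"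
    unfolding rsgf_C_const_indep[where T=n] C_def[symmetric] using n by blast
  from LeastI[of "\<lambda>T. T \<ge> 1 \<and> 2 * \<Delta> * ln (2 * real T / p) / (rsgf_C c d (\<lambda>_. A) (\<lambda>_ _. B) \<delta> \<Delta> T (0::real) * sqrt (real T)) \<le> \<epsilon>\<^sup>2", OF ex]
  show "T \<ge> 1"
    and "2 * \<Delta> * ln (2 * real T / p) / (rsgf_C c d (\<lambda>_. A) (\<lambda>_ _. B) \<delta> \<Delta> T (0::real) * sqrt (real T)) \<le> \<epsilon>\<^sup>2"
    unfolding T_def rsgf_T_def by auto
qed

lemma rsgf_T_le:
  assumes "n \<ge> 1" "2 * \<Delta> * ln (2 * real n / p) / (rsgf_C c d (\<lambda>_. A) (\<lambda>_ _. B) \<delta> \<Delta> n (0::real) * sqrt (real n)) \<le> \<epsilon>\<^sup>2"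
  shows "rsgf_T c \<Delta> A B d \<delta> \<epsilon> p \<le> n"
  unfolding rsgf_T_def by (rule Least_le) (use assms in blast)

lemma powr_le_of_le_one:
  fixes d :: real
  assumes "d \<ge> 1" "0 < \<delta>" "\<delta> \<le> 1" "a \<le> 5 / 4"
  shows "\<delta> powr (1 / 2) * d powr (- 5 / 4) \<le> d powr (- a)"
proof -
  have "\<delta> powr (1 / 2) * d powr (- 5 / 4) \<le> 1 * d powr (- a)"
    using assms by (intro mult_mono powr_mono powr_le1) auto
  then show ?thesis by simp
qed

text \<open>Of the three terms in the step size the last one is the smallest in the regime of large
  dimension and small \<open>\<delta>\<close>; it determines the rate.\<close>

lemma rsgf_C_const_ge:
  assumes \<Delta>: "\<Delta> > 0" and AB: "A \<ge> 0" "B \<ge> 0" and c: "c > 0"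
  obtains \<kappa> where "\<kappa> > 0" "\<And>d \<delta> T. d \<ge> 1 \<Longrightarrow> 0 < \<delta> \<Longrightarrow> \<delta> \<le> 1 \<Longrightarrow>
    \<kappa> * (\<delta> powr (1 / 2) * real d powr (- 5 / 4)) \<le> rsgf_C c d (\<lambda>_. A) (\<lambda>_ _. B) \<delta> \<Delta> T (0::real)"
proof -
  define m where "m = A + B"
  have m: "m \<ge> 0" using AB by (simp add: m_def)
  define k where "k = sqrt (16 * sqrt (2 * pi))"
  have k: "k > 0" by (simp add: k_def)
  define \<kappa>1 where "\<kappa>1 = \<Delta> / (4 * (m + 1)\<^sup>2)"
  define \<kappa>2 where "\<kappa>2 = (if m = 0 then 1 else sqrt 6 / 12 * (\<Delta> / (k * m\<^sup>2)))"
  define \<kappa>3 where "\<kappa>3 = (if m = 0 then 1 else sqrt (\<Delta> / (c * m)) / m)"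
  define \<kappa> where "\<kappa> = min \<kappa>1 (min \<kappa>2 \<kappa>3)"
  have \<kappa>: "\<kappa>1 > 0" "\<kappa>2 > 0" "\<kappa>3 > 0" using \<Delta> m k c by (auto simp: \<kappa>1_def \<kappa>2_def \<kappa>3_def less_le)
  have le: "\<kappa> * (\<delta> powr (1 / 2) * real d powr (- 5 / 4)) \<le> rsgf_C c d (\<lambda>_. A) (\<lambda>_ _. B) \<delta> \<Delta> T (0::real)"
    if d: "d \<ge> 1" and \<delta>: "0 < \<delta>" "\<delta> \<le> 1" for d \<delta> T
  proof -
    define P where "P = \<delta> powr (1 / 2) * real d powr (- 5 / 4)"
    have P: "P \<ge> 0" by (simp add: P_def)
    have d1: "real d \<ge> 1" using d by simp
    have P1: "P \<le> 1 / real d"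
      using powr_le_of_le_one[OF d1 \<delta>, of 1] d1 by (simp add: P_def powr_minus_divide)
    have P2: "P \<le> 1 / sqrt (real d)"
      using powr_le_of_le_one[OF d1 \<delta>, of "1 / 2"] d1 by (simp add: P_def powr_minus_divide powr_half_sqrt)
    have P3: "P = sqrt \<delta> / (real d * sqrt (sqrt (real d)))"
    proof -
      have "real d powr (- 5 / 4) = real d powr (- 1 + - 1 / 4)" by simp
      also have "\<dots> = real d powr (- 1) * real d powr (- 1 / 4)" by (rule powr_add)
      also have "\<dots> = 1 / real d * (1 / real d powr (1 / 4))" using d1 by (simp add: powr_minus_divide)
      also have "real d powr (1 / 4) = (real d powr (1 / 2)) powr (1 / 2)" by (simp add: powr_powr)
      also have "\<dots> = sqrt (sqrt (real d))" using d1 by (simp add: powr_half_sqrt)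
      finally show ?thesis using \<delta> by (simp add: P_def powr_half_sqrt)
    qed
    have "\<kappa> * P \<le> rsgf_C c d (\<lambda>_. A) (\<lambda>_ _. B) \<delta> \<Delta> T (0::real)"
    proof (rule rsgf_C_ge)
      have "\<kappa> * P \<le> \<kappa>1 * (1 / real d)" using P1 P \<kappa> by (intro mult_mono) (auto simp: \<kappa>_def)
      also have "\<dots> = \<Delta> / (2 * (2 * real d) * (m + 1)\<^sup>2)" by (simp add: \<kappa>1_def)
      also have "\<dots> \<le> \<Delta> / (2 * (real d + 1) * (m + 1)\<^sup>2)"
        using \<Delta> m d1 by (intro divide_left_mono mult_right_mono mult_pos_pos) auto
      finally show "\<kappa> * P \<le> \<Delta> / (2 * (real d + 1) * (A + B + 1)\<^sup>2)" by (simp add: m_def)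
    next
      assume nz: "rsgf_sigma d (\<lambda>_. A) (\<lambda>_ _. B) \<delta> (0::real) * (A + B) \<noteq> 0"
      then have m0: "m > 0" using m by (auto simp: m_def less_le)
      have s: "rsgf_sigma d (\<lambda>_. A) (\<lambda>_ _. B) \<delta> (0::real) * (A + B) = k * sqrt (real d) * m\<^sup>2"
        using m by (simp add: rsgf_sigma_def real_sqrt_mult k_def m_def power2_eq_square)
      have "\<kappa> * P \<le> \<kappa>2 * (1 / sqrt (real d))" using P2 P \<kappa> by (intro mult_mono) (auto simp: \<kappa>_def)
      also have "\<dots> = sqrt 6 / 12 * (\<Delta> / (rsgf_sigma d (\<lambda>_. A) (\<lambda>_ _. B) \<delta> (0::real) * (A + B)))"
        unfolding s using m0 by (simp add: \<kappa>2_def mult_ac)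
      finally show "\<kappa> * P \<le> sqrt 6 / 12 * (\<Delta> / (rsgf_sigma d (\<lambda>_. A) (\<lambda>_ _. B) \<delta> (0::real) * (A + B)))" .
    next
      define l where "l = rsgf_ell c d (\<lambda>_. A) (\<lambda>_ _. B) \<delta> (0::real) (\<Delta> / (real d * (A + B + 1) * sqrt (real T)))"
      assume "A + B \<noteq> 0"
      then have m0: "m > 0" using m by (auto simp: m_def less_le)
      have "2 * A + B + B = 2 * m" by (simp add: m_def)
      then have l: "l = c * m * sqrt (real d) / \<delta>" by (simp add: l_def rsgf_ell_def mult_ac)
      have "\<Delta> / l = \<Delta> / (c * m) * \<delta> / sqrt (real d)" by (simp add: l mult_ac)
      then have sq: "sqrt (\<Delta> / l) = sqrt (\<Delta> / (c * m)) * sqrt \<delta> / sqrt (sqrt (real d))"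
        by (simp only: real_sqrt_mult real_sqrt_divide)
      have "\<kappa> * P \<le> \<kappa>3 * P" using P by (intro mult_right_mono) (auto simp: \<kappa>_def)
      also have "\<dots> = 1 / (real d * m) * sqrt (\<Delta> / l)"
        unfolding P3 sq using m0 by (simp add: \<kappa>3_def mult_ac)
      finally show "\<kappa> * P \<le> 1 / (real d * (A + B)) * sqrt (\<Delta> / rsgf_ell c d (\<lambda>_. A) (\<lambda>_ _. B) \<delta> (0::real)
          (\<Delta> / (real d * (A + B + 1) * sqrt (real T))))" by (simp only: l_def m_def)
    qed
    then show ?thesis by (simp add: P_def)
  qed
  have "\<kappa> > 0" using \<kappa> by (simp add: \<kappa>_def)
  then show thesis using that le by blast
qed

lemma soft_O_mult:
  assumes "soft_O h g"
  shows "soft_O (\<lambda>d \<delta> \<epsilon> p. 2 * h d \<delta> \<epsilon> p) g"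
proof -
  obtain K m where K: "\<And>d \<delta> \<epsilon> p. d \<ge> 1 \<Longrightarrow> \<delta> \<in> {0<..1} \<Longrightarrow> \<epsilon> \<in> {0<..1} \<Longrightarrow> p \<in> {0<..<1} \<Longrightarrow>
      \<bar>h d \<delta> \<epsilon> p\<bar> \<le> K * (1 + ln (real d / (\<delta> * \<epsilon> * p))) ^ m * g d \<delta> \<epsilon>"
    using assms unfolding soft_O_def by metis
  show ?thesis unfolding soft_O_def
  proof (intro exI[of _ "2 * K"] exI[of _ m] allI ballI impI)
    fix d :: nat and \<delta> \<epsilon> p :: real assume "1 \<le> d" "\<delta> \<in> {0<..1}" "\<epsilon> \<in> {0<..1}" "p \<in> {0<..<1}"
    from K[OF this] show "\<bar>2 * h d \<delta> \<epsilon> p\<bar> \<le> 2 * K * (1 + ln (real d / (\<delta> * \<epsilon> * p))) ^ m * g d \<delta> \<epsilon>"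
      by (simp add: abs_mult)
  qed
qed

lemma soft_O_rsgf_T:
  assumes \<Delta>: "\<Delta> > 0" and AB: "A \<ge> 0" "B \<ge> 0" and c: "c > 0"
  shows "soft_O (\<lambda>d \<delta> \<epsilon> p. real (rsgf_T c \<Delta> A B d \<delta> \<epsilon> p))
    (\<lambda>d \<delta> \<epsilon>. real d powr (5 / 2) * \<delta> powr (- 1) * \<epsilon> powr (- 4))"
proof -
  obtain \<kappa> where \<kappa>: "\<kappa> > 0" "\<And>d \<delta> T. d \<ge> 1 \<Longrightarrow> 0 < \<delta> \<Longrightarrow> \<delta> \<le> 1 \<Longrightarrow>
      \<kappa> * (\<delta> powr (1 / 2) * real d powr (- 5 / 4)) \<le> rsgf_C c d (\<lambda>_. A) (\<lambda>_ _. B) \<delta> \<Delta> T (0::real)"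
    using rsgf_C_const_ge[OF \<Delta> AB c] by blast
  have "2 * \<Delta> / \<kappa> > 0" using \<Delta> \<kappa> by simp
  \<comment> \<open>The factor \<open>exp 6\<close> under the logarithm stands for the terms \<open>6 * Q\<close> below.\<close>
  then obtain H :: nat where H: "H \<ge> 1" "2 * \<Delta> / \<kappa> * ln (4 * exp 6 * real H) \<le> sqrt (real H)"
    using ln_linear_le_sqrt[of "4 * exp 6" "2 * \<Delta> / \<kappa>"] by auto
  have lnH: "ln (4 * exp 6 * real H) = ln (4 * real H) + 6" using H(1) by (simp add: ln_mult)
  have lnH0: "ln (4 * real H) \<ge> 0" using H(1) by simp
  show ?thesis unfolding soft_O_def
  proof (intro exI[of _ "2 * real H"] exI[of _ 2] allI ballI impI)
    fix d :: nat and \<delta> \<epsilon> p :: real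
    assume d: "1 \<le> d" and "\<delta> \<in> {0<..1}" "\<epsilon> \<in> {0<..1}" "p \<in> {0<..<1}"
    then have \<delta>: "0 < \<delta>" "\<delta> \<le> 1" and \<epsilon>: "0 < \<epsilon>" "\<epsilon> \<le> 1" and p: "0 < p" "p < 1" by auto
    have d1: "real d \<ge> 1" using d by simp
    define Q where "Q = 1 + ln (real d / (\<delta> * \<epsilon> * p))"
    define X where "X = real d powr (5 / 2) * \<delta> powr (- 1) * \<epsilon> powr (- 4)"
    have lnQ: "ln (real d / (\<delta> * \<epsilon> * p)) = ln (real d) - ln \<delta> - ln \<epsilon> - ln p"
      using d1 \<delta> \<epsilon> p by (simp add: ln_div ln_mult)
    have logs: "ln (real d) \<ge> 0" "ln \<delta> \<le> 0" "ln \<epsilon> \<le> 0" "ln p \<le> 0" using d1 \<delta> \<epsilon> p by auto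
    have Q: "Q \<ge> 1" using logs by (simp add: Q_def lnQ)
    have X0: "X > 0" using d1 \<delta> \<epsilon> by (simp add: X_def)
    have lnX: "ln X = 5 / 2 * ln (real d) - ln \<delta> - 4 * ln \<epsilon>"
    proof -
      have ln3: "ln (a * b * e) = ln a + ln b + ln e" if "a > 0" "b > 0" "e > 0" for a b e :: real
        using that by (simp add: ln_mult)
      have "ln X = ln (real d powr (5 / 2)) + ln (\<delta> powr (- 1)) + ln (\<epsilon> powr (- 4))"
        unfolding X_def by (rule ln3) (use d1 \<delta> \<epsilon> in auto)
      also have "\<dots> = 5 / 2 * ln (real d) + - 1 * ln \<delta> + - 4 * ln \<epsilon>"
        using d1 \<delta> \<epsilon> by (simp only: ln_powr)
      finally show ?thesis by simp
    qed
    have X1: "X \<ge> 1"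
    proof -
      have "ln X \<ge> 0" unfolding lnX using logs by simp
      then show ?thesis using X0 by (simp add: ln_ge_zero_iff)
    qed
    define R where "R = real H * Q\<^sup>2 * X"
    have R1: "R \<ge> 1"
    proof -
      have "1 * 1 * 1 \<le> real H * Q\<^sup>2 * X" using H(1) Q X1 by (intro mult_mono) (auto simp: one_le_power)
      then show ?thesis by (simp add: R_def)
    qed
    define T where "T = nat \<lceil>R\<rceil>"
    have T: "R \<le> real T" "real T \<le> 2 * R" "T \<ge> 1" using R1 unfolding T_def by linarith+
    have log_le: "ln (2 * real T / p) \<le> (ln (4 * real H) + 6) * Q"
    proof -
      have "ln (2 * real T / p) \<le> ln (4 * R / p)" using T p R1 by (simp add: divide_right_mono)
      also have "\<dots> = ln (4 * real H) + 2 * ln Q + ln X - ln p"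
        using H(1) Q X0 p by (simp add: R_def ln_div ln_mult ln_realpow)
      also have "\<dots> \<le> ln (4 * real H) * Q + 2 * Q + 4 * Q"
      proof -
        have "ln X - ln p \<le> 4 * (Q - 1)" unfolding lnX Q_def lnQ using logs by simp
        moreover have "ln Q \<le> Q" using ln_le_minus_one[of Q] Q by simp
        moreover have "ln (4 * real H) * 1 \<le> ln (4 * real H) * Q" using lnH0 Q by (intro mult_left_mono) auto
        ultimately show ?thesis by simp
      qed
      finally show ?thesis by (simp add: algebra_simps)
    qed
    define C where "C = rsgf_C c d (\<lambda>_. A) (\<lambda>_ _. B) \<delta> \<Delta> T (0::real)"
    have C: "\<kappa> * (\<delta> powr (1 / 2) * real d powr (- 5 / 4)) \<le> C" unfolding C_def by (rule \<kappa>(2)[OF d \<delta>])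
    \<comment> \<open>The square root of \<open>X\<close>; its first two factors cancel those in the lower bound for \<open>C\<close>.\<close>
    define x where "x = real d powr (5 / 4) * \<delta> powr (- 1 / 2) * \<epsilon> powr (- 2)"
    have x0: "x > 0" using d1 \<delta> \<epsilon> by (simp add: x_def)
    have xX: "x\<^sup>2 = X"
    proof -
      have "x\<^sup>2 = (real d powr (5 / 4) * real d powr (5 / 4)) * (\<delta> powr (- 1 / 2) * \<delta> powr (- 1 / 2)) * (\<epsilon> powr (- 2) * \<epsilon> powr (- 2))"
        by (simp only: x_def power2_eq_square mult_ac)
      then show ?thesis by (simp add: X_def flip: powr_add)
    qed
    have "\<kappa> * sqrt (real H) * Q * (1 / \<epsilon>\<^sup>2) = (\<kappa> * (\<delta> powr (1 / 2) * real d powr (- 5 / 4))) * (sqrt (real H) * Q * x)"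
    proof -
      have "(\<delta> powr (1 / 2) * real d powr (- 5 / 4)) * x
          = (\<delta> powr (1 / 2) * \<delta> powr (- 1 / 2)) * (real d powr (- 5 / 4) * real d powr (5 / 4)) * \<epsilon> powr (- 2)"
        by (simp only: x_def mult_ac)
      also have "\<dots> = \<epsilon> powr (- 2)" using d1 \<delta> by (simp flip: powr_add)
      also have "\<dots> = 1 / \<epsilon>\<^sup>2" using \<epsilon> by (simp add: powr_minus_divide)
      finally have "1 / \<epsilon>\<^sup>2 = (\<delta> powr (1 / 2) * real d powr (- 5 / 4)) * x" by simp
      then show ?thesis by (simp only: mult_ac)
    qed
    also have "\<dots> \<le> C * sqrt (real T)"
    proof (rule mult_mono[OF C])
      have "sqrt R = sqrt (real H) * Q * x"
        unfolding R_def xX[symmetric] using Q x0 by (simp add: real_sqrt_mult)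
      then show "sqrt (real H) * Q * x \<le> sqrt (real T)" using T(1) by (metis real_sqrt_le_iff)
      show "0 \<le> C" unfolding C_def by (rule less_imp_le, rule rsgf_C_const_pos) (use \<Delta> AB c \<delta> d in auto)
      show "0 \<le> sqrt (real H) * Q * x" using Q x0 by simp
    qed
    finally have CT: "\<kappa> * sqrt (real H) * Q * (1 / \<epsilon>\<^sup>2) \<le> C * sqrt (real T)" .
    have pos: "0 < \<kappa> * sqrt (real H) * Q * (1 / \<epsilon>\<^sup>2)" using \<kappa> H(1) Q \<epsilon> by simp
    have "2 * \<Delta> * ln (2 * real T / p) \<le> 2 * \<Delta> * ((ln (4 * real H) + 6) * Q)"
      using log_le \<Delta> by (intro mult_left_mono) auto
    also have "\<dots> = \<kappa> * Q * (2 * \<Delta> / \<kappa> * ln (4 * exp 6 * real H))" unfolding lnH using \<kappa>(1) by simp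
    also have "\<dots> \<le> \<kappa> * Q * sqrt (real H)" using H(2) \<kappa>(1) Q by (intro mult_left_mono) auto
    also have "\<dots> = \<epsilon>\<^sup>2 * (\<kappa> * sqrt (real H) * Q * (1 / \<epsilon>\<^sup>2))" using \<epsilon> by simp
    also have "\<dots> \<le> \<epsilon>\<^sup>2 * (C * sqrt (real T))" using CT by (intro mult_left_mono) auto
    finally have "2 * \<Delta> * ln (2 * real T / p) / (C * sqrt (real T)) \<le> \<epsilon>\<^sup>2"
      using pos CT by (simp add: pos_divide_le_eq)
    then have "rsgf_T c \<Delta> A B d \<delta> \<epsilon> p \<le> T" unfolding C_def by (rule rsgf_T_le[OF T(3)])
    then have "\<bar>real (rsgf_T c \<Delta> A B d \<delta> \<epsilon> p)\<bar> \<le> 2 * R" using T(2) by simp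
    then show "\<bar>real (rsgf_T c \<Delta> A B d \<delta> \<epsilon> p)\<bar> \<le> 2 * real H * (1 + ln (real d / (\<delta> * \<epsilon> * p)))\<^sup>2 *
        (real d powr (5 / 2) * \<delta> powr (- 1) * \<epsilon> powr (- 4))"
      by (simp only: R_def Q_def X_def mult.assoc)
  qed
qed

lemma level_bounds_exist:
  fixes f :: "'a::euclidean_space \<Rightarrow> real"
  assumes growth: "growth_condition f \<alpha> \<beta>" and \<delta>: "\<delta> > 0" and \<Delta>: "\<Delta> > 0"
    and bounded: "bounded {x. smoothing f \<delta> x \<le> fstar + 2 * \<Delta>}"
  shows "\<exists>A B. level_bounds f fstar \<alpha> \<beta> \<delta> \<Delta> A B"
proof -
  define K where "K = closure {x. smoothing f \<delta> x \<le> fstar + 2 * \<Delta>}"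
  have K: "compact K" using bounded by (simp add: K_def compact_closure)
  have "compact (\<alpha> ` K)"
    using growth_conditionD(1)[OF growth] K by (intro compact_continuous_image) (auto intro: continuous_on_subset)
  then have "\<exists>A. \<forall>y\<in>\<alpha> ` K. norm y \<le> A"
    unfolding bounded_iff[symmetric] by (rule compact_imp_bounded)
  then obtain A where A: "\<forall>y\<in>\<alpha> ` K. norm y \<le> A"
    by (rule exE)
  have "compact ((\<lambda>(x, r). \<beta> x r) ` (K \<times> {0..3 * \<delta> + \<Delta>}))"
  proof (rule compact_continuous_image)
    show "continuous_on (K \<times> {0..3 * \<delta> + \<Delta>}) (\<lambda>(x, r). \<beta> x r)"
      by (rule continuous_on_subset[OF growth_conditionD(3)[OF growth]]) auto
  qed (intro compact_Times K compact_Icc)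
  then have "\<exists>B. \<forall>y\<in>(\<lambda>(x, r). \<beta> x r) ` (K \<times> {0..3 * \<delta> + \<Delta>}). norm y \<le> B"
    unfolding bounded_iff[symmetric] by (rule compact_imp_bounded)
  then obtain B where B: "\<forall>y\<in>(\<lambda>(x, r). \<beta> x r) ` (K \<times> {0..3 * \<delta> + \<Delta>}). norm y \<le> B"
    by (rule exE)
  have "level_bounds f fstar \<alpha> \<beta> \<delta> \<Delta> A B" unfolding level_bounds_def
  proof (intro allI impI conjI ballI)
    fix x assume "smoothing f \<delta> x \<le> fstar + 2 * \<Delta>"
    then have "x \<in> {x. smoothing f \<delta> x \<le> fstar + 2 * \<Delta>}" by simp
    then have x: "x \<in> K" unfolding K_def by (rule subsetD[OF closure_subset])
    show "\<alpha> x \<le> A" using bspec[OF A imageI[OF x]] by simp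
    show "\<beta> x r \<le> B" if "r \<in> {0..3 * \<delta> + \<Delta>}" for r
    proof -
      have "(\<lambda>(x, r). \<beta> x r) (x, r) \<in> (\<lambda>(x, r). \<beta> x r) ` (K \<times> {0..3 * \<delta> + \<Delta>})"
        using x that by (intro imageI) simp
      then have "\<beta> x r \<in> (\<lambda>(x, r). \<beta> x r) ` (K \<times> {0..3 * \<delta> + \<Delta>})" by simp
      from bspec[OF B this] show ?thesis by simp
    qed
  qed
  then show ?thesis by blast
qed

context rsgf_run
begin

lemma level_bounds_nonneg:
  assumes "level_bounds f fstar \<alpha> \<beta> \<delta> \<Delta> A B"
  shows "0 \<le> A" "0 \<le> B"
proof -
  have "S x1 \<le> fstar + 2 * \<Delta>" using \<Delta> \<Delta>_pos by simp
  then have le: "\<alpha> x1 \<le> A" "\<forall>r\<in>{0..3 * \<delta> + \<Delta>}. \<beta> x1 r \<le> B"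
    using assms unfolding level_bounds_def by blast+
  have "0 \<in> {0..3 * \<delta> + \<Delta>}" using \<delta>_pos \<Delta>_pos by simp
  then have "\<beta> x1 0 \<le> B" using le(2) by blast
  then show "0 \<le> A" "0 \<le> B" using le(1) growth_nonneg(1)[of x1] growth_nonneg(2)[where x=x1 and r=0] by linarith+
qed

text \<open>The points at which the step size evaluates \<open>\<beta>\<close> all have radius at most \<open>3 * \<delta> + \<Delta>\<close>.\<close>

lemma rsgf_C_ge_const:
  assumes lb: "level_bounds f fstar \<alpha> \<beta> \<delta> \<Delta> A B" and x: "S x - fstar \<le> 2 * \<Delta>"
  shows "rsgf_C c DIM('a) (\<lambda>_. A) (\<lambda>_ _. B) \<delta> \<Delta> T (0::real) \<le> C x"
proof (rule rsgf_C_ge)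
  let ?C = "rsgf_C c DIM('a) (\<lambda>_. A) (\<lambda>_ _. B) \<delta> \<Delta> T (0::real)"
  let ?\<rho> = "\<Delta> / (real DIM('a) * (\<alpha> x + \<beta> x (3 * \<delta>) + 1) * sqrt (real T))"
  have x': "S x \<le> fstar + 2 * \<Delta>" using x by simp
  have AB: "0 \<le> A" "0 \<le> B" by (rule level_bounds_nonneg[OF lb])+
  have c0: "c > 0" using c_ge by simp
  have lbx: "\<alpha> x \<le> A" "\<forall>r\<in>{0..3 * \<delta> + \<Delta>}. \<beta> x r \<le> B"
    using lb x' unfolding level_bounds_def by blast+
  note \<alpha>A = lbx(1)
  have \<beta>B: "\<beta> x r \<le> B" if "0 \<le> r" "r \<le> 3 * \<delta> + \<Delta>" for r
    using lbx(2) that by simp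
  have \<beta>s: "\<beta> x \<delta> \<le> B" "\<beta> x (2 * \<delta>) \<le> B" "\<beta> x (3 * \<delta>) \<le> B"
    by (rule \<beta>B; use \<delta>_pos \<Delta>_pos in simp)+
  have nn: "0 \<le> \<alpha> x" "0 \<le> \<beta> x \<delta>" "0 \<le> \<beta> x (2 * \<delta>)" "0 \<le> \<beta> x (3 * \<delta>)"
    by (rule growth_nonneg; use \<delta>_pos in simp)+
  have pos: "?C > 0" by (rule rsgf_C_const_pos) (use \<Delta>_pos AB c0 \<delta>_pos d_ge in auto)
  show "?C \<le> \<Delta> / (2 * (real DIM('a) + 1) * (\<alpha> x + \<beta> x (3 * \<delta>) + 1)\<^sup>2)"
  proof -
    have "?C \<le> \<Delta> / (2 * (real DIM('a) + 1) * (A + B + 1)\<^sup>2)" by (rule rsgf_C_le(1))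
    also have "\<dots> \<le> \<Delta> / (2 * (real DIM('a) + 1) * (\<alpha> x + \<beta> x (3 * \<delta>) + 1)\<^sup>2)"
    proof (rule frac_le[OF less_imp_le[OF \<Delta>_pos] order_refl])
      show "0 < 2 * (real DIM('a) + 1) * (\<alpha> x + \<beta> x (3 * \<delta>) + 1)\<^sup>2"
        using nn d_ge by (intro mult_pos_pos zero_less_power) auto
      show "2 * (real DIM('a) + 1) * (\<alpha> x + \<beta> x (3 * \<delta>) + 1)\<^sup>2 \<le> 2 * (real DIM('a) + 1) * (A + B + 1)\<^sup>2"
        using \<alpha>A \<beta>s nn by (intro mult_left_mono power_mono) auto
    qed
    finally show ?thesis .
  qed
  show "?C \<le> sqrt 6 / 12 * (\<Delta> / (rsgf_sigma DIM('a) \<alpha> \<beta> \<delta> x * (\<alpha> x + \<beta> x \<delta>)))"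
    if nz: "rsgf_sigma DIM('a) \<alpha> \<beta> \<delta> x * (\<alpha> x + \<beta> x \<delta>) \<noteq> 0"
  proof -
    let ?s = "rsgf_sigma DIM('a) \<alpha> \<beta> \<delta> x * (\<alpha> x + \<beta> x \<delta>)"
    let ?s' = "rsgf_sigma DIM('a) (\<lambda>_. A) (\<lambda>_ _. B) \<delta> (0::real) * (A + B)"
    have "0 \<le> ?s" using nn by (intro mult_nonneg_nonneg rsgf_sigma_nonneg) auto
    then have s0: "0 < ?s" by (rule le_neq_trans) (rule nz[symmetric])
    have "rsgf_sigma DIM('a) \<alpha> \<beta> \<delta> x \<le> rsgf_sigma DIM('a) (\<lambda>_. A) (\<lambda>_ _. B) \<delta> (0::real)"
      unfolding rsgf_sigma_def using \<alpha>A \<beta>s nn by (intro real_sqrt_le_mono mult_left_mono power_mono) auto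
    then have "?s \<le> ?s'" using \<alpha>A \<beta>s nn by (intro mult_mono rsgf_sigma_nonneg) auto
    then have s0': "0 < ?s'" using s0 by linarith
    have "?C \<le> sqrt 6 / 12 * (\<Delta> / ?s')" by (rule rsgf_C_le(2)) (rule less_imp_neq[OF s0', symmetric])
    also have "\<dots> \<le> sqrt 6 / 12 * (\<Delta> / ?s)"
      by (rule mult_left_mono[OF frac_le[OF less_imp_le[OF \<Delta>_pos] order_refl s0 \<open>?s \<le> ?s'\<close>]]) simp
    finally show ?thesis .
  qed
  show "?C \<le> 1 / (real DIM('a) * (\<alpha> x + \<beta> x (3 * \<delta>))) * sqrt (\<Delta> / rsgf_ell c DIM('a) \<alpha> \<beta> \<delta> x ?\<rho>)"
    if nz: "\<alpha> x + \<beta> x (3 * \<delta>) \<noteq> 0" "rsgf_ell c DIM('a) \<alpha> \<beta> \<delta> x ?\<rho> \<noteq> 0"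
  proof -
    have m0: "0 < \<alpha> x + \<beta> x (3 * \<delta>)" by (rule le_neq_trans[OF _ nz(1)[symmetric]]) (use nn in simp)
    let ?l = "rsgf_ell c DIM('a) \<alpha> \<beta> \<delta> x ?\<rho>"
    let ?l' = "rsgf_ell c DIM('a) (\<lambda>_. A) (\<lambda>_ _. B) \<delta> (0::real) (\<Delta> / (real DIM('a) * (A + B + 1) * sqrt (real T)))"
    have \<rho>: "0 \<le> ?\<rho>" "?\<rho> \<le> \<Delta>"
    proof -
      have "1 * 1 * 1 \<le> real DIM('a) * (\<alpha> x + \<beta> x (3 * \<delta>) + 1) * sqrt (real T)"
        using d_ge m0 T_ge by (intro mult_mono) auto
      then have D: "1 \<le> real DIM('a) * (\<alpha> x + \<beta> x (3 * \<delta>) + 1) * sqrt (real T)" by simp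
      then show "0 \<le> ?\<rho>" using \<Delta>_pos by (intro divide_nonneg_nonneg) linarith+
      have "?\<rho> \<le> \<Delta> / 1" using D \<Delta>_pos by (intro divide_left_mono) auto
      then show "?\<rho> \<le> \<Delta>" by simp
    qed
    have "0 \<le> \<beta> x (?\<rho> + \<delta>)" using \<rho> \<delta>_pos by (intro growth_nonneg) simp
    then have "0 \<le> ?l" unfolding rsgf_ell_def using nn c0 \<delta>_pos by (intro divide_nonneg_nonneg mult_nonneg_nonneg) auto
    then have l0: "0 < ?l" by (rule le_neq_trans) (rule nz(2)[symmetric])
    have "\<beta> x (?\<rho> + \<delta>) \<le> B" using \<rho> \<delta>_pos by (intro \<beta>B) linarith+
    then have l_le: "?l \<le> ?l'" unfolding rsgf_ell_def using \<alpha>A \<beta>s c0 \<delta>_pos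
      by (intro divide_right_mono mult_left_mono) auto
    then have l0': "0 < ?l'" using l0 by linarith
    have m0': "0 < A + B" using m0 \<alpha>A \<beta>s by linarith
    have "?C \<le> 1 / (real DIM('a) * (A + B)) * sqrt (\<Delta> / ?l')"
      by (rule rsgf_C_le(3)) (use m0' l0' in auto)
    also have "\<dots> \<le> 1 / (real DIM('a) * (\<alpha> x + \<beta> x (3 * \<delta>))) * sqrt (\<Delta> / ?l)"
    proof (rule mult_mono)
      show "1 / (real DIM('a) * (A + B)) \<le> 1 / (real DIM('a) * (\<alpha> x + \<beta> x (3 * \<delta>)))"
        using m0 \<alpha>A \<beta>s d_ge by (intro frac_le mult_left_mono mult_pos_pos) auto
      show "sqrt (\<Delta> / ?l') \<le> sqrt (\<Delta> / ?l)"
        by (rule real_sqrt_le_mono[OF frac_le[OF less_imp_le[OF \<Delta>_pos] order_refl l0 l_le]])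
    qed (use m0 l0' \<Delta>_pos in auto)
    finally show ?thesis .
  qed
qed

text \<open>The minimum is at most the weighted average.\<close>

lemma conclusion_min:
  assumes concl: "conclusion w" and lb: "level_bounds f fstar \<alpha> \<beta> \<delta> \<Delta> A B"
    and T: "2 * \<Delta> * ln (2 * real T / p) / (rsgf_C c DIM('a) (\<lambda>_. A) (\<lambda>_ _. B) \<delta> \<Delta> T (0::real) * sqrt (real T)) \<le> \<epsilon>\<^sup>2"
  shows "(MIN t\<in>{1..T}. (norm (G (X w t)))\<^sup>2) \<le> \<epsilon>\<^sup>2"
proof -
  define g where "g t = (norm (G (X w t)))\<^sup>2" for t
  define E where "E = (\<Sum>s=1..T. \<eta> (X w s))"
  define \<mu> where "\<mu> = Min (g ` {1..T})"
  let ?C = "rsgf_C c DIM('a) (\<lambda>_. A) (\<lambda>_ _. B) \<delta> \<Delta> T (0::real)"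
  have E: "E > 0" unfolding E_def using eta_pos T_ge by (intro sum_pos) auto
  have C0: "?C > 0"
    by (rule rsgf_C_const_pos) (use \<Delta>_pos level_bounds_nonneg[OF lb] c_ge \<delta>_pos d_ge in auto)
  have Cpath: "?C \<le> (\<Sum>t=1..T. C (X w t)) / real T"
  proof -
    have "real T * ?C = (\<Sum>t=1..T. ?C)" by simp
    also have "\<dots> \<le> (\<Sum>t=1..T. C (X w t))"
      using concl by (intro sum_mono rsgf_C_ge_const[OF lb]) (auto simp: conclusion_def)
    finally show ?thesis using T_ge by (simp add: pos_le_divide_eq mult.commute)
  qed
  have "\<mu> = (\<Sum>t=1..T. \<eta> (X w t) / E * \<mu>)"
    using E by (simp add: E_def flip: sum_distrib_right sum_divide_distrib)
  also have "\<dots> \<le> (\<Sum>t=1..T. \<eta> (X w t) / E * g t)"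
    using E eta_pos by (intro sum_mono mult_left_mono) (auto simp: \<mu>_def less_imp_le)
  also have "\<dots> \<le> 2 * \<Delta> * ln (2 * real T / p) / ((\<Sum>t=1..T. C (X w t)) / real T * sqrt (real T))"
    using concl unfolding conclusion_def g_def E_def by blast
  also have "\<dots> \<le> 2 * \<Delta> * ln (2 * real T / p) / (?C * sqrt (real T))"
  proof (rule divide_left_mono)
    show "?C * sqrt (real T) \<le> (\<Sum>t=1..T. C (X w t)) / real T * sqrt (real T)"
      using Cpath by (intro mult_right_mono) auto
    show "0 \<le> 2 * \<Delta> * ln (2 * real T / p)" using \<Delta>_pos L_pos by (simp add: L_def)
    show "0 < (\<Sum>t=1..T. C (X w t)) / real T * sqrt (real T) * (?C * sqrt (real T))"
      using C0 Cpath T_sqrt by (intro mult_pos_pos) linarith+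
  qed
  also have "\<dots> \<le> \<epsilon>\<^sup>2" by (rule T)
  finally show ?thesis by (simp add: \<mu>_def g_def[abs_def])
qed

theorem prob_min_gradient:
  assumes lb: "level_bounds f fstar \<alpha> \<beta> \<delta> \<Delta> A B"
    and T: "2 * \<Delta> * ln (2 * real T / p) / (rsgf_C c DIM('a) (\<lambda>_. A) (\<lambda>_ _. B) \<delta> \<Delta> T (0::real) * sqrt (real T)) \<le> \<epsilon>\<^sup>2"
  shows "measure N {w \<in> space N. (MIN t\<in>{1..T}. (norm (G (X w t)))\<^sup>2) \<le> \<epsilon>\<^sup>2} \<ge> 1 - p"
proof -
  interpret prob_space N by (rule prob_space_noise)
  have "{w \<in> space N. (MIN t\<in>{1..T}. (norm (G (X w t)))\<^sup>2) \<le> \<epsilon>\<^sup>2}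
      = (\<Union>t\<in>{1..T}. {w \<in> space N. (norm (G (X w t)))\<^sup>2 \<le> \<epsilon>\<^sup>2})"
    using T_ge by (auto simp: Min_le_iff)
  also have "\<dots> \<in> sets N"
  proof (rule sets.finite_UN)
    fix t assume t: "t \<in> {1..T}"
    have [measurable]: "(\<lambda>w. X w t) \<in> N \<rightarrow>\<^sub>M borel" by (rule X_measurable) (use t in simp)
    show "{w \<in> space N. (norm (G (X w t)))\<^sup>2 \<le> \<epsilon>\<^sup>2} \<in> sets N" by measurable
  qed simp
  finally have sets: "{w \<in> space N. (MIN t\<in>{1..T}. (norm (G (X w t)))\<^sup>2) \<le> \<epsilon>\<^sup>2} \<in> sets N" .
  have "measure N {w \<in> space N. conclusion w} \<le> measure N {w \<in> space N. (MIN t\<in>{1..T}. (norm (G (X w t)))\<^sup>2) \<le> \<epsilon>\<^sup>2}"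
    using conclusion_min[OF _ lb T] by (intro finite_measure_mono sets) auto
  then show ?thesis using prob_conclusion by simp
qed

lemma arg_min_goldstein_stationary:
  assumes \<epsilon>: "\<epsilon> > 0" and min: "(MIN t\<in>{1..T}. (norm (G (X w t)))\<^sup>2) \<le> \<epsilon>\<^sup>2"
    and arg: "is_arg_min (\<lambda>z. norm (G z)) (\<lambda>z. z \<in> (\<lambda>t. X w t) ` {1..T}) y"
  shows "goldstein_stationary f \<delta> \<epsilon> y"
proof -
  have "\<exists>t\<in>{1..T}. (norm (G (X w t)))\<^sup>2 \<le> \<epsilon>\<^sup>2" using min T_ge by (subst (asm) Min_le_iff) auto
  then obtain t where t: "t \<in> {1..T}" "(norm (G (X w t)))\<^sup>2 \<le> \<epsilon>\<^sup>2" by blast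
  have "norm (G (X w t)) \<le> \<epsilon>" by (rule power2_le_imp_le[OF t(2)]) (use \<epsilon> in simp)
  moreover have "norm (G y) \<le> norm (G (X w t))" using arg imageI[OF t(1), of "\<lambda>t. X w t"] unfolding is_arg_min_def not_less[symmetric] by blast
  ultimately have "norm (G y) \<le> \<epsilon>" by linarith
  then show ?thesis by (rule goldstein_stationaryI[OF compact_goldstein G_in_goldstein])
qed

end

lemma length_concat_map_pair: "length (concat (map (\<lambda>t. let x = g t in [a x t, b x t]) ts)) = 2 * length ts"
  by (induction ts) (auto simp: Let_def)

theorem theorem1:
  fixes f :: "'a::euclidean_space \<Rightarrow> real"
    and \<alpha> :: "'a \<Rightarrow> real" and \<beta> :: "'a \<Rightarrow> real \<Rightarrow> real"
    and fstar \<delta> p \<Delta> c :: real and x1 :: 'a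
  assumes c_pos: "c > 0"
    and c_smooth: "\<And>(g :: 'a \<Rightarrow> real) a b s x y.
          locally_lipschitz g \<Longrightarrow> growth_condition g a b \<Longrightarrow> s > 0 \<Longrightarrow>
          norm (gradient (smoothing g s) x - gradient (smoothing g s) y)
            \<le> rsgf_ell c DIM('a) a b s x (norm (x - y)) * norm (x - y)"
    and lip: "locally_lipschitz f"
    and bounded_below: "\<And>x. fstar \<le> f x"
    and growth: "growth_condition f \<alpha> \<beta>"
    and \<delta>_pos: "\<delta> > 0"
    and level_bounded: "\<And>\<nu>. bounded {x. smoothing f \<delta> x \<le> \<nu>}"
    and p: "0 < p" "p < 1"
    and \<Delta>: "\<Delta> > smoothing f \<delta> x1 - fstar"
  shows
    "(\<forall>T\<ge>1.
       \<P>(w in rsgf_noise T.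
          let x = rsgf_iter f c \<alpha> \<beta> \<delta> \<Delta> p T x1 w;
              \<eta> = (\<lambda>t. rsgf_eta c DIM('a) \<alpha> \<beta> \<delta> \<Delta> p T (x t));
              Cpath = (\<Sum>t=1..T. rsgf_C c DIM('a) \<alpha> \<beta> \<delta> \<Delta> T (x t)) / real T
          in (\<forall>t\<in>{1..T}. smoothing f \<delta> (x t) - fstar \<le> 2 * \<Delta>) \<and>
             (\<Sum>t=1..T. \<eta> t / (\<Sum>s=1..T. \<eta> s) * (norm (gradient (smoothing f \<delta>) (x t)))\<^sup>2)
               \<le> 2 * \<Delta> * ln (2 * real T / p) / (Cpath * sqrt (real T)))
       \<ge> 1 - p)
     \<and> (\<exists>A B. level_bounds f fstar \<alpha> \<beta> \<delta> \<Delta> A B)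
     \<and> (\<forall>A B. level_bounds f fstar \<alpha> \<beta> \<delta> \<Delta> A B \<longrightarrow>
          soft_O (\<lambda>d \<delta> \<epsilon> p. real (rsgf_T c \<Delta> A B d \<delta> \<epsilon> p))
                 (\<lambda>d \<delta> \<epsilon>. real d powr (5/2) * \<delta> powr (-1) * \<epsilon> powr (-4)) \<and>
          soft_O (\<lambda>d \<delta> \<epsilon> p. real (2 * rsgf_T c \<Delta> A B d \<delta> \<epsilon> p))
                 (\<lambda>d \<delta> \<epsilon>. real d powr (5/2) * \<delta> powr (-1) * \<epsilon> powr (-4)) \<and>
          (\<forall>\<epsilon>>0. let T = rsgf_T c \<Delta> A B DIM('a) \<delta> \<epsilon> p in
             T \<ge> 1 \<and>
             \<P>(w in rsgf_noise T.
                let x = rsgf_iter f c \<alpha> \<beta> \<delta> \<Delta> p T x1 w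
                in (MIN t\<in>{1..T}. (norm (gradient (smoothing f \<delta>) (x t)))\<^sup>2) \<le> \<epsilon>\<^sup>2) \<ge> 1 - p \<and>
             (\<forall>w\<in>space (rsgf_noise T).
                let x = rsgf_iter f c \<alpha> \<beta> \<delta> \<Delta> p T x1 w
                in length (rsgf_queries f c \<alpha> \<beta> \<delta> \<Delta> p T x1 w) = 2 * T \<and>
                   ((MIN t\<in>{1..T}. (norm (gradient (smoothing f \<delta>) (x t)))\<^sup>2) \<le> \<epsilon>\<^sup>2 \<longrightarrow>
                    (\<forall>xt. is_arg_min (\<lambda>z. norm (gradient (smoothing f \<delta>) z)) (\<lambda>z. z \<in> x ` {1..T}) xt
                       \<longrightarrow> goldstein_stationary f \<delta> \<epsilon> xt)))))"
proof -
  have c_ge: "c \<ge> 1 / 2"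
    using smoothness_constant_ge_half[OF c_pos c_smooth] .
  have run: "rsgf_run f \<alpha> \<beta> fstar \<delta> p \<Delta> c x1 T" if "T \<ge> 1" for T
    by (unfold_locales; fact lip bounded_below growth \<delta>_pos p \<Delta> c_ge that c_smooth[OF lip growth \<delta>_pos])
  interpret run1: rsgf_run f \<alpha> \<beta> fstar \<delta> p \<Delta> c x1 1 by (rule run) simp
  have \<Delta>_pos: "\<Delta> > 0" by (rule run1.\<Delta>_pos)
  show ?thesis
  proof (intro conjI allI impI)
    fix T :: nat assume "1 \<le> T"
    then interpret rsgf_run f \<alpha> \<beta> fstar \<delta> p \<Delta> c x1 T by (rule run)
    show "\<P>(w in rsgf_noise T.
          let x = rsgf_iter f c \<alpha> \<beta> \<delta> \<Delta> p T x1 w;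
              \<eta> = (\<lambda>t. rsgf_eta c DIM('a) \<alpha> \<beta> \<delta> \<Delta> p T (x t));
              Cpath = (\<Sum>t=1..T. rsgf_C c DIM('a) \<alpha> \<beta> \<delta> \<Delta> T (x t)) / real T
          in (\<forall>t\<in>{1..T}. smoothing f \<delta> (x t) - fstar \<le> 2 * \<Delta>) \<and>
             (\<Sum>t=1..T. \<eta> t / (\<Sum>s=1..T. \<eta> s) * (norm (gradient (smoothing f \<delta>) (x t)))\<^sup>2)
               \<le> 2 * \<Delta> * ln (2 * real T / p) / (Cpath * sqrt (real T)))
       \<ge> 1 - p"
      using prob_conclusion unfolding conclusion_def Let_def .
  next
    show "\<exists>A B. level_bounds f fstar \<alpha> \<beta> \<delta> \<Delta> A B"
      by (rule level_bounds_exist[OF growth \<delta>_pos \<Delta>_pos level_bounded])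
  next
    fix A B assume lb: "level_bounds f fstar \<alpha> \<beta> \<delta> \<Delta> A B"
    have AB: "0 \<le> A" "0 \<le> B" by (rule run1.level_bounds_nonneg[OF lb])+
    show O: "soft_O (\<lambda>d \<delta> \<epsilon> p. real (rsgf_T c \<Delta> A B d \<delta> \<epsilon> p))
        (\<lambda>d \<delta> \<epsilon>. real d powr (5/2) * \<delta> powr (-1) * \<epsilon> powr (-4))"
      by (rule soft_O_rsgf_T[OF \<Delta>_pos AB c_pos])
    show "soft_O (\<lambda>d \<delta> \<epsilon> p. real (2 * rsgf_T c \<Delta> A B d \<delta> \<epsilon> p))
        (\<lambda>d \<delta> \<epsilon>. real d powr (5/2) * \<delta> powr (-1) * \<epsilon> powr (-4))"
      using soft_O_mult[OF O] by simp
    fix \<epsilon> :: real assume \<epsilon>: "0 < \<epsilon>"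
    define T where "T = rsgf_T c \<Delta> A B DIM('a) \<delta> \<epsilon> p"
    have d: "1 \<le> DIM('a)" using DIM_positive[where 'a='a] by simp
    have T: "1 \<le> T"
      "2 * \<Delta> * ln (2 * real T / p) / (rsgf_C c DIM('a) (\<lambda>_. A) (\<lambda>_ _. B) \<delta> \<Delta> T (0::real) * sqrt (real T)) \<le> \<epsilon>\<^sup>2"
      unfolding T_def by (rule rsgf_T_exists[OF \<Delta>_pos AB c_pos \<delta>_pos d \<epsilon> p(1)])+
    interpret rsgf_run f \<alpha> \<beta> fstar \<delta> p \<Delta> c x1 T by (rule run[OF T(1)])
    show "let T = rsgf_T c \<Delta> A B DIM('a) \<delta> \<epsilon> p in
             T \<ge> 1 \<and>
             \<P>(w in rsgf_noise T.
                let x = rsgf_iter f c \<alpha> \<beta> \<delta> \<Delta> p T x1 w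
                in (MIN t\<in>{1..T}. (norm (gradient (smoothing f \<delta>) (x t)))\<^sup>2) \<le> \<epsilon>\<^sup>2) \<ge> 1 - p \<and>
             (\<forall>w\<in>space (rsgf_noise T).
                let x = rsgf_iter f c \<alpha> \<beta> \<delta> \<Delta> p T x1 w
                in length (rsgf_queries f c \<alpha> \<beta> \<delta> \<Delta> p T x1 w) = 2 * T \<and>
                   ((MIN t\<in>{1..T}. (norm (gradient (smoothing f \<delta>) (x t)))\<^sup>2) \<le> \<epsilon>\<^sup>2 \<longrightarrow>
                    (\<forall>xt. is_arg_min (\<lambda>z. norm (gradient (smoothing f \<delta>) z)) (\<lambda>z. z \<in> x ` {1..T}) xt
                       \<longrightarrow> goldstein_stationary f \<delta> \<epsilon> xt)))"
      unfolding T_def[symmetric] Let_def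
    proof (intro conjI ballI impI allI)
      show "1 \<le> T" by (rule T)
      show "1 - p \<le> \<P>(w in rsgf_noise T. (MIN t\<in>{1..T}. (norm (gradient (smoothing f \<delta>) (rsgf_iter f c \<alpha> \<beta> \<delta> \<Delta> p T x1 w t)))\<^sup>2) \<le> \<epsilon>\<^sup>2)"
        by (rule prob_min_gradient[OF lb T(2)])
    next
      fix w
      show "length (rsgf_queries f c \<alpha> \<beta> \<delta> \<Delta> p T x1 w) = 2 * T"
        unfolding rsgf_queries_def by (subst length_concat_map_pair) simp
      fix xt
      assume "(MIN t\<in>{1..T}. (norm (gradient (smoothing f \<delta>) (rsgf_iter f c \<alpha> \<beta> \<delta> \<Delta> p T x1 w t)))\<^sup>2) \<le> \<epsilon>\<^sup>2"
        and "is_arg_min (\<lambda>z. norm (gradient (smoothing f \<delta>) z)) (\<lambda>z. z \<in> rsgf_iter f c \<alpha> \<beta> \<delta> \<Delta> p T x1 w ` {1..T}) xt"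
      then show "goldstein_stationary f \<delta> \<epsilon> xt" by (rule arg_min_goldstein_stationary[OF \<epsilon>])
    qed
  qed
qed

end
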